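(* If metric spaces $\mathcal{M}_i$ converge to $\mathcal{M}$ in the Gromov-Hausdorff sense, the minimizing indices $minind(\mathcal{M}_i)$ need not converge to $minind(\mathcal{M})$. In particular, as $p\to\infty$ through the primes, the doubled regular $p$-gons $X_p$ converge in the Gromov-Hausdorff sense to the doubled disk $X_\infty$ and $minind(X_p)\to\infty$, whereas $$minind\left(\lim_{p\to\infty}X_p\right)=minind(X_\infty)=2.$$
   Context: $X_n$ ($n\ge 3$) is the metric space obtained by gluing two copies (front and back) of a regular Euclidean $n$-gon along their common boundary, with the induced length metric; the polygons are normalized to have inradius $1$. $X_\infty$ is obtained in the same way from two copies of the closed Euclidean unit disk. A closed geodesic is a nonconstant, constant speed, locally length-minimizing closed curve $\gamma\colon S^1=[0,2\pi]/(0\sim 2\pi)\to \mathcal{M}$ in a metric space $(\mathcal{M},d_{\mathcal M})$; let $L$ be its length. For an integer $k\ge 2$, $\gamma$ is a $1/k$ geodesic if $d_{\mathcal M}(\gamma(t),\gamma(t+2\pi/k))=L/k$ for every $t\in S^1$. The minimizing index $minind(\mathcal{M})$ is the smallest integer $k\ge 2$ such that $\mathcal{M}$ admits a $1/k$ geodesic. *)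

theory Defs
  imports "HOL-Analysis.Analysis" "HOL-Computational_Algebra.Primes"
begin

section \<open>Gromov-Hausdorff distance\<close>

definition hausdorff_dist :: "'a metric \<Rightarrow> 'a set \<Rightarrow> 'a set \<Rightarrow> ennreal" where
  "hausdorff_dist Z A B =
     max (SUP a\<in>A. INF b\<in>B. ennreal (mdist Z a b)) (SUP b\<in>B. INF a\<in>A. ennreal (mdist Z a b))"

definition isometric_embedding :: "'a metric \<Rightarrow> 'b metric \<Rightarrow> ('a \<Rightarrow> 'b) \<Rightarrow> bool" where
  "isometric_embedding M N f \<longleftrightarrow>
     f ` mspace M \<subseteq> mspace N \<and>
     (\<forall>x\<in>mspace M. \<forall>y\<in>mspace M. mdist N (f x) (f y) = mdist M x y)"

text \<open>The ambient space \<open>Z\<close> ranges over metrics on the sum type only. This loses nothing: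
  only the subspace formed by the two images matters, and it embeds into \<open>'a + 'b\<close>.\<close>

definition gromov_hausdorff_dist :: "'a metric \<Rightarrow> 'b metric \<Rightarrow> ennreal" where
  "gromov_hausdorff_dist M N =
     Inf {hausdorff_dist Z (f ` mspace M) (g ` mspace N) | (Z :: ('a + 'b) metric) f g.
            isometric_embedding M Z f \<and> isometric_embedding N Z g}"

definition gromov_hausdorff_tendsto ::
    "('i \<Rightarrow> 'a metric) \<Rightarrow> 'b metric \<Rightarrow> 'i filter \<Rightarrow> bool" where
  "gromov_hausdorff_tendsto M N F \<longleftrightarrow> ((\<lambda>i. gromov_hausdorff_dist (M i) N) \<longlongrightarrow> 0) F"


section \<open>Closed geodesics and the minimizing index\<close>

definition curve_length :: "'a metric \<Rightarrow> (real \<Rightarrow> 'a) \<Rightarrow> real \<Rightarrow> real \<Rightarrow> ennreal" where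
  "curve_length M \<gamma> a b =
     (SUP ts\<in>{ts. sorted ts \<and> set ts \<subseteq> {a..b}}.
        \<Sum>i<length ts - 1. ennreal (mdist M (\<gamma> (ts ! i)) (\<gamma> (ts ! Suc i))))"

definition curve_on :: "'a metric \<Rightarrow> (real \<Rightarrow> 'a) \<Rightarrow> real \<Rightarrow> real \<Rightarrow> bool" where
  "curve_on M \<gamma> a b \<longleftrightarrow> continuous_map (top_of_set {a..b}) (mtopology_of M) \<gamma>"

definition length_minimizing_on :: "'a metric \<Rightarrow> (real \<Rightarrow> 'a) \<Rightarrow> real \<Rightarrow> real \<Rightarrow> bool" where
  "length_minimizing_on M \<gamma> a b \<longleftrightarrow>
     (\<forall>\<eta>. curve_on M \<eta> a b \<and> \<eta> a = \<gamma> a \<and> \<eta> b = \<gamma> b \<longrightarrow>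
          curve_length M \<gamma> a b \<le> curve_length M \<eta> a b)"

text \<open>A closed curve on \<open>[0,2\<pi>]/(0 \<sim> 2\<pi>)\<close> is given by its \<open>2\<pi>\<close>-periodic lift to the real line.\<close>

definition closed_geodesic :: "'a metric \<Rightarrow> (real \<Rightarrow> 'a) \<Rightarrow> bool" where
  "closed_geodesic M \<gamma> \<longleftrightarrow>
     continuous_map euclideanreal (mtopology_of M) \<gamma> \<and>
     (\<forall>t. \<gamma> (t + 2 * pi) = \<gamma> t) \<and>
     (\<exists>s t. \<gamma> s \<noteq> \<gamma> t) \<and>
     (\<exists>v\<ge>0. \<forall>a b. a \<le> b \<longrightarrow> curve_length M \<gamma> a b = ennreal (v * (b - a))) \<and>
     (\<forall>t. \<exists>a b. a < t \<and> t < b \<and> length_minimizing_on M \<gamma> a b)"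

definition one_over_geodesic :: "nat \<Rightarrow> 'a metric \<Rightarrow> (real \<Rightarrow> 'a) \<Rightarrow> bool" where
  "one_over_geodesic k M \<gamma> \<longleftrightarrow>
     closed_geodesic M \<gamma> \<and>
     (\<forall>t. mdist M (\<gamma> t) (\<gamma> (t + 2 * pi / real k)) = enn2real (curve_length M \<gamma> 0 (2 * pi)) / real k)"

definition admits_one_over_geodesic :: "nat \<Rightarrow> 'a metric \<Rightarrow> bool" where
  "admits_one_over_geodesic k M \<longleftrightarrow> (\<exists>\<gamma>. one_over_geodesic k M \<gamma>)"

text \<open>If there is no such \<open>k\<close>, the value is unspecified: it is then the same unknown number for all
  such spaces.\<close>

definition minind :: "'a metric \<Rightarrow> nat" where
  "minind M = (LEAST k. 2 \<le> k \<and> admits_one_over_geodesic k M)"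


section \<open>Gluing\<close>

text \<open>The quotient semimetric obtained by gluing a (possibly infinite) distance \<open>d\<close> on \<open>S\<close> along an
  equivalence relation \<open>R\<close>, for two equivalence classes \<open>A\<close> and \<open>B\<close>: the infimum of
  \<open>d(p\<^sub>0,q\<^sub>0) + \<dots> + d(p\<^sub>n,q\<^sub>n)\<close> over all chains that start in \<open>A\<close>, end in \<open>B\<close> and jump
  for free from \<open>q\<^sub>i\<close> to an equivalent \<open>p\<^sub>i\<^sub>+\<^sub>1\<close>.\<close>

definition glue_chains :: "'a set \<Rightarrow> 'a rel \<Rightarrow> 'a set \<Rightarrow> 'a set \<Rightarrow> (nat \<times> (nat \<Rightarrow> 'a) \<times> (nat \<Rightarrow> 'a)) set" where
  "glue_chains S R A B =
     {(n, p, q). (\<forall>i\<le>n. p i \<in> S \<and> q i \<in> S) \<and> p 0 \<in> A \<and> q n \<in> B \<and>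
                 (\<forall>i<n. (q i, p (Suc i)) \<in> R)}"

definition glue_dist ::
    "'a set \<Rightarrow> ('a \<Rightarrow> 'a \<Rightarrow> ennreal) \<Rightarrow> 'a rel \<Rightarrow> 'a set \<Rightarrow> 'a set \<Rightarrow> ennreal" where
  "glue_dist S d R A B = (INF (n, p, q)\<in>glue_chains S R A B. \<Sum>i\<le>n. d (p i) (q i))"

datatype sheet = Front | Back

definition two_sheets :: "complex set \<Rightarrow> (complex \<times> sheet) set" where
  "two_sheets K = K \<times> UNIV"

definition sheet_dist :: "complex \<times> sheet \<Rightarrow> complex \<times> sheet \<Rightarrow> ennreal" where
  "sheet_dist x y = (if snd x = snd y then ennreal (dist (fst x) (fst y)) else \<infinity>)"

definition boundary_rel :: "complex set \<Rightarrow> (complex \<times> sheet) rel" where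
  "boundary_rel K = {((z, s), (w, t)). z \<in> K \<and> w = z \<and> (s = t \<or> z \<in> frontier K)}"

text \<open>For compact nonempty \<open>K\<close> this is a metric space (\<open>compact_set.Metric_space_doubling\<close>); if
  \<open>K\<close> is also convex, its metric is the induced length metric (\<open>doubling_length_metric\<close>).\<close>

definition doubling :: "complex set \<Rightarrow> (complex \<times> sheet) set metric" where
  "doubling K =
     metric (two_sheets K // boundary_rel K,
             \<lambda>A B. enn2real (glue_dist (two_sheets K) sheet_dist (boundary_rel K) A B))"

text \<open>A regular \<open>n\<close>-gon with circumradius \<open>1 / cos (\<pi> / n)\<close> has inradius \<open>1\<close>.\<close>

definition regular_polygon :: "nat \<Rightarrow> complex set" where
  "regular_polygon n =
     convex hull ((\<lambda>j. complex_of_real (1 / cos (pi / real n)) * cis (2 * pi * real j / real n)) ` {..<n})"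

definition doubled_polygon :: "nat \<Rightarrow> (complex \<times> sheet) set metric" where
  "doubled_polygon n = doubling (regular_polygon n)"

definition doubled_disk :: "(complex \<times> sheet) set metric" where
  "doubled_disk = doubling (cball 0 1)"


section \<open>The doubling is a length space\<close>

lemma equiv_boundary_rel: "equiv (two_sheets K) (boundary_rel K)"
  by (auto simp: equiv_def refl_on_def sym_def trans_def boundary_rel_def two_sheets_def)

lemma boundary_rel_in: "(x, y) \<in> boundary_rel K \<Longrightarrow> x \<in> two_sheets K \<and> y \<in> two_sheets K"
  by (auto simp: boundary_rel_def two_sheets_def)

text \<open>The shortest crossing between points on the two sheets.\<close>

definition cross_dist :: "complex set \<Rightarrow> complex \<times> sheet \<Rightarrow> complex \<times> sheet \<Rightarrow> real" where
  "cross_dist K x y =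
     (if snd x = snd y then dist (fst x) (fst y)
      else INF a\<in>frontier K. dist (fst x) a + dist a (fst y))"

locale compact_set =
  fixes K :: "complex set"
  assumes compact: "compact K" and nonempty: "K \<noteq> {}"
begin

lemma frontier_nonempty: "frontier K \<noteq> {}"
  using compact nonempty frontier_eq_empty[of K] not_bounded_UNIV compact_imp_bounded by metis

lemma compact_frontier: "compact (frontier K)"
  using compact compact_frontier by blast

lemma frontier_sub: "frontier K \<subseteq> K"
  using compact compact_imp_closed frontier_subset_closed by blast

lemma cross_bdd: "bdd_below ((\<lambda>a. dist z a + dist a w) ` frontier K)"
  by (rule bdd_belowI2[of _ 0]) simp

lemma cross_attained:
  obtains a where "a \<in> frontier K" "(INF a\<in>frontier K. dist z a + dist a w) = dist z a + dist a w"
proof -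
  have "continuous_on (frontier K) (\<lambda>a. dist z a + dist a w)"
    by (intro continuous_intros)
  from continuous_attains_inf[OF compact_frontier frontier_nonempty this]
  obtain a where a: "a \<in> frontier K" "\<forall>b\<in>frontier K. dist z a + dist a w \<le> dist z b + dist b w"
    by blast
  have "(INF a\<in>frontier K. dist z a + dist a w) = dist z a + dist a w"
  proof (rule antisym)
    show "(INF a\<in>frontier K. dist z a + dist a w) \<le> dist z a + dist a w"
      by (rule cINF_lower[OF cross_bdd a(1)])
    show "dist z a + dist a w \<le> (INF a\<in>frontier K. dist z a + dist a w)"
      by (rule cINF_greatest[OF frontier_nonempty]) (use a in auto)
  qed
  with a that show thesis by blast
qed

lemma cross_dist_cases:
  assumes "snd x \<noteq> snd y"
  obtains a where "a \<in> frontier K" "cross_dist K x y = dist (fst x) a + dist a (fst y)"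
  using cross_attained[of "fst x" "fst y"] assms unfolding cross_dist_def by metis

lemma cross_dist_le:
  assumes "a \<in> frontier K"
  shows "cross_dist K x y \<le> dist (fst x) a + dist a (fst y)"
  using cINF_lower[OF cross_bdd assms, of "fst x" "fst y"] dist_triangle[of "fst x" "fst y" a]
  by (auto simp: cross_dist_def)

lemma cross_dist_ge: "dist (fst x) (fst y) \<le> cross_dist K x y"
proof (cases "snd x = snd y")
  case False
  then obtain a where "cross_dist K x y = dist (fst x) a + dist a (fst y)"
    by (rule cross_dist_cases)
  then show ?thesis using dist_triangle[of "fst x" "fst y" a] by simp
qed (simp add: cross_dist_def)

lemma cross_dist_nonneg: "0 \<le> cross_dist K x y"
  using cross_dist_ge[of x y] zero_le_dist order_trans by blast

lemma cross_dist_commute: "cross_dist K x y = cross_dist K y x"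
  by (simp add: cross_dist_def dist_commute add.commute)

lemma cross_dist_triangle: "cross_dist K x z \<le> cross_dist K x y + cross_dist K y z"
proof (cases "snd x = snd y")
  case xy: True
  show ?thesis
  proof (cases "snd y = snd z")
    case True
    then show ?thesis using xy dist_triangle by (simp add: cross_dist_def)
  next
    case False
    then obtain a where a: "a \<in> frontier K" "cross_dist K y z = dist (fst y) a + dist a (fst z)"
      by (rule cross_dist_cases)
    have "cross_dist K x y = dist (fst x) (fst y)" using xy by (simp add: cross_dist_def)
    then show ?thesis
      using cross_dist_le[OF a(1), of x z] a(2) dist_triangle[of "fst x" a "fst y"] by linarith
  qed
next
  case xy: False
  then obtain a where a: "a \<in> frontier K" "cross_dist K x y = dist (fst x) a + dist a (fst y)"
    by (rule cross_dist_cases)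
  show ?thesis
    using cross_dist_le[OF a(1), of x z] a(2) dist_triangle[of a "fst z" "fst y"]
      cross_dist_ge[of y z] by linarith
qed

lemma cross_dist_rel_zero: "(x, y) \<in> boundary_rel K \<Longrightarrow> cross_dist K x y = 0"
proof -
  assume r: "(x, y) \<in> boundary_rel K"
  have eq: "fst y = fst x" using r by (auto simp: boundary_rel_def)
  consider "snd x = snd y" | "fst x \<in> frontier K" using r by (auto simp: boundary_rel_def)
  then show "cross_dist K x y = 0"
  proof cases
    case 2
    from cross_dist_le[OF this, of x y] cross_dist_nonneg[of x y] eq show ?thesis by simp
  qed (simp add: cross_dist_def eq)
qed

lemma cross_dist_zero_rel:
  assumes "x \<in> two_sheets K" "cross_dist K x y = 0"
  shows "(x, y) \<in> boundary_rel K"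
proof -
  have eq: "fst x = fst y" using cross_dist_ge[of x y] assms(2) by simp
  show ?thesis
  proof (cases "snd x = snd y")
    case True
    then show ?thesis using eq assms(1) by (auto simp: boundary_rel_def two_sheets_def)
  next
    case False
    then obtain a where a: "a \<in> frontier K" "cross_dist K x y = dist (fst x) a + dist a (fst y)"
      by (rule cross_dist_cases)
    then have "dist (fst x) a = 0"
      using assms(2) zero_le_dist[of "fst x" a] zero_le_dist[of a "fst y"] by linarith
    then show ?thesis using a(1) eq assms(1) by (auto simp: boundary_rel_def two_sheets_def)
  qed
qed

lemma sheet_dist_ge: "ennreal (cross_dist K x y) \<le> sheet_dist x y"
  by (simp add: sheet_dist_def cross_dist_def)

lemma chain_ge:
  assumes "\<forall>i<n. (q i, p (Suc i)) \<in> boundary_rel K"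
  shows "ennreal (cross_dist K (p 0) (q n)) \<le> (\<Sum>i\<le>n. sheet_dist (p i) (q i))"
  using assms
proof (induction n)
  case 0
  then show ?case by (simp add: sheet_dist_ge)
next
  case (Suc n)
  have "cross_dist K (q n) (p (Suc n)) = 0" using Suc.prems by (intro cross_dist_rel_zero) auto
  then have "cross_dist K (p 0) (q (Suc n)) \<le> cross_dist K (p 0) (q n) + cross_dist K (p (Suc n)) (q (Suc n))"
    using cross_dist_triangle[of "p 0" "q (Suc n)" "q n"]
      cross_dist_triangle[of "q n" "q (Suc n)" "p (Suc n)"] by linarith
  then have "ennreal (cross_dist K (p 0) (q (Suc n))) \<le>
      ennreal (cross_dist K (p 0) (q n)) + ennreal (cross_dist K (p (Suc n)) (q (Suc n)))"
    by (simp add: cross_dist_nonneg ennreal_leI flip: ennreal_plus)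
  also have "\<dots> \<le> (\<Sum>i\<le>n. sheet_dist (p i) (q i)) + sheet_dist (p (Suc n)) (q (Suc n))"
    using Suc by (intro add_mono sheet_dist_ge) auto
  finally show ?case by simp
qed

lemma glue_dist_eq:
  assumes x: "x \<in> two_sheets K" and y: "y \<in> two_sheets K"
  shows "glue_dist (two_sheets K) sheet_dist (boundary_rel K)
           (boundary_rel K `` {x}) (boundary_rel K `` {y}) = ennreal (cross_dist K x y)"
proof (rule antisym)
  let ?C = "glue_chains (two_sheets K) (boundary_rel K) (boundary_rel K `` {x}) (boundary_rel K `` {y})"
  have self: "(u, u) \<in> boundary_rel K" if "u \<in> two_sheets K" for u
    using that by (auto simp: boundary_rel_def two_sheets_def)
  show "glue_dist (two_sheets K) sheet_dist (boundary_rel K)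
           (boundary_rel K `` {x}) (boundary_rel K `` {y}) \<le> ennreal (cross_dist K x y)"
  proof (cases "snd x = snd y")
    case True
    have "(0, (\<lambda>_. x), (\<lambda>_. y)) \<in> ?C" using x y self by (auto simp: glue_chains_def)
    then have "glue_dist (two_sheets K) sheet_dist (boundary_rel K)
        (boundary_rel K `` {x}) (boundary_rel K `` {y}) \<le> sheet_dist x y"
      unfolding glue_dist_def by (rule INF_lower2) simp
    then show ?thesis using True by (simp add: sheet_dist_def cross_dist_def)
  next
    case False
    then obtain a where a: "a \<in> frontier K" "cross_dist K x y = dist (fst x) a + dist a (fst y)"
      by (rule cross_dist_cases)
    have aK: "a \<in> K" using a frontier_sub by auto
    have "(1, (\<lambda>i. if i = 0 then x else (a, snd y)), (\<lambda>i. if i = 0 then (a, snd x) else y)) \<in> ?C"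
      using x y self a(1) aK by (auto simp: glue_chains_def two_sheets_def boundary_rel_def)
    then have "glue_dist (two_sheets K) sheet_dist (boundary_rel K)
        (boundary_rel K `` {x}) (boundary_rel K `` {y}) \<le>
        sheet_dist x (a, snd x) + sheet_dist (a, snd y) y"
      unfolding glue_dist_def by (rule INF_lower2) simp
    then show ?thesis using a(2) by (simp add: sheet_dist_def flip: ennreal_plus)
  qed
  show "ennreal (cross_dist K x y) \<le> glue_dist (two_sheets K) sheet_dist (boundary_rel K)
           (boundary_rel K `` {x}) (boundary_rel K `` {y})"
    unfolding glue_dist_def
  proof (rule INF_greatest, clarify)
    fix n p q assume c: "(n, p, q) \<in> ?C"
    have "cross_dist K x (p 0) = 0" "cross_dist K y (q n) = 0"
      using c by (auto simp: glue_chains_def intro: cross_dist_rel_zero)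
    then have "cross_dist K x y \<le> cross_dist K (p 0) (q n)"
      using cross_dist_triangle[of x y "p 0"] cross_dist_triangle[of "p 0" y "q n"]
        cross_dist_commute[of y "q n"] by linarith
    also have "ennreal \<dots> \<le> (\<Sum>i\<le>n. sheet_dist (p i) (q i))"
      using c by (intro chain_ge) (auto simp: glue_chains_def)
    finally show "ennreal (cross_dist K x y) \<le> (\<Sum>i\<le>n. sheet_dist (p i) (q i))"
      by (simp add: ennreal_leI)
  qed
qed

lemma sheet_dist_commute: "sheet_dist x y = sheet_dist y x"
  by (auto simp: sheet_dist_def dist_commute)

lemma glue_dist_commute:
  "glue_dist (two_sheets K) sheet_dist (boundary_rel K) A B =
   glue_dist (two_sheets K) sheet_dist (boundary_rel K) B A"
proof -
  have *: "glue_dist (two_sheets K) sheet_dist (boundary_rel K) A B \<le>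
      glue_dist (two_sheets K) sheet_dist (boundary_rel K) B A" for A B
    unfolding glue_dist_def
  proof (rule INF_greatest, clarify)
    fix n p q assume c: "(n, p, q) \<in> glue_chains (two_sheets K) (boundary_rel K) B A"
    have "(q (n - Suc i), p (Suc (n - Suc i))) \<in> boundary_rel K" if "i < n" for i
      using c that by (auto simp: glue_chains_def)
    then have "(p (n - i), q (n - Suc i)) \<in> boundary_rel K" if "i < n" for i
      using that equiv_boundary_rel[of K] Suc_diff_Suc[of i n] by (metis equivE symD)
    then have "(n, (\<lambda>i. q (n - i)), (\<lambda>i. p (n - i))) \<in> glue_chains (two_sheets K) (boundary_rel K) A B"
      using c by (auto simp: glue_chains_def)
    moreover have "(\<Sum>i\<le>n. sheet_dist (q (n - i)) (p (n - i))) = (\<Sum>i\<le>n. sheet_dist (p i) (q i))"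
      by (subst sum.nat_diff_reindex[symmetric, where n = "Suc n", simplified lessThan_Suc_atMost])
        (simp add: sheet_dist_commute)
    ultimately show "(INF (n, p, q)\<in>glue_chains (two_sheets K) (boundary_rel K) A B.
        \<Sum>i\<le>n. sheet_dist (p i) (q i)) \<le> (\<Sum>i\<le>n. sheet_dist (p i) (q i))"
      by (intro INF_lower2) auto
  qed
  show ?thesis by (rule antisym[OF * *])
qed

lemma Metric_space_doubling:
  "Metric_space (two_sheets K // boundary_rel K)
     (\<lambda>A B. enn2real (glue_dist (two_sheets K) sheet_dist (boundary_rel K) A B))"
proof
  fix A B C
  assume "A \<in> two_sheets K // boundary_rel K" "B \<in> two_sheets K // boundary_rel K"
  then obtain x y where x: "x \<in> two_sheets K" "A = boundary_rel K `` {x}"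
    and y: "y \<in> two_sheets K" "B = boundary_rel K `` {y}" by (meson quotientE)
  have "(A = B) = (cross_dist K x y = 0)"
    using cross_dist_zero_rel[OF x(1), of y] cross_dist_rel_zero[of x y]
      eq_equiv_class_iff[OF equiv_boundary_rel x(1) y(1)] x y by auto
  then show "(enn2real (glue_dist (two_sheets K) sheet_dist (boundary_rel K) A B) = 0) = (A = B)"
    using x y by (simp add: glue_dist_eq cross_dist_nonneg)
  assume "C \<in> two_sheets K // boundary_rel K"
  then obtain z where z: "z \<in> two_sheets K" "C = boundary_rel K `` {z}" by (meson quotientE)
  show "enn2real (glue_dist (two_sheets K) sheet_dist (boundary_rel K) A C) \<le>
      enn2real (glue_dist (two_sheets K) sheet_dist (boundary_rel K) A B) +
      enn2real (glue_dist (two_sheets K) sheet_dist (boundary_rel K) B C)"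
    using x y z by (simp add: glue_dist_eq cross_dist_nonneg cross_dist_triangle)
qed (simp_all add: glue_dist_commute)

lemma mspace_doubling: "mspace (doubling K) = two_sheets K // boundary_rel K"
  unfolding doubling_def using Metric_space_doubling by (rule Metric_space.mspace_metric)

lemma mdist_doubling:
  assumes "x \<in> two_sheets K" "y \<in> two_sheets K"
  shows "mdist (doubling K) (boundary_rel K `` {x}) (boundary_rel K `` {y}) = cross_dist K x y"
  unfolding doubling_def
  by (simp add: Metric_space.mdist_metric[OF Metric_space_doubling] glue_dist_eq[OF assms] cross_dist_nonneg)

end

lemma curve_length_ge:
  assumes "a \<le> b"
  shows "ennreal (mdist M (\<gamma> a) (\<gamma> b)) \<le> curve_length M \<gamma> a b"
  unfolding curve_length_def by (rule SUP_upper2[of "[a, b]"]) (use assms in auto)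

lemma curve_length_le:
  fixes h :: "real \<Rightarrow> real"
  assumes ab: "a \<le> b"
    and h: "\<And>u v. a \<le> u \<Longrightarrow> u \<le> v \<Longrightarrow> v \<le> b \<Longrightarrow> mdist M (\<gamma> u) (\<gamma> v) \<le> h v - h u"
  shows "curve_length M \<gamma> a b \<le> ennreal (h b - h a)"
  unfolding curve_length_def
proof (rule SUP_least, clarify)
  fix ts :: "real list"
  assume s: "sorted ts" "set ts \<subseteq> {a..b}"
  have mono: "h u \<le> h v" if "a \<le> u" "u \<le> v" "v \<le> b" for u v
    using h[OF that] mdist_nonneg[of M "\<gamma> u" "\<gamma> v"] by linarith
  have tele: "(\<Sum>i<n. mdist M (\<gamma> (ts ! i)) (\<gamma> (ts ! Suc i))) \<le> h (ts ! n) - h (ts ! 0)"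
    if "n < length ts" for n
    using that
  proof (induction n)
    case (Suc n)
    have "ts ! n \<in> set ts" "ts ! Suc n \<in> set ts" using Suc.prems by auto
    moreover have "ts ! n \<le> ts ! Suc n" using s(1) Suc.prems by (intro sorted_nth_mono) auto
    ultimately have "mdist M (\<gamma> (ts ! n)) (\<gamma> (ts ! Suc n)) \<le> h (ts ! Suc n) - h (ts ! n)"
      using s(2) by (intro h) auto
    then show ?case using Suc by simp
  qed simp
  show "(\<Sum>i<length ts - 1. ennreal (mdist M (\<gamma> (ts ! i)) (\<gamma> (ts ! Suc i)))) \<le> ennreal (h b - h a)"
  proof (cases "ts = []")
    case False
    let ?n = "length ts - 1"
    have l: "?n < length ts" using False by simp
    have "ts ! ?n \<in> set ts" "ts ! 0 \<in> set ts" using False l by (auto intro: nth_mem)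
    then have "h (ts ! ?n) \<le> h b" "h a \<le> h (ts ! 0)" using s(2) by (auto intro!: mono)
    then have "(\<Sum>i<?n. mdist M (\<gamma> (ts ! i)) (\<gamma> (ts ! Suc i))) \<le> h b - h a"
      using tele[OF l] by linarith
    then show ?thesis by (simp add: ennreal_leI)
  qed simp
qed

lemma curve_on_Lipschitz:
  assumes "\<And>u. u \<in> {a..b} \<Longrightarrow> \<gamma> u \<in> mspace M"
    and "\<And>u v. a \<le> u \<Longrightarrow> u \<le> v \<Longrightarrow> v \<le> b \<Longrightarrow> mdist M (\<gamma> u) (\<gamma> v) \<le> C * (v - u)"
  shows "curve_on M \<gamma> a b"
proof -
  have *: "mdist M (\<gamma> u) (\<gamma> v) \<le> C * dist u v" if "u \<in> {a..b}" "v \<in> {a..b}" for u v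
  proof (cases "u \<le> v")
    case True
    then show ?thesis using assms(2)[of u v] that by (simp add: dist_real_def)
  next
    case False
    then show ?thesis
      using assms(2)[of v u] that mdist_commute[of M "\<gamma> u" "\<gamma> v"] by (simp add: dist_real_def)
  qed
  have "Lipschitz_continuous_map (submetric euclidean_metric {a..b}) M \<gamma>"
    unfolding Lipschitz_continuous_map_def
    using assms(1) * by (auto intro!: exI[of _ C])
  then have "continuous_map (mtopology_of (submetric euclidean_metric {a..b})) (mtopology_of M) \<gamma>"
    by (rule Lipschitz_continuous_imp_continuous_map)
  then show ?thesis
    unfolding curve_on_def by (simp add: mtopology_of_submetric)
qed

lemma doubling_geodesic:
  assumes K: "compact K" "convex K" "K \<noteq> {}"
    and A: "A \<in> mspace (doubling K)" and B: "B \<in> mspace (doubling K)"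
  obtains \<gamma> where "curve_on (doubling K) \<gamma> 0 1" "\<gamma> 0 = A" "\<gamma> 1 = B"
    "curve_length (doubling K) \<gamma> 0 1 \<le> ennreal (mdist (doubling K) A B)"
proof -
  interpret compact_set K using K by unfold_locales
  let ?M = "doubling K" and ?c = "\<lambda>x. boundary_rel K `` {x}"
  from A B obtain x y where x: "x \<in> two_sheets K" "A = ?c x" and y: "y \<in> two_sheets K" "B = ?c y"
    unfolding mspace_doubling by (meson quotientE)
  have "\<exists>a. a \<in> K \<and> (snd x = snd y \<or> a \<in> frontier K) \<and>
      cross_dist K x y = dist (fst x) a + dist a (fst y)"
  proof (cases "snd x = snd y")
    case True
    then show ?thesis using x y by (intro exI[of _ "fst x"]) (auto simp: cross_dist_def two_sheets_def)
  next
    case False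
    then show ?thesis using frontier_sub by (auto elim!: cross_dist_cases)
  qed
  then obtain a where a: "a \<in> K" "snd x = snd y \<or> a \<in> frontier K"
    "cross_dist K x y = dist (fst x) a + dist a (fst y)" by blast
  define z and w where "z = fst x" and "w = fst y"
  have zw: "z \<in> K" "w \<in> K" using x y by (auto simp: z_def w_def two_sheets_def)
  have rel_eq: "?c u = ?c v" if "(u, v) \<in> boundary_rel K" for u v
    using that equiv_boundary_rel by (rule equiv_class_eq[rotated])
  have mid: "?c (a, snd x) = ?c (a, snd y)"
    using a by (intro rel_eq) (auto simp: boundary_rel_def)
  define P where "P t = (if t \<le> 1/2 then (z + (2 * t) *\<^sub>R (a - z), snd x)
                          else (a + (2 * t - 1) *\<^sub>R (w - a), snd y))" for t :: real
  define \<gamma> where "\<gamma> t = ?c (P t)" for t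
  define h where "h t = (if t \<le> 1/2 then 2 * t * dist z a else dist z a + (2 * t - 1) * dist a w)"
    for t :: real
  have seg: "u + s *\<^sub>R (v - u) \<in> K" if "u \<in> K" "v \<in> K" "0 \<le> s" "s \<le> 1" for u v and s :: real
  proof -
    have "u + s *\<^sub>R (v - u) = (1 - s) *\<^sub>R u + s *\<^sub>R v" by (simp add: algebra_simps)
    then show ?thesis using convexD_alt[OF K(2) that(1,2,3,4)] by simp
  qed
  have PK: "P t \<in> two_sheets K" if "0 \<le> t" "t \<le> 1" for t
    using that a zw unfolding P_def two_sheets_def by (auto intro!: seg)
  have same: "dist (u + s *\<^sub>R (v - u)) (u + r *\<^sub>R (v - u)) = (r - s) * dist u v"
    if "s \<le> r" for u v :: complex and s r :: real
  proof -
    have "(u + r *\<^sub>R (v - u)) - (u + s *\<^sub>R (v - u)) = (r - s) *\<^sub>R (v - u)"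
      by (simp add: algebra_simps)
    then have "norm ((u + r *\<^sub>R (v - u)) - (u + s *\<^sub>R (v - u))) = \<bar>r - s\<bar> * norm (v - u)"
      by (metis norm_scaleR)
    then show ?thesis using that by (metis abs_of_nonneg diff_ge_0_iff_ge dist_commute dist_norm)
  qed
  have h1: "mdist ?M (\<gamma> u) (\<gamma> v) \<le> h v - h u" if uv: "0 \<le> u" "u \<le> v" "v \<le> 1" for u v
  proof -
    have eq: "mdist ?M (\<gamma> u) (\<gamma> v) = cross_dist K (P u) (P v)"
      using uv unfolding \<gamma>_def by (intro mdist_doubling PK) auto
    consider "v \<le> 1/2" | "u > 1/2" | "u \<le> 1/2" "v > 1/2" by linarith
    then show ?thesis
    proof cases
      case 1
      then show ?thesis using uv eq same[of "2 * u" "2 * v" z a]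
        by (simp add: cross_dist_def P_def h_def algebra_simps)
    next
      case 2
      then show ?thesis using uv eq same[of "2 * u - 1" "2 * v - 1" a w]
        by (simp add: cross_dist_def P_def h_def algebra_simps)
    next
      case 3
      have "cross_dist K (P u) (P v) \<le> dist (fst (P u)) a + dist a (fst (P v))"
      proof (cases "snd x = snd y")
        case True
        then have "snd (P u) = snd (P v)" by (simp add: P_def)
        then show ?thesis by (simp add: cross_dist_def dist_triangle)
      next
        case False
        then show ?thesis using a by (intro cross_dist_le) auto
      qed
      also have "\<dots> = (1 - 2 * u) * dist z a + (2 * v - 1) * dist a w"
        using 3 same[of "2 * u" 1 z a] same[of 0 "2 * v - 1" a w] by (simp add: P_def)
      finally show ?thesis using 3 eq by (simp add: h_def algebra_simps)
    qed
  qed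
  have h2: "h v - h u \<le> 2 * (dist z a + dist a w) * (v - u)" if uv: "0 \<le> u" "u \<le> v" "v \<le> 1" for u v
  proof -
    define d and e where "d = dist z a" and "e = dist a w"
    have de: "d \<ge> 0" "e \<ge> 0" by (auto simp: d_def e_def)
    consider "v \<le> 1/2" | "u > 1/2" | "u \<le> 1/2" "v > 1/2" by linarith
    then show ?thesis
    proof cases
      case 1
      have "0 \<le> e * (v - u)" using de uv by simp
      then show ?thesis using 1 uv
        by (simp add: h_def algebra_simps flip: d_def e_def)
    next
      case 2
      have "0 \<le> d * (v - u)" using de uv by simp
      then show ?thesis using 2 uv
        by (simp add: h_def algebra_simps flip: d_def e_def)
    next
      case 3
      have "d * (1 - 2 * u) \<le> d * (2 * (v - u))" "e * (2 * v - 1) \<le> e * (2 * (v - u))"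
        using de 3 by (auto intro!: mult_left_mono)
      then show ?thesis using 3 uv
        by (simp add: h_def algebra_simps flip: d_def e_def)
    qed
  qed
  have c: "curve_on ?M \<gamma> 0 1"
  proof (rule curve_on_Lipschitz)
    fix u :: real assume "u \<in> {0..1}"
    then show "\<gamma> u \<in> mspace ?M"
      using PK unfolding \<gamma>_def mspace_doubling by (auto intro: quotientI)
  qed (use h1 h2 order_trans in blast)
  have "curve_length ?M \<gamma> 0 1 \<le> ennreal (h 1 - h 0)"
    by (rule curve_length_le) (use h1 in auto)
  moreover have "h 1 - h 0 = cross_dist K x y" using a(3) by (simp add: h_def z_def w_def)
  ultimately have "curve_length ?M \<gamma> 0 1 \<le> ennreal (mdist ?M A B)"
    using mdist_doubling[OF x(1) y(1)] x(2) y(2) by simp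
  moreover have "\<gamma> 0 = A" "\<gamma> 1 = B"
    using x y by (simp_all add: \<gamma>_def P_def z_def w_def)
  ultimately show thesis using that c by blast
qed

theorem doubling_length_metric:
  assumes "compact K" "convex K" "K \<noteq> {}"
    and "A \<in> mspace (doubling K)" "B \<in> mspace (doubling K)"
  shows "ennreal (mdist (doubling K) A B) =
    (INF \<gamma>\<in>{\<gamma>. curve_on (doubling K) \<gamma> 0 1 \<and> \<gamma> 0 = A \<and> \<gamma> 1 = B}. curve_length (doubling K) \<gamma> 0 1)"
proof (rule antisym)
  show "ennreal (mdist (doubling K) A B) \<le>
    (INF \<gamma>\<in>{\<gamma>. curve_on (doubling K) \<gamma> 0 1 \<and> \<gamma> 0 = A \<and> \<gamma> 1 = B}. curve_length (doubling K) \<gamma> 0 1)"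
    using curve_length_ge[of 0 1 "doubling K"] by (intro INF_greatest) auto
  obtain \<gamma> where "curve_on (doubling K) \<gamma> 0 1" "\<gamma> 0 = A" "\<gamma> 1 = B"
    "curve_length (doubling K) \<gamma> 0 1 \<le> ennreal (mdist (doubling K) A B)"
    using doubling_geodesic[OF assms] .
  then show "(INF \<gamma>\<in>{\<gamma>. curve_on (doubling K) \<gamma> 0 1 \<and> \<gamma> 0 = A \<and> \<gamma> 1 = B}.
      curve_length (doubling K) \<gamma> 0 1) \<le> ennreal (mdist (doubling K) A B)"
    by (intro INF_lower2) auto
qed

end

theory Submission
  imports Defs
begin

text \<open>A \<open>1/k\<close> geodesic of a doubled convex body is a closed billiard trajectory whose chords alternate between
  the sheets, such that every window of length \<open>L / k\<close> is a shortest path. Chords joining midpoints of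
  consecutive sides give a \<open>1/2n\<close> geodesic of the doubled \<open>n\<close>-gon, and the doubled diameter is a \<open>1/2\<close>
  geodesic of the doubled disk.

  Suppose that the doubled regular \<open>p\<close>-gon has a \<open>1/k\<close> geodesic with \<open>k\<close> fixed and \<open>p\<close> a large prime. It
  bounces an even number \<open>m \<le> k\<close> of times. Comparing a window around a bounce with the paths through
  the two adjacent sides shows that the bounce stays away from the ends of its side: in units of
  \<open>2\<pi>/p\<close> its offset from the midpoint is at most \<open>1/2 - \<delta>\<close>, with \<open>\<delta>\<close> depending on \<open>k\<close> only. The reflection law
  says that, up to \<open>O(1/p)\<close>, the alternating offsets are an orbit of a rotation of the circle.
  An orbit that avoids \<open>1/2\<close> and has small alternating sum has odd period, and then the side numbers
  are so symmetric that \<open>m\<close> divides \<open>w p\<close>, where \<open>0 < w < m\<close> counts half turns. This is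
  impossible for a prime \<open>p > m\<close>.\<close>

section \<open>Rotations of the circle with small alternating sum\<close>

text \<open>Minimality is used through unfolding: mirroring in the line of a side turns a path
  across that side into a straight segment, so each side yields one quadratic inequality about a
  window. The side of the bounce itself gives the reflection law, its two neighbours the bound on
  the offset. The obstacle is uniformity in \<open>p\<close>: if the angles \<eta> could tend to 0
  or \<pi>, the chords would skim the boundary and the \<open>O(1/p)\<close> errors would be out of
  control. Closing up prevents this: the angles of at most \<open>k\<close> bounces add up to an
  integer multiple of \<pi>, and consecutive cosines differ by \<open>O(1/p)\<close>, so all sines
  exceed a positive number \<open>S\<close> that depends on \<open>k\<close> only. Then
  \<open>4 * S / k\<close> bounds the window length from below, and \<delta> is a fixed fraction of
  it. Existence for the polygons matters too, because it makes \<open>minind\<close> an attained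
  minimum instead of an unspecified number. The convergence comes from projecting the polygon to the
  nearest points of the disk, which maps boundary to boundary.\<close>

lemma periodic_mult:
  fixes f :: "nat \<Rightarrow> 'a"
  assumes "\<And>i. f (i + m) = f i"
  shows "f (i + m * n) = f i"
proof (induction n)
  case (Suc n)
  have "f (i + m * Suc n) = f ((i + m * n) + m)" by (simp add: algebra_simps)
  then show ?case using assms Suc by simp
qed simp

lemma periodic_sum_shift:
  fixes f :: "nat \<Rightarrow> 'a :: ab_group_add"
  assumes "\<And>i. f (i + m) = f i"
  shows "(\<Sum>i<m. f (i + d)) = (\<Sum>i<m. f i)"
proof (induction d)
  case (Suc d)
  have "(\<Sum>i<m. f (i + Suc d)) + f d = (\<Sum>i<Suc m. f (i + d))"
    by (subst sum.lessThan_Suc_shift) (simp add: add.commute)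
  also have "\<dots> = (\<Sum>i<m. f (i + d)) + f d"
    using assms[of d] by (simp add: add.commute)
  finally show ?case using Suc by simp
qed simp

lemma periodic_sum_mult:
  fixes f :: "nat \<Rightarrow> 'a :: comm_ring_1"
  assumes per: "\<And>i. f (i + m) = f i"
  shows "(\<Sum>i<m * n. f i) = of_nat n * (\<Sum>i<m. f i)"
proof (induction n)
  case (Suc n)
  have split: "(\<Sum>i<a + b. f i) = (\<Sum>i<a. f i) + (\<Sum>i<b. f (i + a))" for a b
    by (induction b) (simp_all add: add_ac)
  have "(\<Sum>i<m * Suc n. f i) = (\<Sum>i<m * n. f i) + (\<Sum>i<m. f (i + m * n))"
    using split[of "m * n" m] by (simp add: add.commute)
  also have "(\<Sum>i<m. f (i + m * n)) = (\<Sum>i<m. f i)"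
    using periodic_mult[of f, OF per] by simp
  finally show ?case using Suc by (simp add: algebra_simps)
qed simp

lemma sum_alternating_index:
  "(\<Sum>i<2 * n. (-1) ^ i * real i) = - real n"
  by (induction n) (auto simp: algebra_simps)

text \<open>Let \<open>q\<close> be the denominator of the rotation number \<open>r\<close>. The bound \<open>1/2\<close> makes \<open>y\<close> itself, and not only
  its class modulo 1, \<open>q\<close>-periodic. If \<open>q\<close> is even, then the alternating sum over one period is a
  half-integer but not an integer. If \<open>q\<close> is odd, then \<open>N (i + q) - N i\<close> alternates in sign.\<close>

lemma rotation_parity:
  fixes N :: "nat \<Rightarrow> int" and y :: "nat \<Rightarrow> real"
  assumes m: "even m" "m > 0"
    and N: "\<And>i. N (i + m) = N i"
    and y: "\<And>i. y (i + m) = y i"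
    and step: "\<And>i. y (Suc i) = y i + r - of_int (N i + N (Suc i))"
    and bound: "\<And>i. \<bar>y i\<bar> < 1 / 2"
    and alt: "\<bar>\<Sum>i<m. (-1) ^ i * y i\<bar> < 1 / 2"
  shows "int m dvd 2 * (\<Sum>i<m. (-1) ^ i * N i)"
proof -
  \<comment> \<open>\<open>g\<close>, \<open>q\<close> and \<open>k\<close> below write
    \<open>r\<close>, which is \<open>X m / m\<close>, in lowest terms as
    \<open>k / q\<close>.\<close>
  define X where "X i = (\<Sum>l<i. N l + N (Suc l))" for i
  have yX: "y i = y 0 + real i * r - of_int (X i)" for i
    by (induction i) (simp_all add: step X_def algebra_simps)
  have mr: "real m * r = of_int (X m)" using yX[of m] y[of 0] by simp
  define g where "g = nat (gcd (X m) (int m))"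
  define q where "q = m div g"
  define k where "k = X m div int g"
  have gi: "gcd (X m) (int m) = int g" by (simp add: g_def)
  have g: "g > 0" "m = q * g" "X m = k * int g"
  proof -
    show "g > 0" using m unfolding g_def by simp
    have "int g dvd int m" "int g dvd X m" unfolding gi[symmetric] by (rule gcd_dvd2, rule gcd_dvd1)
    then show "m = q * g" "X m = k * int g" by (simp_all add: q_def k_def)
  qed
  have cop: "coprime k (int q)"
    using gi m(2) div_gcd_coprime[of "X m" "int m"] unfolding k_def q_def by (simp add: zdiv_int)
  have "real g * (real q * r) = real g * of_int k" using mr g(2,3) by (simp add: mult_ac)
  then have qr: "real q * r = of_int k" using g(1) by simp
  have per: "y (i + q) = y i" for i
  proof -
    have "y (i + q) - y i = of_int (k - X (i + q) + X i)"
      using yX[of "i + q"] yX[of i] qr by (simp add: algebra_simps)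
    moreover have "\<bar>y (i + q) - y i\<bar> < 1" using bound[of "i + q"] bound[of i] by linarith
    ultimately have "k - X (i + q) + X i = 0" by linarith
    with \<open>y (i + q) - y i = _\<close> show ?thesis by simp
  qed
  show ?thesis
  proof (cases "even q")
    case True
    then obtain h where h: "q = 2 * h" by blast
    have odd: "odd k" using cop True coprime_common_divisor[of k "int q" 2] by auto
    have "(\<Sum>i<m. (-1) ^ i * y i) = real g * (\<Sum>i<q. (-1) ^ i * y i)"
      unfolding g(2) using True per by (intro periodic_sum_mult) (simp add: power_add)
    also have "(\<Sum>i<q. (-1) ^ i * y i) =
        (\<Sum>i<q. (-1) ^ i * y 0 + r * ((-1) ^ i * real i) - of_int ((-1) ^ i * X i))"
      by (intro sum.cong refl, subst yX) (simp add: algebra_simps)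
    also have "\<dots> = (\<Sum>i<q. (-1) ^ i) * y 0 + r * (\<Sum>i<q. (-1) ^ i * real i) - of_int (\<Sum>i<q. (-1) ^ i * X i)"
      by (simp add: sum.distrib sum_subtractf sum_distrib_left sum_distrib_right)
    also have "(\<Sum>i<q. (-1) ^ i) = (0::real)" unfolding h by (induction h) auto
    also have "(\<Sum>i<q. (-1) ^ i * real i) = - real h" unfolding h by (rule sum_alternating_index)
    also have "0 * y 0 + r * (- real h) - of_int (\<Sum>i<q. (-1) ^ i * X i) = - of_int (k + 2 * (\<Sum>i<q. (-1) ^ i * X i)) / 2"
      using qr h by (simp add: field_simps)
    finally have e: "(\<Sum>i<m. (-1) ^ i * y i) = real g * (- of_int (k + 2 * (\<Sum>i<q. (-1) ^ i * X i)) / 2)" .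
    \<comment> \<open>\<open>z\<close> is odd, hence nonzero, and all \<open>g\<close> periods
      contribute the same amount, so the alternating sum cannot be smaller than 1/2.\<close>
    define z where "z = k + 2 * (\<Sum>i<q. (-1) ^ i * X i)"
    have "z \<noteq> 0" using odd unfolding z_def by presburger
    then have "\<bar>z\<bar> \<ge> 1" by linarith
    then have "\<bar>real_of_int z\<bar> \<ge> 1" by linarith
    moreover have "real g \<ge> 1" using g by simp
    ultimately have "1 * 1 \<le> real g * \<bar>real_of_int z\<bar>" by (intro mult_mono) auto
    then have "\<bar>\<Sum>i<m. (-1) ^ i * y i\<bar> \<ge> 1 / 2"
      unfolding e z_def[symmetric] by (simp add: abs_mult)
    with alt show ?thesis by simp
  next
    case False
    define c where "c i = N (i + q) - N i" for i
    have "c (Suc i) = - c i" for i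
    proof -
      have "real_of_int (N (i + q) + N (Suc (i + q))) = of_int (N i + N (Suc i))"
        using step[of "i + q"] step[of i] per[of i] per[of "Suc i"] by simp
      then have "N (i + q) + N (Suc (i + q)) = N i + N (Suc i)" by linarith
      then show ?thesis unfolding c_def by simp
    qed
    then have c: "c i = (-1) ^ i * c 0" for i by (induction i) auto
    let ?f = "\<lambda>i. (-1) ^ i * N i"
    \<comment> \<open>A shift by the odd number \<open>q\<close> flips the sign
      \<open>(-1) ^ i\<close>, so the sum equals its own negative up to \<open>m * c 0\<close>. This
      is where the factor 2 in the conclusion comes from.\<close>
    have "(\<Sum>i<m. ?f i) = (\<Sum>i<m. ?f (i + q))"
      using m N by (intro periodic_sum_shift[symmetric]) (simp add: power_add)
    also have "\<dots> = (\<Sum>i<m. - ?f i - c 0)"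
    proof (rule sum.cong)
      fix i
      have "N (i + q) = N i + (-1) ^ i * c 0" using c[of i] by (simp add: c_def)
      then show "?f (i + q) = - ?f i - c 0"
        using False by (simp add: power_add algebra_simps flip: power_mult_distrib mult.assoc)
    qed simp
    also have "\<dots> = - (\<Sum>i<m. ?f i) - int m * c 0" by (simp add: sum_subtractf sum_negf)
    finally have "2 * (\<Sum>i<m. ?f i) = int m * (- c 0)" by simp
    then show ?thesis by simp
  qed
qed

text \<open>Replacing \<open>r\<close> by the rational number \<open>X m / m\<close> gives an
  exactly periodic orbit \<open>y'\<close>. Periodicity of \<open>y\<close> forces the two rotation
  numbers to differ by at most \<epsilon>, so \<open>y'\<close> stays within
  \<open>2 * m * \<epsilon>\<close> of \<open>y\<close> over a period; the slack in
  \<open>bound\<close> and \<open>alt\<close> pays for this.\<close>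

lemma approximate_rotation_parity:
  fixes N :: "nat \<Rightarrow> int" and y :: "nat \<Rightarrow> real"
  assumes m: "even m" "m > 0"
    and N: "\<And>i. N (i + m) = N i"
    and y: "\<And>i. y (i + m) = y i"
    and step: "\<And>i. \<bar>y (Suc i) - (y i + r - of_int (N i + N (Suc i)))\<bar> \<le> \<epsilon>"
    and bound: "\<And>i. \<bar>y i\<bar> + 2 * real m * \<epsilon> < 1 / 2"
    and alt: "\<bar>\<Sum>i<m. (-1) ^ i * y i\<bar> + 2 * (real m)\<^sup>2 * \<epsilon> < 1 / 2"
  shows "int m dvd 2 * (\<Sum>i<m. (-1) ^ i * N i)"
proof -
  define X where "X i = (\<Sum>l<i. N l + N (Suc l))" for i
  define r' where "r' = of_int (X m) / real m"
  define y' where "y' i = y 0 + real i * r' - of_int (X i)" for i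
  have \<epsilon>: "\<epsilon> \<ge> 0" using step[of 0] by linarith
  have yX: "\<bar>y i - (y 0 + real i * r - of_int (X i))\<bar> \<le> real i * \<epsilon>" for i
  proof (induction i)
    case (Suc i)
    have "X (Suc i) = X i + (N i + N (Suc i))" by (simp add: X_def)
    then show ?case using Suc step[of i] by (simp add: algebra_simps)
  qed (simp add: X_def)
  have "\<bar>real m * r - of_int (X m)\<bar> \<le> real m * \<epsilon>" using yX[of m] y[of 0] by simp
  moreover have "real m * r - of_int (X m) = real m * (r - r')" using m by (simp add: r'_def field_simps)
  ultimately have rr: "\<bar>r - r'\<bar> \<le> \<epsilon>" using m by (simp add: abs_mult)
  have close: "\<bar>y i - y' i\<bar> \<le> 2 * real m * \<epsilon>" if "i < m" for i
  proof -
    have "y i - y' i = (y i - (y 0 + real i * r - of_int (X i))) + real i * (r - r')"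
      by (simp add: y'_def algebra_simps)
    moreover have "\<bar>real i * (r - r')\<bar> \<le> real i * \<epsilon>" using rr by (simp add: abs_mult mult_left_mono)
    moreover have "real i * \<epsilon> \<le> real m * \<epsilon>" using that \<epsilon> by (intro mult_right_mono) auto
    ultimately show ?thesis using yX[of i] by linarith
  qed
  have XS: "X (i + m) = X i + X m" for i
    by (induction i) (use N N[of "Suc _"] in \<open>simp_all add: X_def\<close>)
  have per: "y' (i + m) = y' i" for i
    using m by (simp add: y'_def XS r'_def field_simps)
  have bnd: "\<bar>y' i\<bar> < 1 / 2" for i
  proof -
    have "y' i = y' (i mod m)" using periodic_mult[of y' m "i mod m" "i div m"] per by simp
    then show ?thesis using close[of "i mod m"] bound[of "i mod m"] m by simp
  qed
  have "\<bar>(\<Sum>i<m. (-1) ^ i * y' i) - (\<Sum>i<m. (-1) ^ i * y i)\<bar> \<le> (\<Sum>i<m. 2 * real m * \<epsilon>)"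
    unfolding sum_subtractf[symmetric]
  proof (rule order_trans[OF sum_abs sum_mono])
    fix i assume "i \<in> {..<m}"
    then show "\<bar>(-1) ^ i * y' i - (-1) ^ i * y i\<bar> \<le> 2 * real m * \<epsilon>"
      using close[of i] by (simp add: abs_mult abs_minus_commute flip: right_diff_distrib)
  qed
  also have "\<dots> = 2 * (real m)\<^sup>2 * \<epsilon>" by (simp add: power2_eq_square)
  finally have alt': "\<bar>\<Sum>i<m. (-1) ^ i * y' i\<bar> < 1 / 2" using alt by linarith
  show ?thesis
    by (rule rotation_parity[where N = N and y = y' and r = r', OF m N per _ bnd alt'])
      (simp add: y'_def X_def algebra_simps)
qed

section \<open>Rigidity of bounce sequences\<close>

lemma min_sin_le_sin:
  assumes "0 \<le> a" "a \<le> x" "x \<le> b" "b \<le> pi" "S \<le> sin a" "S \<le> sin b"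
  shows "S \<le> sin x"
proof (cases "x \<le> pi / 2")
  case True
  then have "sin a \<le> sin x" using assms by (intro sin_monotone_2pi_le) auto
  then show ?thesis using assms by simp
next
  case False
  then have "sin (pi - b) \<le> sin (pi - x)" using assms by (intro sin_monotone_2pi_le) auto
  then show ?thesis using assms by simp
qed

lemma abs_sin_diff_le:
  fixes x y :: real
  shows "\<bar>sin x - sin y\<bar> \<le> \<bar>x - y\<bar>"
proof -
  have "\<bar>sin x - sin y\<bar> = 2 * \<bar>sin ((x - y) / 2)\<bar> * \<bar>cos ((x + y) / 2)\<bar>"
    by (simp add: sin_diff_sin abs_mult)
  also have "\<dots> \<le> 2 * \<bar>(x - y) / 2\<bar> * 1"
    by (intro mult_mono abs_sin_x_le_abs_x) auto
  finally show ?thesis by simp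
qed

text \<open>The mean value theorem, in a form symmetric in \<open>a\<close> and \<open>b\<close>. As
  the sine is unimodal on the interval from 0 to \<pi>, the lower bound \<open>S\<close> passes to
  the intermediate point; its distances to both ends allow \<open>sin a\<close> and
  \<open>sin b\<close> to be traded for \<open>sin \<xi>\<close>.\<close>

lemma cos_diff_linear:
  fixes a b :: real
  assumes a: "0 < a" "a < pi" and b: "0 < b" "b < pi" and S: "S \<le> sin a" "S \<le> sin b"
  obtains \<xi> where "cos a - cos b = (b - a) * sin \<xi>" "S \<le> sin \<xi>"
    "\<bar>\<xi> - a\<bar> \<le> \<bar>b - a\<bar>" "\<bar>\<xi> - b\<bar> \<le> \<bar>b - a\<bar>"
proof -
  have *: "\<exists>\<xi>. cos u - cos v = (v - u) * sin \<xi> \<and> S \<le> sin \<xi> \<and> \<bar>\<xi> - u\<bar> \<le> \<bar>v - u\<bar> \<and> \<bar>\<xi> - v\<bar> \<le> \<bar>v - u\<bar>"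
    if uv: "u < v" "0 < u" "v < pi" "S \<le> sin u" "S \<le> sin v" for u v
  proof -
    obtain z where z: "u < z" "z < v" "cos v - cos u = (v - u) * (- sin z)"
      using MVT2[OF uv(1), of cos "\<lambda>x. - sin x", OF DERIV_cos] by blast
    have "S \<le> sin z" by (rule min_sin_le_sin[of u _ v]) (use uv z in auto)
    then show ?thesis using z uv by (intro exI[of _ z]) auto
  qed
  consider "a < b" | "a = b" | "b < a" by linarith
  then show thesis
  proof cases
    case 1
    with *[of a b] a b S that show thesis by blast
  next
    case 2
    with that[of a] S show thesis by simp
  next
    case 3
    from *[of b a] 3 a b S obtain \<xi> where x: "cos b - cos a = (a - b) * sin \<xi>" "S \<le> sin \<xi>"
      "\<bar>\<xi> - b\<bar> \<le> \<bar>a - b\<bar>" "\<bar>\<xi> - a\<bar> \<le> \<bar>a - b\<bar>" by blast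
    then have "cos a - cos b = (b - a) * sin \<xi>" by (simp add: algebra_simps)
    with x that[of \<xi>] show thesis by (simp add: abs_minus_commute)
  qed
qed

text \<open>Excludes grazing incidence with a bound that involves \<open>k\<close> only. Some angle
  is at least \<open>pi / m\<close> and some angle is at most \<open>pi - pi / m\<close>. Cosines
  drift by at most \<open>2 * k * \<kappa>\<close> along a period, which is at most
  \<open>(1 - c) / 2\<close> with \<open>c = cos (pi / k)\<close>, so no cosine exceeds
  \<open>(1 + c) / 2\<close> in absolute value.\<close>

lemma sin_lower_bound:
  fixes \<eta> :: "nat \<Rightarrow> real" and w :: int
  assumes m: "0 < m" "m \<le> k" and per: "\<And>i. \<eta> (i + m) = \<eta> i"
    and \<eta>: "\<And>i. 0 < \<eta> i" "\<And>i. \<eta> i < pi"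
    and w: "(\<Sum>i<m. \<eta> i) = pi * of_int w"
    and small: "\<And>i. \<bar>cos (\<eta> i) - cos (\<eta> (Suc i))\<bar> \<le> 2 * \<kappa>"
    and \<kappa>: "4 * real k * \<kappa> \<le> 1 - cos (pi / real k)"
  shows "sqrt (1 - ((1 + cos (pi / real k)) / 2)\<^sup>2) \<le> sin (\<eta> i)"
proof -
  let ?c = "cos (pi / real k)"
  have k0: "\<kappa> \<ge> 0" using small[of 0] by linarith
  have cosk: "cos (pi / real m) \<le> ?c"
    using m by (intro cos_monotone_0_pi_le) (auto simp: field_simps)
  \<comment> \<open>A positive integer multiple of \<pi> is at least \<pi>, so one of the
    \<open>m\<close> terms reaches the average \<open>pi / m\<close>. Applied to \<eta> and to \<pi>
    minus \<eta>.\<close>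
  have *: "\<exists>i<m. x i \<ge> pi / real m"
    if "\<And>i. 0 < x i" "(\<Sum>i<m. x i) = pi * of_int v" for x :: "nat \<Rightarrow> real" and v :: int
  proof (rule ccontr)
    assume "\<not> ?thesis"
    then have "(\<Sum>i<m. x i) < (\<Sum>i<m. pi / real m)"
      using m by (intro sum_strict_mono) auto
    also have "\<dots> = pi * 1" using m by simp
    finally have "v < 1" unfolding that(2) by simp
    moreover have "0 < (\<Sum>i<m. x i)" using m that(1) by (intro sum_pos) auto
    then have "0 < v" unfolding that(2) by (simp add: zero_less_mult_iff)
    ultimately show False by simp
  qed
  obtain i1 where i1: "i1 < m" "\<eta> i1 \<ge> pi / real m" using *[OF \<eta>(1) w] by blast
  have "(\<Sum>i<m. pi - \<eta> i) = pi * of_int (int m - w)" by (simp add: sum_subtractf w algebra_simps)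
  then have "\<exists>i<m. pi - \<eta> i \<ge> pi / real m" using \<eta>(2) by (intro *[where v = "int m - w"]) auto
  then obtain i2 where i2: "i2 < m" "pi - \<eta> i2 \<ge> pi / real m" by blast
  have c1: "cos (\<eta> i1) \<le> ?c"
    using cos_monotone_0_pi_le[of "pi / real m" "\<eta> i1"] i1 \<eta>(2)[of i1] cosk m by simp
  have c2: "- cos (\<eta> i2) \<le> ?c"
    using cos_monotone_0_pi_le[of "pi / real m" "pi - \<eta> i2"] i2 \<eta>(1)[of i2] cosk m
    by (simp add: less_imp_le)
  have chain: "\<bar>cos (\<eta> i) - cos (\<eta> (i + n))\<bar> \<le> real n * (2 * \<kappa>)" for i n
  proof (induction n)
    case (Suc n)
    then show ?case using small[of "i + n"] by (simp add: algebra_simps)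
  qed simp
  have near: "\<bar>cos (\<eta> i) - cos (\<eta> j)\<bar> \<le> 2 * real k * \<kappa>" if "j < m" for i j
  proof -
    have ij: "\<bar>cos (\<eta> i) - cos (\<eta> j)\<bar> \<le> 2 * real k * \<kappa>" if "i < m" "j < m" "i \<le> j" for i j
    proof -
      have "real (j - i) * (2 * \<kappa>) \<le> real k * (2 * \<kappa>)"
        using that m k0 by (intro mult_right_mono) auto
      then show ?thesis using chain[of i "j - i"] that by simp
    qed
    have "\<eta> i = \<eta> (i mod m)" using periodic_mult[of \<eta> m "i mod m" "i div m", OF per] by simp
    moreover have "i mod m < m" using m by simp
    ultimately show ?thesis
      using ij[of "i mod m" j] ij[of j "i mod m"] that by (simp add: abs_minus_commute) linarith
  qed
  have "\<bar>cos (\<eta> i)\<bar> \<le> (1 + ?c) / 2"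
    using near[OF i1(1), of i] near[OF i2(1), of i] c1 c2 \<kappa> unfolding abs_le_iff
    by (simp add: field_simps)
  then have "(cos (\<eta> i))\<^sup>2 \<le> ((1 + ?c) / 2)\<^sup>2"
    by (metis abs_ge_zero power2_abs power_mono)
  then have "sqrt (1 - ((1 + ?c) / 2)\<^sup>2) \<le> sqrt ((sin (\<eta> i))\<^sup>2)"
    by (intro real_sqrt_le_mono) (simp add: sin_squared_eq)
  then show ?thesis using sin_gt_zero[OF \<eta>] by (simp add: less_imp_le)
qed

text \<open>In the application \<open>1 - cos \<kappa> - b * sin \<kappa>\<close> is the distance
  from the bounce to the line of an adjacent side. It is at most \<open>l\<close>, which makes the
  right-hand side of \<open>q\<close> at most \<open>8 * l\<close> times this distance; so the
  distance is at least \<open>l0 * (sin \<kappa>)^2 / 8\<close> and the bounce keeps away from the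
  corner.\<close>

lemma offset_bound:
  fixes b \<kappa> l s :: real
  assumes \<kappa>: "0 < \<kappa>" "\<kappa> < 1" and l: "l0 \<le> l" "\<kappa>\<^sup>2 \<le> l0" and s: "0 \<le> s" "s \<le> 1"
    and sin: "\<kappa> / 2 \<le> sin \<kappa>" "\<kappa> * (1 - l0 / 32) \<le> sin \<kappa>"
    and q0: "0 \<le> 1 - cos \<kappa> - b * sin \<kappa>" "0 \<le> 1 - cos \<kappa> + b * sin \<kappa>"
    and q: "l\<^sup>2 * (sin \<kappa>)\<^sup>2 \<le> 4 * (1 - cos \<kappa> - b * sin \<kappa>)\<^sup>2 + 4 * (1 - cos \<kappa> - b * sin \<kappa>) * l * s * cos \<kappa>"
  shows "b \<le> \<kappa> * (1 / 2 - l0 / 32)"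
proof -
  define q where "q = 1 - cos \<kappa> - b * sin \<kappa>"
  have cosk: "1 - cos \<kappa> \<le> \<kappa>\<^sup>2 / 2"
  proof -
    have "1 - cos \<kappa> = 2 * \<bar>sin (\<kappa> / 2)\<bar>\<^sup>2" using cos_double_sin[of "\<kappa> / 2"] by simp
    also have "\<dots> \<le> 2 * \<bar>\<kappa> / 2\<bar>\<^sup>2" by (intro mult_left_mono power_mono abs_sin_x_le_abs_x) auto
    finally show ?thesis by (simp add: power_divide)
  qed
  have "0 < \<kappa>\<^sup>2" using \<kappa> by simp
  then have l0: "0 < l0" using l(2) by linarith
  have q2: "q \<le> l" "0 \<le> q" using q0 cosk l unfolding q_def by linarith+
  have "l\<^sup>2 * (sin \<kappa>)\<^sup>2 \<le> 4 * q\<^sup>2 + 4 * q * l * s * cos \<kappa>" using q by (simp only: q_def)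
  also have "4 * q * l * s * cos \<kappa> \<le> 4 * q * l * 1 * 1"
    using q2 s by (intro mult_mono mult_nonneg_nonneg cos_ge_zero) (use \<kappa> pi_gt3 in auto)
  also have "4 * q\<^sup>2 \<le> 4 * q * l" using q2 by (simp add: power2_eq_square mult_left_mono)
  finally have "l * (l * (sin \<kappa>)\<^sup>2) \<le> l * (8 * q)" by (simp add: power2_eq_square algebra_simps)
  then have "l * (sin \<kappa>)\<^sup>2 \<le> 8 * q" using l l0 by simp
  moreover have "l0 * (sin \<kappa>)\<^sup>2 \<le> l * (sin \<kappa>)\<^sup>2" using l by (intro mult_right_mono) auto
  ultimately have "l0 * (sin \<kappa>)\<^sup>2 / 8 \<le> q" by linarith
  then have "b * sin \<kappa> \<le> \<kappa>\<^sup>2 / 2 - l0 * (sin \<kappa>)\<^sup>2 / 8" using cosk unfolding q_def by linarith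
  \<comment> \<open>Since \<open>sin \<kappa> \<ge> \<kappa> / 2\<close>, the subtracted term is at
    least \<open>l0 * \<kappa> * sin \<kappa> / 16\<close>. Half of it absorbs the passage from
    \<kappa> to \<open>sin \<kappa>\<close> in the main term; the other half remains as
    \<open>l0 / 32\<close>.\<close>
  also have "\<dots> \<le> \<kappa> * (1 / 2 - l0 / 32) * sin \<kappa>"
  proof -
    have "\<kappa> * (\<kappa> * (1 - l0 / 32)) \<le> \<kappa> * sin \<kappa>" using sin \<kappa> by (intro mult_left_mono) auto
    moreover have "sin \<kappa> * (\<kappa> / 2) \<le> sin \<kappa> * sin \<kappa>" using sin \<kappa> by (intro mult_left_mono) auto
    then have "l0 * (sin \<kappa> * (\<kappa> / 2)) \<le> l0 * (sin \<kappa> * sin \<kappa>)" by (rule mult_left_mono) (use l0 in simp)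
    moreover have "l0 * (\<kappa> * (\<kappa> / 2)) \<le> l0 * (\<kappa> * sin \<kappa>)" using sin \<kappa> l0 by (intro mult_left_mono) auto
    ultimately show ?thesis by (simp add: power2_eq_square algebra_simps)
  qed
  finally show ?thesis by (rule mult_right_le_imp_le) (use sin(1) \<kappa> in linarith)
qed

text \<open>Measured in units of \<kappa>, the angles \<open>v i\<close> have integral sums
  \<open>v i + v (Suc i)\<close>, so \<open>(-1) ^ i * v i\<close> differs from \<open>v 0\<close>
  by an integer \<open>N i\<close>. The linearized bounce equation then says that the alternating
  offsets \<open>y i\<close> follow, up to \<epsilon>, a rotation by \<open>- 2 * v 0\<close>. As
  \<open>m\<close> is even, \<open>v 0\<close> cancels from the sum of the \<open>v i\<close>, which
  leaves the alternating sum of the \<open>N i\<close>.\<close>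

lemma bounce_rigidity:
  fixes \<eta> b :: "nat \<Rightarrow> real" and D :: "nat \<Rightarrow> int"
  assumes m: "even m" "0 < m"
    and per: "\<And>i. \<eta> (i + m) = \<eta> i" "\<And>i. b (i + m) = b i"
    and \<eta>: "\<And>i. 0 < \<eta> i" "\<And>i. \<eta> i < pi"
    and S: "0 < S" "\<And>i. S \<le> sin (\<eta> i)"
    and bounce: "\<And>i. cos (\<eta> i) + b i * sin (\<eta> i) = cos (\<eta> (Suc i)) - b (Suc i) * sin (\<eta> (Suc i))"
    and D: "\<And>i. \<eta> i + \<eta> (Suc i) = \<kappa> * of_int (D i)"
    and \<kappa>: "0 < \<kappa>"
    and b: "\<And>i. \<bar>b i\<bar> \<le> \<kappa> * (1 / 2 - \<delta>)"
    and small: "8 * real m * \<kappa> < \<delta> * S\<^sup>2" "24 * (real m)\<^sup>2 * \<kappa> < S\<^sup>2"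
  shows "\<exists>W :: int. 2 * (\<Sum>i<m. \<eta> i) = \<kappa> * real m * of_int W"
proof -
  \<comment> \<open>Dividing the bounce equation by a sine of size at least \<open>S\<close> gives
    increments of \<eta> of at most \<open>2 * \<kappa> / S\<close>; inserting this once more bounds
    the error of the linearized equation by \<open>4 * \<kappa>^2 / S^2\<close>, which is
    \<open>\<kappa> * \<epsilon>\<close>.\<close>
  define \<epsilon> where "\<epsilon> = 4 * \<kappa> / S\<^sup>2"
  have \<epsilon>: "2 * real m * \<epsilon> < \<delta>" "6 * (real m)\<^sup>2 * \<epsilon> < 1"
    using small S by (simp_all add: \<epsilon>_def field_simps)
  have \<epsilon>0: "\<epsilon> > 0" using \<kappa> S by (simp add: \<epsilon>_def)
  have \<delta>: "\<delta> > 0" using \<epsilon>(1) \<epsilon>0 m by (smt (verit) mult_pos_pos of_nat_0_less_iff)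
  have b1: "\<bar>b i\<bar> \<le> \<kappa>" for i
  proof -
    have "\<kappa> * (1 / 2 - \<delta>) \<le> \<kappa> * 1" using \<kappa> \<delta> by (intro mult_left_mono) auto
    then show ?thesis using b[of i] by simp
  qed
  have err: "\<bar>(\<eta> (Suc i) - \<eta> i) + (b i + b (Suc i))\<bar> \<le> \<kappa> * \<epsilon>" for i
  proof -
    let ?d = "\<eta> (Suc i) - \<eta> i"
    obtain \<xi> where \<xi>: "cos (\<eta> i) - cos (\<eta> (Suc i)) = ?d * sin \<xi>" "S \<le> sin \<xi>"
      "\<bar>\<xi> - \<eta> i\<bar> \<le> \<bar>?d\<bar>" "\<bar>\<xi> - \<eta> (Suc i)\<bar> \<le> \<bar>?d\<bar>"
      by (rule cos_diff_linear[of "\<eta> i" "\<eta> (Suc i)" S]) (use \<eta> S in auto)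
    have bs: "\<bar>b j * sin x\<bar> \<le> \<kappa>" for j x
      using mult_mono[OF b1[of j] abs_sin_le_one[of x]] \<kappa> by (simp add: abs_mult)
    have "?d * sin \<xi> = - (b i * sin (\<eta> i)) - b (Suc i) * sin (\<eta> (Suc i))"
      using bounce[of i] \<xi>(1) by simp
    then have "\<bar>?d\<bar> * sin \<xi> \<le> 2 * \<kappa>"
      using bs[of i "\<eta> i"] bs[of "Suc i" "\<eta> (Suc i)"] \<xi>(2) S(1) abs_mult[of ?d "sin \<xi>"] by simp
    moreover have "\<bar>?d\<bar> * S \<le> \<bar>?d\<bar> * sin \<xi>" using \<xi>(2) by (intro mult_left_mono) auto
    ultimately have d: "\<bar>?d\<bar> \<le> 2 * \<kappa> / S" using S(1) by (simp add: field_simps)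
    have bd: "\<bar>b j * (sin \<xi> - sin (\<eta> j))\<bar> \<le> \<kappa> * (2 * \<kappa> / S)" if "\<bar>\<xi> - \<eta> j\<bar> \<le> \<bar>?d\<bar>" for j
      unfolding abs_mult
      using abs_sin_diff_le[of \<xi> "\<eta> j"] that d \<kappa> by (intro mult_mono b1) auto
    have "(?d + (b i + b (Suc i))) * sin \<xi> =
        b i * (sin \<xi> - sin (\<eta> i)) + b (Suc i) * (sin \<xi> - sin (\<eta> (Suc i)))"
      using \<open>?d * sin \<xi> = _\<close> by (simp add: algebra_simps)
    then have "\<bar>?d + (b i + b (Suc i))\<bar> * sin \<xi> \<le> 2 * (\<kappa> * (2 * \<kappa> / S))"
      using bd[OF \<xi>(3)] bd[OF \<xi>(4)] abs_mult[of "?d + (b i + b (Suc i))" "sin \<xi>"] \<xi>(2) S(1)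
      by (simp del: times_divide_eq_right)
    moreover have "\<bar>?d + (b i + b (Suc i))\<bar> * S \<le> \<bar>?d + (b i + b (Suc i))\<bar> * sin \<xi>"
      using \<xi>(2) by (intro mult_left_mono) auto
    ultimately have "\<bar>?d + (b i + b (Suc i))\<bar> * S \<le> \<kappa> * \<epsilon> * S"
      using S(1) by (simp add: \<epsilon>_def power2_eq_square mult_ac)
    then show ?thesis using S(1) by simp
  qed
  define v where "v i = \<eta> i / \<kappa>" for i
  have vD: "v (Suc i) = of_int (D i) - v i" for i
    using D[of i] \<kappa> by (simp add: v_def field_simps)
  define N where "N i = (\<Sum>l<i. - ((-1) ^ l) * D l)" for i
  have vN: "(-1) ^ i * v i = v 0 + of_int (N i)" for i
  proof (induction i)
    case (Suc i)
    have "(-1) ^ Suc i * v (Suc i) = (-1) ^ i * v i - (-1) ^ i * of_int (D i)"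
      by (simp add: vD algebra_simps)
    then show ?case using Suc by (simp add: N_def)
  qed (simp add: N_def)
  have Nper: "N (i + m) = N i" for i
  proof -
    have "v 0 + of_int (N (i + m)) = v 0 + real_of_int (N i)"
      unfolding vN[symmetric] using m per by (simp add: power_add v_def)
    then show ?thesis by simp
  qed
  define y where "y i = (-1) ^ i * (b i / \<kappa>)" for i
  have yper: "y (i + m) = y i" for i using m per by (simp add: y_def power_add)
  have ystep: "\<bar>y (Suc i) - (y i + (- 2 * v 0) - of_int (N i + N (Suc i)))\<bar> \<le> \<epsilon>" for i
  proof -
    have "of_int (N i + N (Suc i)) + 2 * v 0 = (-1) ^ i * (v i - v (Suc i))"
      using vN[of i] vN[of "Suc i"] by (simp add: algebra_simps)
    then have "y (Suc i) - (y i + (- 2 * v 0) - of_int (N i + N (Suc i))) =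
        - ((-1) ^ i) * ((v (Suc i) - v i) + (b i / \<kappa> + b (Suc i) / \<kappa>))"
      unfolding y_def by (simp add: algebra_simps)
    then have "\<bar>y (Suc i) - (y i + (- 2 * v 0) - of_int (N i + N (Suc i)))\<bar> =
        \<bar>(v (Suc i) - v i) + (b i / \<kappa> + b (Suc i) / \<kappa>)\<bar>"
      by (simp only:) (simp add: abs_mult)
    also have "(v (Suc i) - v i) + (b i / \<kappa> + b (Suc i) / \<kappa>) =
        ((\<eta> (Suc i) - \<eta> i) + (b i + b (Suc i))) / \<kappa>"
      by (simp add: v_def diff_divide_distrib add_divide_distrib)
    also have "\<bar>\<dots>\<bar> = \<bar>(\<eta> (Suc i) - \<eta> i) + (b i + b (Suc i))\<bar> / \<kappa>"
      using \<kappa> by (simp add: abs_divide)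
    also have "\<dots> \<le> \<epsilon>" using err[of i] \<kappa> by (simp add: field_simps)
    finally show ?thesis .
  qed
  have ybound: "\<bar>y i\<bar> + 2 * real m * \<epsilon> < 1 / 2" for i
  proof -
    have "\<bar>y i\<bar> = \<bar>b i\<bar> / \<kappa>" using \<kappa> by (simp add: y_def abs_mult)
    also have "\<dots> \<le> 1 / 2 - \<delta>" using b[of i] \<kappa> by (simp add: field_simps)
    finally show ?thesis using \<epsilon> by linarith
  qed
  \<comment> \<open>The increments of \<eta> cancel around a period, so the linearized equation
    itself shows that the offsets nearly add up to zero.\<close>
  have yalt: "\<bar>\<Sum>i<m. (-1) ^ i * y i\<bar> + 2 * (real m)\<^sup>2 * \<epsilon> < 1 / 2"
  proof -
    have "(\<Sum>i<m. \<eta> (i + 1)) = (\<Sum>i<m. \<eta> i)" "(\<Sum>i<m. b (i + 1)) = (\<Sum>i<m. b i)"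
      by (intro periodic_sum_shift per)+
    then have "(\<Sum>i<m. (\<eta> (Suc i) - \<eta> i) + (b i + b (Suc i))) = 2 * (\<Sum>i<m. b i)"
      by (simp add: sum.distrib sum_subtractf)
    moreover have "\<bar>\<Sum>i<m. (\<eta> (Suc i) - \<eta> i) + (b i + b (Suc i))\<bar> \<le> (\<Sum>i<m. \<kappa> * \<epsilon>)"
      by (rule order_trans[OF sum_abs sum_mono]) (rule err)
    ultimately have "\<bar>\<Sum>i<m. b i\<bar> \<le> \<kappa> * (real m * \<epsilon> / 2)" by (simp add: algebra_simps)
    then have "\<bar>\<Sum>i<m. b i\<bar> / \<kappa> \<le> real m * \<epsilon> / 2" using \<kappa> by (simp add: field_simps)
    moreover have "(\<Sum>i<m. (-1) ^ i * y i) = (\<Sum>i<m. b i) / \<kappa>"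
      by (simp add: y_def sum_divide_distrib flip: mult.assoc power_mult_distrib)
    moreover have "real m * \<epsilon> \<le> (real m)\<^sup>2 * \<epsilon>"
      using m \<epsilon>0 by (intro mult_right_mono) (auto simp: power2_eq_square)
    ultimately show ?thesis using \<epsilon>(2) \<kappa> by simp
  qed
  have "int m dvd 2 * (\<Sum>i<m. (-1) ^ i * N i)"
    by (rule approximate_rotation_parity[OF m Nper yper ystep ybound yalt])
  then obtain W where W: "2 * (\<Sum>i<m. (-1) ^ i * N i) = int m * W" by blast
  obtain h where h: "m = 2 * h" using m by blast
  have alt0: "(\<Sum>i<m. (-1) ^ i :: real) = 0" unfolding h by (induction h) auto
  have "(\<Sum>i<m. v i) = (\<Sum>i<m. (-1) ^ i * (v 0 + of_int (N i)))"
    unfolding vN[symmetric] by (simp flip: mult.assoc power_mult_distrib)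
  also have "\<dots> = (\<Sum>i<m. (-1) ^ i) * v 0 + of_int (\<Sum>i<m. (-1) ^ i * N i)"
    by (simp add: sum.distrib sum_distrib_right distrib_left)
  also have "\<dots> = of_int (\<Sum>i<m. (-1) ^ i * N i)" using alt0 by simp
  finally have "2 * (\<Sum>i<m. v i) = of_int (int m * W)" unfolding W[symmetric] by simp
  moreover have "(\<Sum>i<m. v i) = (\<Sum>i<m. \<eta> i) / \<kappa>" by (simp add: v_def sum_divide_distrib)
  ultimately have "2 * (\<Sum>i<m. \<eta> i) = \<kappa> * real m * of_int W" using \<kappa> by (simp add: field_simps)
  then show ?thesis by blast
qed

section \<open>Minimizing curves in a doubling\<close>

text \<open>From an interior point, a segment to a point of \<open>K\<close> stays in the interior
  before its end. Hence a boundary point inside a straight piece of a curve forces the ends of that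
  piece onto the boundary.\<close>

lemma convex_frontier_prolong:
  fixes K :: "'a :: euclidean_space set"
  assumes K: "convex K" "closed K" and x: "x \<in> K" and y: "y \<in> K" and w: "w \<in> open_segment x y" "w \<in> frontier K"
  shows "x \<in> frontier K"
proof (rule ccontr)
  assume "x \<notin> frontier K"
  then have "x \<in> interior K" using x K by (simp add: frontier_def closure_closed)
  then have "open_segment x y \<subseteq> interior K"
    using y K by (intro in_interior_closure_convex_segment) (auto simp: closure_closed)
  with w show False by (auto simp: frontier_def)
qed

lemma dist_eq_imp_between:
  fixes f :: "real \<Rightarrow> 'a :: real_inner"
  assumes lip: "dist (f s) (f u) \<le> u - s" "dist (f u) (f t) \<le> t - u"
    and eq: "dist (f s) (f t) = t - s" and st: "s \<le> u" "u \<le> t" "s < t"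
  shows "f u = f s + ((u - s) / (t - s)) *\<^sub>R (f t - f s)"
proof -
  have d: "dist (f s) (f u) = u - s" "dist (f u) (f t) = t - u"
    using dist_triangle[of "f s" "f t" "f u"] lip eq by linarith+
  then have "dist (f s) (f t) = dist (f s) (f u) + dist (f u) (f t)" using eq by simp
  then have "norm (f s - f u) *\<^sub>R (f u - f t) = norm (f u - f t) *\<^sub>R (f s - f u)"
    unfolding dist_triangle_eq .
  then have "(u - s) *\<^sub>R (f u - f t) = (t - u) *\<^sub>R (f s - f u)" using d by (simp add: dist_norm)
  then have "(t - s) *\<^sub>R (f u - f s) = (u - s) *\<^sub>R (f t - f s)" by (simp add: algebra_simps)
  then have "(1 / (t - s)) *\<^sub>R ((t - s) *\<^sub>R (f u - f s)) = (1 / (t - s)) *\<^sub>R ((u - s) *\<^sub>R (f t - f s))"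
    by (rule arg_cong)
  then have "f u - f s = ((u - s) / (t - s)) *\<^sub>R (f t - f s)" using st by (simp del: scaleR_right_diff_distrib scaleR_diff_right)
  then show ?thesis by (metis add.commute diff_add_cancel)
qed

text \<open>Consecutive windows overlap in a piece of positive length, on which the direction is
  already known to be \<open>e\<close>. The step \<open>h\<close> is at most \<open>l / 2\<close> so
  that two steps fit into one window.\<close>

lemma local_isometry_affine:
  fixes f :: "real \<Rightarrow> 'a :: real_inner"
  assumes l: "0 < l" and AB: "A < B"
    and iso: "\<And>s t. A \<le> s \<Longrightarrow> s \<le> t \<Longrightarrow> t \<le> B \<Longrightarrow> t - s \<le> l \<Longrightarrow> dist (f s) (f t) = t - s"
  shows "\<exists>e. norm e = 1 \<and> (\<forall>t. A \<le> t \<and> t \<le> B \<longrightarrow> f t = f A + (t - A) *\<^sub>R e)"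
proof -
  have loc: "f u = f s + (u - s) *\<^sub>R ((1 / (t - s)) *\<^sub>R (f t - f s))"
    if "A \<le> s" "s \<le> u" "u \<le> t" "t \<le> B" "s < t" "t - s \<le> l" for s u t
    using dist_eq_imp_between[of f s u t] iso[of s u] iso[of u t] iso[of s t] that by simp
  define h where "h = min (l / 2) (B - A)"
  have h: "0 < h" "h \<le> l / 2" "A + h \<le> B" using l AB by (auto simp: h_def min_def)
  define e where "e = (1 / h) *\<^sub>R (f (A + h) - f A)"
  have ne: "norm e = 1" using iso[of A "A + h"] h by (simp add: e_def dist_norm norm_minus_commute)
  have step: "f t = f A + (t - A) *\<^sub>R e" if "A \<le> t" "t \<le> B" "t - A \<le> real (Suc n) * h" for t n
    using that
  proof (induction n arbitrary: t)
    case 0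
    then show ?case using loc[of A t "A + h"] h by (simp add: e_def)
  next
    case (Suc n)
    show ?case
    proof (cases "t - A \<le> h")
      case True
      then show ?thesis using loc[of A t "A + h"] h Suc.prems by (simp add: e_def)
    next
      case False
      define u s where "u = t - h" and "s = max A (u - h)"
      have us: "A \<le> s" "s < u" "u < t" "t - s \<le> l" "s \<le> t - h" using False h by (auto simp: u_def s_def)
      have su: "f s = f A + (s - A) *\<^sub>R e" "f u = f A + (u - A) *\<^sub>R e"
        using Suc.prems us h by (intro Suc.IH; simp add: u_def algebra_simps)+
      define g where "g = (1 / (t - s)) *\<^sub>R (f t - f s)"
      have fu: "f u = f s + (u - s) *\<^sub>R g" and ft: "f t = f s + (t - s) *\<^sub>R g"
        using loc[of s u t] loc[of s t t] us Suc.prems unfolding g_def by auto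
      have "(u - s) *\<^sub>R g = (u - s) *\<^sub>R e" using fu su by (simp add: algebra_simps)
      then have "g = e" using us by simp
      then show ?thesis using ft su by (simp add: algebra_simps)
    qed
  qed
  have "f t = f A + (t - A) *\<^sub>R e" if "A \<le> t" "t \<le> B" for t
  proof -
    obtain n where "(t - A) / h \<le> real n" using real_arch_simple by blast
    then have "t - A \<le> real (Suc n) * h" using h by (simp add: field_simps)
    with step that show ?thesis by blast
  qed
  with ne show ?thesis by blast
qed

text \<open>\<open>z\<close> is the planar projection of a curve parametrized by arc length and
  \<sigma> its sheet; \<open>iso\<close> says that windows no longer than \<open>l\<close> are
  shortest paths of the doubling. On the frontier the value of \<sigma> carries no information, as
  both sheets agree there.\<close>

locale double_geodesic = compact_set +
  fixes z :: "real \<Rightarrow> complex" and \<sigma> :: "real \<Rightarrow> sheet" and l L :: real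
  assumes convex: "convex K" and l: "0 < l" and L: "0 < L"
    and zK: "z t \<in> K"
    and zper: "z (t + L) = z t" and sper: "\<sigma> (t + L) = \<sigma> t"
    and iso: "s \<le> t \<Longrightarrow> t - s \<le> l \<Longrightarrow> cross_dist K (z s, \<sigma> s) (z t, \<sigma> t) = t - s"
begin

section \<open>Hits of the boundary are isolated, and sheets change only there\<close>

abbreviation "F \<equiv> frontier K"

lemma zdist: "s \<le> t \<Longrightarrow> t - s \<le> l \<Longrightarrow> dist (z s) (z t) \<le> t - s"
  using cross_dist_ge[of "(z s, \<sigma> s)" "(z t, \<sigma> t)"] iso by simp

text \<open>A boundary point belongs to both sheets, so if one end lies there, changing sheets costs
  nothing beyond the planar distance.\<close>

lemma same_sheet:
  assumes "s \<le> t" "t - s \<le> l" "\<sigma> s = \<sigma> t \<or> z s \<in> F \<or> z t \<in> F"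
  shows "dist (z s) (z t) = t - s"
proof -
  have "cross_dist K (z s, \<sigma> s) (z t, \<sigma> t) \<le> dist (z s) (z t)"
    using assms(3) cross_dist_le[of "z s" "(z s, \<sigma> s)" "(z t, \<sigma> t)"]
      cross_dist_le[of "z t" "(z s, \<sigma> s)" "(z t, \<sigma> t)"] by (auto simp: cross_dist_def)
  with zdist[of s t] iso[of s t] assms show ?thesis by simp
qed

lemma between:
  assumes "s < u" "u < t" "t - s \<le> l" "dist (z s) (z t) = t - s"
  shows "z u \<in> open_segment (z s) (z t)"
proof -
  have "z u = z s + ((u - s) / (t - s)) *\<^sub>R (z t - z s)"
    using assms by (intro dist_eq_imp_between zdist) auto
  then have "z u = (1 - (u - s) / (t - s)) *\<^sub>R z s + ((u - s) / (t - s)) *\<^sub>R z t"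
    by (simp add: algebra_simps)
  moreover have "z s \<noteq> z t" using assms by auto
  ultimately show ?thesis
    unfolding in_segment using assms by (intro conjI exI[of _ "(u - s) / (t - s)"]) auto
qed

lemma prolong:
  assumes "x \<in> K" "y \<in> K" "w \<in> open_segment x y" "w \<in> F"
  shows "x \<in> F" "y \<in> F"
  using convex_frontier_prolong[OF convex compact_imp_closed[OF compact] assms]
    convex_frontier_prolong[OF convex compact_imp_closed[OF compact] assms(2,1)] assms(3,4)
  by (auto simp: open_segment_commute)

lemma not_affine:
  assumes "norm e = 1" "\<And>t. A \<le> t \<Longrightarrow> t \<le> A + L \<Longrightarrow> z t = z A + (t - A) *\<^sub>R e"
  shows False
proof -
  have "z (A + L) = z A + L *\<^sub>R e" using assms(2)[of "A + L"] L by simp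
  then show False using zper[of A] L assms(1) by auto
qed

text \<open>A window starting at a hit is a straight planar segment. The second hit lies inside such
  a segment, and convexity drags the rest of the window onto the frontier.\<close>

lemma frontier_run:
  assumes "z t1 \<in> F" "z t2 \<in> F" "t1 < t2" "t2 - t1 < l"
  shows "t1 \<le> w \<Longrightarrow> w \<le> t1 + l \<Longrightarrow> z w \<in> F"
proof -
  assume w: "t1 \<le> w" "w \<le> t1 + l"
  consider "w = t1" | "w = t2" | "t1 < w" "w < t2" | "t2 < w" using w by linarith
  then show ?thesis
  proof cases
    case 3
    have "dist (z t1) (z (t1 + l)) = t1 + l - t1" by (rule same_sheet) (use assms l in auto)
    moreover have "dist (z w) (z (t1 + l)) = t1 + l - w"
    proof -
      have "dist (z t1) (z w) \<le> w - t1" "dist (z w) (z (t1 + l)) \<le> t1 + l - w"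
        using 3 assms by (auto intro!: zdist)
      then show ?thesis using dist_triangle[of "z t1" "z (t1 + l)" "z w"] calculation by linarith
    qed
    then have "z t2 \<in> open_segment (z w) (z (t1 + l))"
      using 3 assms by (intro between) auto
    then show ?thesis using prolong(1) zK assms by blast
  next
    case 4
    then have "dist (z t1) (z w) = w - t1" using assms w by (intro same_sheet) auto
    then have "z t2 \<in> open_segment (z t1) (z w)" using 4 w assms by (intro between) auto
    then show ?thesis using prolong(2) zK assms by blast
  qed (use assms in auto)
qed

text \<open>Two hits closer than \<open>l\<close> would trap the curve in the frontier forever.
  There all short windows are planar isometries, so the curve would be straight over a whole period
  and could not close up.\<close>

lemma frontier_gap:
  assumes "z t1 \<in> F" "z t2 \<in> F" "t1 < t2"
  shows "l \<le> t2 - t1"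
proof (rule ccontr)
  assume "\<not> ?thesis"
  then have lt: "t2 - t1 < l" by simp
  \<comment> \<open>The window advances by \<open>l / 2\<close>; two points at distance
    \<open>l / 4\<close> in the overlap serve as the close pair of hits for the next window.\<close>
  have run: "\<forall>w. t1 + real n * (l / 2) \<le> w \<and> w \<le> t1 + real n * (l / 2) + l \<longrightarrow> z w \<in> F" for n
  proof (induction n)
    case 0
    then show ?case using frontier_run[OF assms lt] by auto
  next
    case (Suc n)
    let ?a = "t1 + real (Suc n) * (l / 2)"
    have a: "?a = t1 + real n * (l / 2) + l / 2" by (simp add: field_simps)
    have "z ?a \<in> F" "z (?a + l / 4) \<in> F"
      using Suc[rule_format, of ?a] Suc[rule_format, of "?a + l / 4"] l unfolding a by simp_all
    then show ?case using frontier_run[of ?a "?a + l / 4"] l by auto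
  qed
  have all: "z w \<in> F" if "t1 \<le> w" for w
  proof -
    define n where "n = nat \<lfloor>(w - t1) / (l / 2)\<rfloor>"
    have "real n \<le> (w - t1) / (l / 2)" "(w - t1) / (l / 2) \<le> real n + 1"
      using that l unfolding n_def by (auto simp: of_nat_nat)
    then have "t1 + real n * (l / 2) \<le> w" "w \<le> t1 + real n * (l / 2) + l"
      using l by (simp_all add: field_simps)
    then show ?thesis using run by blast
  qed
  have "\<exists>e. norm e = 1 \<and> (\<forall>t. t1 \<le> t \<and> t \<le> t1 + L \<longrightarrow> z t = z t1 + (t - t1) *\<^sub>R e)"
  proof (rule local_isometry_affine[OF l])
    show "dist (z s) (z t) = t - s" if "t1 \<le> s" "s \<le> t" "t - s \<le> l" for s t
      using all that by (intro same_sheet) auto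
  qed (use L in simp)
  then show False using not_affine by blast
qed

text \<open>A signed distance to the boundary: its zeros are the crossings, so sheets can only change there.\<close>

definition height :: "real \<Rightarrow> real" where
  "height t = (case \<sigma> t of Front \<Rightarrow> infdist (z t) F | Back \<Rightarrow> - infdist (z t) F)"

lemma height_zero: "height t = 0 \<longleftrightarrow> z t \<in> F"
proof -
  have "infdist (z t) F = 0 \<longleftrightarrow> z t \<in> F"
    using compact_frontier frontier_nonempty by (simp add: in_closed_iff_infdist_zero compact_imp_closed)
  then show ?thesis unfolding height_def by (cases "\<sigma> t") auto
qed

text \<open>For points on different sheets the crossing point bounds both distances to the frontier,
  and the opposite signs turn their sum into a difference of heights.\<close>

lemma height_lipschitz:
  assumes "s \<le> t" "t - s \<le> l"
  shows "\<bar>height s - height t\<bar> \<le> t - s"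
proof (cases "\<sigma> s = \<sigma> t")
  case True
  have "\<bar>infdist (z s) F - infdist (z t) F\<bar> \<le> dist (z s) (z t)"
    using infdist_triangle[of "z s" F "z t"] infdist_triangle[of "z t" F "z s"]
    by (simp add: dist_commute abs_le_iff)
  then show ?thesis using zdist[OF assms] True unfolding height_def by (cases "\<sigma> t") auto
next
  case False
  then obtain a where a: "a \<in> F" "cross_dist K (z s, \<sigma> s) (z t, \<sigma> t) = dist (z s) a + dist a (z t)"
    using cross_dist_cases[of "(z s, \<sigma> s)" "(z t, \<sigma> t)"] by auto
  have "infdist (z s) F \<le> dist (z s) a" "infdist (z t) F \<le> dist (z t) a" using a by (auto intro: infdist_le)
  then have "infdist (z s) F + infdist (z t) F \<le> t - s"
    using a(2) iso[OF assms] by (simp add: dist_commute)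
  moreover have "0 \<le> infdist (z s) F" "0 \<le> infdist (z t) F" by (auto simp: infdist_nonneg)
  ultimately show ?thesis using False unfolding height_def by (cases "\<sigma> s"; cases "\<sigma> t") auto
qed

lemma continuous_height: "continuous_on UNIV height"
  unfolding continuous_on_iff
proof (intro ballI allI impI)
  fix s e :: real assume "0 < e"
  have "dist (height t) (height s) < e" if "dist t s < min e l" for t
    using height_lipschitz[of s t] height_lipschitz[of t s] that
    by (cases "s \<le> t") (auto simp: dist_real_def abs_minus_commute)
  then show "\<exists>d>0. \<forall>t\<in>UNIV. dist t s < d \<longrightarrow> dist (height t) (height s) < e"
    using \<open>0 < e\<close> l by (intro exI[of _ "min e l"]) auto
qed

lemma sheet_const:
  assumes "s \<le> t" "\<And>u. s \<le> u \<Longrightarrow> u \<le> t \<Longrightarrow> z u \<notin> F"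
  shows "\<sigma> s = \<sigma> t"
proof (rule ccontr)
  assume ne: "\<sigma> s \<noteq> \<sigma> t"
  have nn: "0 \<le> infdist (z u) F" for u by (rule infdist_nonneg)
  have c: "continuous_on {s..t} height" using continuous_height continuous_on_subset by blast
  have "\<exists>u. s \<le> u \<and> u \<le> t \<and> height u = 0"
  proof (cases "\<sigma> s")
    case Front
    then have "\<sigma> t = Back" using ne by (cases "\<sigma> t") auto
    then show ?thesis using Front nn[of s] nn[of t] assms(1) c
      by (intro IVT2') (auto simp: height_def)
  next
    case Back
    then have "\<sigma> t = Front" using ne by (cases "\<sigma> t") auto
    then show ?thesis using Back nn[of s] nn[of t] assms(1) c
      by (intro IVT') (auto simp: height_def)
  qed
  with assms(2) height_zero show False by blast
qed

lemma closed_hits: "closed {t. z t \<in> F}"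
proof -
  have "{t. z t \<in> F} = height -` {0} \<inter> UNIV" by (auto simp: height_zero)
  then show ?thesis using continuous_closed_vimage[of "{0}" height] continuous_height
    by (simp add: continuous_on_eq_continuous_at)
qed

lemma iso_between_hits:
  assumes "\<And>u. A < u \<Longrightarrow> u < B \<Longrightarrow> z u \<notin> F" "A \<le> s" "s \<le> t" "t \<le> B" "t - s \<le> l"
  shows "dist (z s) (z t) = t - s"
proof (cases "z s \<in> F \<or> z t \<in> F")
  case False
  have "z u \<notin> F" if "s \<le> u" "u \<le> t" for u
    using assms that False by (cases "u = A"; cases "u = B") force+
  then show ?thesis using assms by (intro same_sheet disjI1 sheet_const)
qed (use assms in \<open>auto intro: same_sheet\<close>)

lemma hits_exist: "\<exists>t. z t \<in> F"
proof (rule ccontr)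
  assume n: "\<nexists>t. z t \<in> F"
  have "\<exists>e. norm e = 1 \<and> (\<forall>t. 0 \<le> t \<and> t \<le> 0 + L \<longrightarrow> z t = z 0 + (t - 0) *\<^sub>R e)"
  proof (rule local_isometry_affine[OF l])
    show "dist (z s) (z t) = t - s" if "0 \<le> s" "s \<le> t" "t \<le> 0 + L" "t - s \<le> l" for s t
      using n that by (intro iso_between_hits[of 0 L]) auto
  qed (use L in simp)
  then show False using not_affine[of _ 0] by blast
qed

end

section \<open>The sequence of bounces and the chords between them\<close>

context double_geodesic
begin

text \<open>The condition \<open>t + l \<le> u\<close> in place of \<open>t < u\<close> makes the
  set closed, so that the infimum is attained. No hit is skipped if \<open>t\<close> is itself a
  hit, because hits are at least \<open>l\<close> apart.\<close>

definition next_hit :: "real \<Rightarrow> real" where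
  "next_hit t = Inf {u. z u \<in> F \<and> t + l \<le> u}"

lemma next_hit:
  assumes "z t \<in> F"
  shows "z (next_hit t) \<in> F" "t + l \<le> next_hit t" "\<And>u. t < u \<Longrightarrow> u < next_hit t \<Longrightarrow> z u \<notin> F"
proof -
  let ?H = "{u. z u \<in> F \<and> t + l \<le> u}"
  have per: "z (t + real n * L) = z t" for n
  proof (induction n)
    case (Suc n)
    then show ?case using zper[of "t + real n * L"] by (simp add: algebra_simps)
  qed simp
  obtain n where "l / L \<le> real n" using real_arch_simple by blast
  then have "t + real n * L \<in> ?H" using per assms L by (simp add: field_simps)
  then have ne: "?H \<noteq> {}" by blast
  have eq: "?H = {u. z u \<in> F} \<inter> {t + l..}" by auto
  have cl: "closed ?H" unfolding eq by (intro closed_Int closed_hits closed_atLeast)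
  have bb: "bdd_below ?H" by (rule bdd_belowI[of _ "t + l"]) auto
  have "next_hit t \<in> ?H" unfolding next_hit_def by (rule closed_contains_Inf[OF ne bb cl])
  then show "z (next_hit t) \<in> F" "t + l \<le> next_hit t" by auto
  fix u assume u: "t < u" "u < next_hit t"
  show "z u \<notin> F"
  proof
    assume "z u \<in> F"
    then have "u \<in> ?H" using frontier_gap[OF assms _ u(1)] by simp
    then have "next_hit t \<le> u" unfolding next_hit_def by (rule cInf_lower[OF _ bb])
    with u show False by simp
  qed
qed

definition hit :: "nat \<Rightarrow> real" where
  "hit i = (next_hit ^^ i) (SOME t. z t \<in> F)"

lemma hit_frontier: "z (hit i) \<in> F"
proof (induction i)
  case 0
  then show ?case using someI_ex[OF hits_exist] by (simp add: hit_def)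
qed (simp add: hit_def next_hit(1))

lemma hit_Suc: "hit (Suc i) = next_hit (hit i)" by (simp add: hit_def)

lemma hit_gap: "hit i + l \<le> hit (Suc i)"
  unfolding hit_Suc by (rule next_hit(2)[OF hit_frontier])

lemma no_hit: "hit i < u \<Longrightarrow> u < hit (Suc i) \<Longrightarrow> z u \<notin> F"
  unfolding hit_Suc by (rule next_hit(3)[OF hit_frontier])

lemma hit_ge: "hit 0 + real n * l \<le> hit n"
proof (induction n)
  case (Suc n)
  then show ?case using hit_gap[of n] by (simp add: algebra_simps)
qed simp

text \<open>Hits advance by at least \<open>l\<close>, so a period contains finitely many, and
  \<open>m\<close> counts them. With \<open>L = k * l\<close> the bound on \<open>m\<close> becomes
  \<open>m \<le> k\<close>.\<close>

lemma hit_period: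
  obtains m where "0 < m" "real m * l \<le> L" "\<And>i. hit (i + m) = hit i + L"
proof -
  let ?P = "\<lambda>n. hit n \<le> hit 0 + L"
  obtain N where N: "L / l < real N" using reals_Archimedean2 by blast
  have bound: "n \<le> N" if "?P n" for n
  proof -
    have "real n * l \<le> L" using hit_ge[of n] that by simp
    then have "real n \<le> L / l" using l by (simp add: field_simps)
    with N show ?thesis by simp
  qed
  define m where "m = Greatest ?P"
  have m: "?P m" unfolding m_def by (rule GreatestI_nat[of ?P 0 N]) (use L bound in auto)
  have "\<not> ?P (Suc m)"
    using Greatest_le_nat[of ?P "Suc m" N] bound unfolding m_def by auto
  then have lt: "hit 0 + L < hit (Suc m)" by simp
  have "z (hit 0 + L) \<in> F" using zper hit_frontier by simp
  then have eq: "hit m = hit 0 + L" using no_hit[of m "hit 0 + L"] m lt by force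
  have shift: "hit (i + m) = hit i + L" for i
  proof (induction i)
    case (Suc i)
    have a: "z (hit (Suc i) + L) \<in> F" "z (hit (Suc (i + m)) - L) \<in> F"
      using zper[of "hit (Suc i)"] zper[of "hit (Suc (i + m)) - L"] hit_frontier[of "Suc i"]
        hit_frontier[of "Suc (i + m)"] by simp_all
    have "\<not> hit (Suc i) + L < hit (Suc (i + m))"
      using no_hit[of "i + m" "hit (Suc i) + L"] a(1) Suc hit_gap[of i] l by auto
    moreover have "\<not> hit (Suc (i + m)) < hit (Suc i) + L"
      using no_hit[of i "hit (Suc (i + m)) - L"] a(2) Suc hit_gap[of "i + m"] l by auto
    ultimately show ?case by simp
  qed (use eq in simp)
  have "0 < m" using eq L by (cases m) auto
  moreover have "real m * l \<le> L" using hit_ge[of m] eq by simp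
  ultimately show thesis using that shift by blast
qed

definition chord_sheet :: "nat \<Rightarrow> sheet" where
  "chord_sheet i = \<sigma> ((hit i + hit (Suc i)) / 2)"

lemma chord_sheet:
  assumes "hit i < u" "u < hit (Suc i)"
  shows "\<sigma> u = chord_sheet i"
proof -
  let ?c = "(hit i + hit (Suc i)) / 2"
  have "\<sigma> u = \<sigma> ?c" if "u \<le> ?c"
    using that assms by (intro sheet_const no_hit[of i]) auto
  moreover have "\<sigma> ?c = \<sigma> u" if "?c \<le> u"
    using that assms by (intro sheet_const no_hit[of i]) auto
  ultimately show ?thesis unfolding chord_sheet_def using linear by metis
qed

text \<open>Without a change of sheet, a window around the bounce would be a straight segment with a
  boundary point in its middle. By convexity its ends would be boundary points as well, although
  they lie strictly between hits.\<close>

lemma chord_sheet_Suc: "chord_sheet (Suc i) \<noteq> chord_sheet i"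
proof
  assume eq: "chord_sheet (Suc i) = chord_sheet i"
  let ?s = "hit (Suc i) - l / 2" and ?u = "hit (Suc i) + l / 2"
  have s: "hit i < ?s" "?s < hit (Suc i)" and u: "hit (Suc i) < ?u" "?u < hit (Suc (Suc i))"
    using hit_gap[of i] hit_gap[of "Suc i"] l by auto
  have "\<sigma> ?s = \<sigma> ?u" using chord_sheet[OF s] chord_sheet[OF u] eq by simp
  then have "dist (z ?s) (z ?u) = ?u - ?s" using l by (intro same_sheet) auto
  then have "z (hit (Suc i)) \<in> open_segment (z ?s) (z ?u)" using l by (intro between) auto
  then have "z ?s \<in> F" using prolong(1) zK hit_frontier by blast
  then show False using no_hit[OF s] by simp
qed

lemma chord_sheet_parity: "chord_sheet i = chord_sheet 0 \<longleftrightarrow> even i"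
proof (induction i)
  case (Suc i)
  have "chord_sheet (Suc i) = chord_sheet 0 \<longleftrightarrow> chord_sheet i \<noteq> chord_sheet 0"
    using chord_sheet_Suc[of i] by (metis sheet.exhaust)
  then show ?case using Suc by simp
qed simp

definition bounce :: "nat \<Rightarrow> complex" where "bounce i = z (hit i)"

definition chord_length :: "nat \<Rightarrow> real" where "chord_length i = hit (Suc i) - hit i"

definition chord_dir :: "nat \<Rightarrow> complex" where
  "chord_dir i = (1 / chord_length i) *\<^sub>R (bounce (Suc i) - bounce i)"

lemma chord_length_ge: "l \<le> chord_length i"
  using hit_gap[of i] by (simp add: chord_length_def)

lemma chord:
  shows "norm (chord_dir i) = 1"
    and "0 \<le> r \<Longrightarrow> r \<le> chord_length i \<Longrightarrow> z (hit i + r) = bounce i + r *\<^sub>R chord_dir i"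
proof -
  have pos: "0 < chord_length i" using chord_length_ge l less_le_trans by blast
  have "\<exists>e. norm e = 1 \<and> (\<forall>t. hit i \<le> t \<and> t \<le> hit (Suc i) \<longrightarrow> z t = z (hit i) + (t - hit i) *\<^sub>R e)"
  proof (rule local_isometry_affine[OF l])
    show "dist (z s) (z t) = t - s" if "hit i \<le> s" "s \<le> t" "t \<le> hit (Suc i)" "t - s \<le> l" for s t
      by (rule iso_between_hits[OF no_hit[of i] that])
  qed (use pos chord_length_def in simp)
  then obtain e where e: "norm e = 1"
    and z: "\<And>t. hit i \<le> t \<Longrightarrow> t \<le> hit (Suc i) \<Longrightarrow> z t = z (hit i) + (t - hit i) *\<^sub>R e" by blast
  have "bounce (Suc i) - bounce i = chord_length i *\<^sub>R e"
    using z[of "hit (Suc i)"] pos by (simp add: bounce_def chord_length_def)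
  then have "chord_dir i = e" using pos by (simp add: chord_dir_def)
  with e show "norm (chord_dir i) = 1" by simp
  show "z (hit i + r) = bounce i + r *\<^sub>R chord_dir i" if "0 \<le> r" "r \<le> chord_length i"
    using z[of "hit i + r"] that \<open>chord_dir i = e\<close> by (simp add: bounce_def chord_length_def)
qed

lemma bounce_Suc: "bounce (Suc i) = bounce i + chord_length i *\<^sub>R chord_dir i"
  using chord(2)[of "chord_length i" i] chord_length_ge[of i] l by (simp add: bounce_def chord_length_def)

lemma chord_interior:
  assumes "0 < r" "r < chord_length i"
  shows "bounce i + r *\<^sub>R chord_dir i \<in> interior K"
proof -
  have "z (hit i + r) \<notin> F" using assms by (intro no_hit[of i]) (auto simp: chord_length_def)
  then have "z (hit i + r) \<in> interior K"
    using zK[of "hit i + r"] compact_imp_closed[OF compact] by (simp add: frontier_def closure_closed)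
  then show ?thesis using chord(2)[of r i] assms by simp
qed

text \<open>The two points lie on different sheets, so every frontier point \<open>w\<close> is a
  competing place to cross. Varying \<open>w\<close> over the sides of a polygon yields all the
  later constraints on a bounce.\<close>

lemma crossing:
  assumes "0 < \<tau>" "0 < \<rho>" "\<tau> + \<rho> \<le> l" "w \<in> F"
  shows "\<tau> + \<rho> \<le> dist (bounce (Suc i) - \<tau> *\<^sub>R chord_dir i) w +
    dist w (bounce (Suc i) + \<rho> *\<^sub>R chord_dir (Suc i))"
proof -
  let ?s = "hit (Suc i) - \<tau>" and ?t = "hit (Suc i) + \<rho>"
  have s: "hit i < ?s" "?s < hit (Suc i)" and t: "hit (Suc i) < ?t" "?t < hit (Suc (Suc i))"
    using hit_gap[of i] hit_gap[of "Suc i"] assms by auto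
  have "\<sigma> ?s \<noteq> \<sigma> ?t" using chord_sheet[OF s] chord_sheet[OF t] chord_sheet_Suc[of i] by simp
  have "\<tau> + \<rho> = cross_dist K (z ?s, \<sigma> ?s) (z ?t, \<sigma> ?t)" using assms by (subst iso) auto
  also have "\<dots> \<le> dist (z ?s) w + dist w (z ?t)"
    using cross_dist_le[OF assms(4), of "(z ?s, \<sigma> ?s)" "(z ?t, \<sigma> ?t)"] by simp
  also have "z ?t = bounce (Suc i) + \<rho> *\<^sub>R chord_dir (Suc i)"
    using t assms by (intro chord(2)) (auto simp: chord_length_def)
  also have "z ?s = bounce (Suc i) - \<tau> *\<^sub>R chord_dir i"
  proof -
    have "z (hit i + (chord_length i - \<tau>)) = bounce i + (chord_length i - \<tau>) *\<^sub>R chord_dir i"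
      using s assms by (intro chord(2)) (auto simp: chord_length_def)
    then show ?thesis by (simp add: bounce_Suc chord_length_def algebra_simps)
  qed
  finally show ?thesis .
qed

lemma bounce_frontier: "bounce i \<in> F" by (simp add: bounce_def hit_frontier)

text \<open>\<open>m\<close> is even because the sheet has to return after a period and switches at
  every bounce.\<close>

lemma bounce_period:
  obtains m where "0 < m" "even m" "real m * l \<le> L" "\<And>i. bounce (i + m) = bounce i"
    "\<And>i. chord_dir (i + m) = chord_dir i" "\<And>i. chord_length (i + m) = chord_length i"
    "(\<Sum>i<m. chord_length i) = L"
proof -
  obtain m where m: "0 < m" "real m * l \<le> L" "\<And>i. hit (i + m) = hit i + L" using hit_period by blast
  have mS: "hit (Suc (i + m)) = hit (Suc i) + L" for i using m(3)[of "Suc i"] by simp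
  have "chord_sheet m = chord_sheet 0"
    using m(3)[of 0] mS[of 0] sper[of "(hit 0 + hit (Suc 0)) / 2"]
    by (simp add: chord_sheet_def field_simps)
  then have "even m" using chord_sheet_parity by blast
  moreover have b: "bounce (i + m) = bounce i" for i by (simp add: bounce_def m zper)
  moreover have c: "chord_length (i + m) = chord_length i" for i by (simp add: chord_length_def m mS)
  moreover have "chord_dir (i + m) = chord_dir i" for i
    using b[of "Suc i"] by (simp add: chord_dir_def b c)
  moreover have "(\<Sum>i<n. chord_length i) = hit n - hit 0" for n
    by (induction n) (auto simp: chord_length_def)
  ultimately show thesis using that[of m] m m(3)[of 0] by simp
qed

end

section \<open>Shortest crossings of an edge\<close>

lemma inner_complex_cnj: "x \<bullet> u = Re (x * cnj u)"
  by (simp add: inner_complex_def)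

text \<open>The squared distance from \<open>x\<close> to the mirror image of \<open>y\<close> in the line \<open>w \<bullet> u = 1\<close>.\<close>

definition unfolded_dist_sq :: "'a :: real_inner \<Rightarrow> 'a \<Rightarrow> 'a \<Rightarrow> real" where
  "unfolded_dist_sq u x y = (dist x y)\<^sup>2 + 4 * (1 - x \<bullet> u) * (1 - y \<bullet> u)"

lemma unfolded_dist_sq_eq:
  assumes "norm u = 1"
  shows "(dist x (y + (2 * (1 - y \<bullet> u)) *\<^sub>R u))\<^sup>2 = unfolded_dist_sq u x y"
proof -
  have "u \<bullet> u = 1" using assms by (simp add: dot_square_norm)
  then show ?thesis
    by (simp add: unfolded_dist_sq_def dist_norm power2_norm_eq_inner inner_diff_left inner_diff_right
        inner_add_left inner_add_right inner_commute algebra_simps)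
qed

lemma dist_reflect:
  assumes "norm u = 1" "w \<bullet> u = 1"
  shows "dist w (y + (2 * (1 - y \<bullet> u)) *\<^sub>R u) = dist w y"
proof -
  have "(dist w (y + (2 * (1 - y \<bullet> u)) *\<^sub>R u))\<^sup>2 = (dist w y)\<^sup>2"
    using unfolded_dist_sq_eq[OF assms(1), of w y] assms(2) by (simp add: unfolded_dist_sq_def)
  then show ?thesis by simp
qed

lemma path_via_line_ge:
  assumes "norm u = 1" "w \<bullet> u = 1"
  shows "sqrt (unfolded_dist_sq u x y) \<le> dist x w + dist w y"
proof -
  have "sqrt (unfolded_dist_sq u x y) = dist x (y + (2 * (1 - y \<bullet> u)) *\<^sub>R u)"
    unfolding unfolded_dist_sq_eq[OF assms(1), symmetric] by simp
  then show ?thesis using dist_triangle[of x "y + (2 * (1 - y \<bullet> u)) *\<^sub>R u" w] dist_reflect[OF assms, of y] by simp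
qed

lemma path_via_line_exists:
  fixes x y u :: "'a :: real_inner"
  assumes u: "norm u = 1" and xy: "x \<bullet> u \<le> 1" "y \<bullet> u \<le> 1"
  obtains w where "w \<bullet> u = 1" "dist x w + dist w y = sqrt (unfolded_dist_sq u x y)"
proof -
  have uu: "u \<bullet> u = 1" using u by (simp add: dot_square_norm)
  define y' where "y' = y + (2 * (1 - y \<bullet> u)) *\<^sub>R u"
  \<comment> \<open>The parameter at which the segment from \<open>x\<close> to the mirror image of
    \<open>y\<close> meets the line. If \<open>x\<close> and \<open>y\<close> both lie on the line,
    division by zero gives \<open>t = 0\<close> and \<open>w = x\<close>.\<close>
  define t where "t = (1 - x \<bullet> u) / ((1 - x \<bullet> u) + (1 - y \<bullet> u))"
  define w where "w = x + t *\<^sub>R (y' - x)"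
  have y'u: "y' \<bullet> u = 2 - y \<bullet> u" by (simp add: y'_def inner_add_left uu)
  have t: "0 \<le> t" "t \<le> 1" using xy by (auto simp: t_def divide_le_eq_1)
  have wu: "w \<bullet> u = 1"
  proof (cases "(1 - x \<bullet> u) + (1 - y \<bullet> u) = 0")
    case True
    then have "x \<bullet> u = 1" "t = 0" using xy by (auto simp: t_def)
    then show ?thesis by (simp add: w_def)
  next
    case False
    have "w \<bullet> u = x \<bullet> u + t * ((1 - x \<bullet> u) + (1 - y \<bullet> u))"
      by (simp add: w_def inner_add_left inner_diff_left y'u algebra_simps)
    then show ?thesis using False by (simp add: t_def)
  qed
  have "dist x w = t * dist x y'" using t by (simp add: w_def dist_norm norm_minus_commute)
  moreover have "dist w y' = (1 - t) * dist x y'"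
  proof -
    have "w - y' = (1 - t) *\<^sub>R (x - y')" by (simp add: w_def algebra_simps)
    then show ?thesis using t by (simp add: dist_norm)
  qed
  ultimately have "dist x w + dist w y' = dist x y'" by (simp add: algebra_simps)
  also have "\<dots> = sqrt (unfolded_dist_sq u x y)"
    unfolding unfolded_dist_sq_eq[OF u, symmetric] by (simp add: y'_def)
  finally show thesis using that wu dist_reflect[OF u wu, of y] by (simp add: y'_def)
qed

text \<open>\<open>U\<close> holds the outward normals of supporting lines tangent to the unit
  circle: the side normals for a polygon, the whole circle for the disk. Both doublings are thus
  covered by the same arguments.\<close>

locale circumscribed = compact_set +
  fixes U :: "complex set"
  assumes convex: "convex K"
    and unit: "u \<in> U \<Longrightarrow> norm u = 1"
    and half: "u \<in> U \<Longrightarrow> x \<in> K \<Longrightarrow> x \<bullet> u \<le> 1"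
    and touch: "x \<in> frontier K \<Longrightarrow> \<exists>u\<in>U. x \<bullet> u = 1"
    and disk: "cball 0 1 \<subseteq> K"
begin

lemma interior_half: "u \<in> U \<Longrightarrow> x \<in> interior K \<Longrightarrow> x \<bullet> u < 1"
proof -
  assume u: "u \<in> U" and x: "x \<in> interior K"
  have "interior K \<subseteq> interior {x. u \<bullet> x \<le> 1}"
    using half[OF u] by (intro interior_mono) (auto simp: inner_commute)
  then show ?thesis using x unit[OF u] by (subst (asm) interior_halfspace_le) (auto simp: inner_commute)
qed

text \<open>The best crossing point of the line may lie beyond the end of the side. The way to it
  then leaves \<open>K\<close> at some frontier point, and turning off towards \<open>y\<close>
  there is no longer.\<close>

lemma path_via_frontier:
  assumes u: "u \<in> U" and x: "x \<in> K" and y: "y \<in> K"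
  obtains a where "a \<in> frontier K" "dist x a + dist a y \<le> sqrt (unfolded_dist_sq u x y)"
proof -
  obtain w where w: "w \<bullet> u = 1" "dist x w + dist w y = sqrt (unfolded_dist_sq u x y)"
    using path_via_line_exists[OF unit[OF u] half[OF u x] half[OF u y]] by blast
  have "w \<notin> interior K" using interior_half[OF u] w(1) by force
  have "closed_segment x w \<inter> frontier K \<noteq> {}"
  proof (cases "w \<in> K")
    case True
    then have "w \<in> frontier K"
      using \<open>w \<notin> interior K\<close> compact by (simp add: frontier_def compact_imp_closed closure_closed)
    then show ?thesis by blast
  next
    case False
    then show ?thesis using x by (intro connected_Int_frontier connected_segment) auto
  qed
  then obtain a where a: "a \<in> closed_segment x w" "a \<in> frontier K" by blast
  have "dist x a + dist a w = dist x w" using a(1) by (metis between between_mem_segment dist_commute)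
  then have "dist x a + dist a y \<le> dist x w + dist w y" using dist_triangle[of a y w] by linarith
  with w a that show thesis by simp
qed

lemma frontierI: "x \<in> K \<Longrightarrow> u \<in> U \<Longrightarrow> x \<bullet> u = 1 \<Longrightarrow> x \<in> frontier K"
  using interior_half[of u x] compact by (force simp: frontier_def compact_imp_closed closure_closed)

end

text \<open>\<open>- u^2 * cnj e\<close> is the mirror image of \<open>e\<close> in the direction of
  the side. In coordinates where \<open>u\<close> is 1, the inequality reduces to a sum of two
  squares being at most 0, so no first variation is needed.\<close>

lemma reflection_law:
  fixes a e e' u :: complex
  assumes u: "norm u = 1" and e: "norm e = 1" "norm e' = 1" and a: "a \<bullet> u = 1" and l: "0 < l"
    and le: "l\<^sup>2 \<le> unfolded_dist_sq u (a - (l / 2) *\<^sub>R e) (a + (l / 2) *\<^sub>R e')"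
  shows "e' = - u\<^sup>2 * cnj e"
proof -
  have uu: "u * cnj u = 1" "cnj u * u = 1" using u by (simp_all add: complex_norm_square[symmetric] mult.commute)
  define E E' where "E = e * cnj u" and "E' = e' * cnj u"
  have E: "(Re E)\<^sup>2 + (Im E)\<^sup>2 = 1" "(Re E')\<^sup>2 + (Im E')\<^sup>2 = 1"
    using e u unfolding cmod_power2[symmetric] by (simp_all add: E_def E'_def norm_mult)
  have in1: "(a - (l / 2) *\<^sub>R e) \<bullet> u = 1 - l / 2 * Re E"
    unfolding E_def inner_complex_cnj[symmetric] using a by (simp add: inner_diff_left)
  have in2: "(a + (l / 2) *\<^sub>R e') \<bullet> u = 1 + l / 2 * Re E'"
    unfolding E'_def inner_complex_cnj[symmetric] using a by (simp add: inner_add_left)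
  have "dist (a - (l / 2) *\<^sub>R e) (a + (l / 2) *\<^sub>R e') = norm ((l / 2) *\<^sub>R (e + e'))"
    unfolding dist_norm by (subst norm_minus_commute) (simp add: algebra_simps)
  also have "\<dots> = l / 2 * norm (E + E')"
    using l u by (simp add: E_def E'_def norm_mult flip: distrib_right)
  finally have d: "dist (a - (l / 2) *\<^sub>R e) (a + (l / 2) *\<^sub>R e') = l / 2 * norm (E + E')" .
  have "(dist (a - (l / 2) *\<^sub>R e) (a + (l / 2) *\<^sub>R e'))\<^sup>2 =
      (l / 2)\<^sup>2 * ((Re E + Re E')\<^sup>2 + (Im E + Im E')\<^sup>2)"
    unfolding d by (simp only: power_mult_distrib cmod_power2 plus_complex.sel)
  then have "l\<^sup>2 \<le> (l / 2)\<^sup>2 * ((Re E + Re E')\<^sup>2 + (Im E + Im E')\<^sup>2) - l\<^sup>2 * (Re E * Re E')"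
    using le unfolding unfolded_dist_sq_def in1 in2
    by (simp add: power2_eq_square mult_ac)
  also have "\<dots> = l\<^sup>2 * (((Re E + Re E')\<^sup>2 + (Im E + Im E')\<^sup>2) / 4 - Re E * Re E')"
    by (simp add: power_divide algebra_simps)
  finally have "1 \<le> ((Re E + Re E')\<^sup>2 + (Im E + Im E')\<^sup>2) / 4 - Re E * Re E'"
    using l by (simp add: mult_le_cancel_left1)
  then have "(Re E + Re E')\<^sup>2 + (Im E - Im E')\<^sup>2 \<le> 0"
    using E by (simp add: power2_eq_square algebra_simps)
  then have "Re E + Re E' = 0" "Im E - Im E' = 0" by (auto simp: sum_power2_le_zero_iff)
  then have "E' = - cnj E" by (simp add: complex_eq_iff)
  then have "E' * u = - cnj e * u * u" by (simp add: E_def)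
  moreover have "E' * u = e'" by (simp add: E'_def mult.assoc uu)
  ultimately show ?thesis by (simp add: power2_eq_square mult_ac)
qed

text \<open>Unfolds the window around a bounce in the neighbouring side with normal
  \<open>v\<close>. In coordinates where \<open>u\<close> is 1 the two chord directions are mirror
  images, and \<open>1 - cos \<kappa> - b * sin \<kappa>\<close> is the distance from the bounce to
  the line of that side.\<close>

lemma offset_inequality:
  fixes a e u v :: complex and \<eta> b \<kappa> l :: real
  assumes u: "norm u = 1" and a: "a = u * Complex 1 b"
    and e: "e = u * Complex (sin \<eta>) (cos \<eta>)" "e' = u * Complex (- sin \<eta>) (cos \<eta>)"
    and v: "v = u * cis \<kappa>"
    and le: "l\<^sup>2 \<le> unfolded_dist_sq v (a - (l / 2) *\<^sub>R e) (a + (l / 2) *\<^sub>R e')"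
  shows "l\<^sup>2 * (sin \<kappa>)\<^sup>2 \<le> 4 * (1 - cos \<kappa> - b * sin \<kappa>)\<^sup>2 + 4 * (1 - cos \<kappa> - b * sin \<kappa>) * l * sin \<eta> * cos \<kappa>"
proof -
  have uu: "cnj u * u = 1" "u * cnj u = 1" using u by (simp_all add: complex_norm_square[symmetric] mult.commute)
  define s c S C where "s = sin \<eta>" and "c = cos \<eta>" and "S = sin \<kappa>" and "C = cos \<kappa>"
  have sc: "s\<^sup>2 = 1 - c\<^sup>2" "S\<^sup>2 = 1 - C\<^sup>2" by (simp_all add: s_def c_def S_def C_def sin_squared_eq)
  have inn: "(u * w) \<bullet> v = Re (w * cnj (cis \<kappa>))" for w
  proof -
    have "u * w * cnj v = w * cnj (cis \<kappa>)" unfolding v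
      by (metis (no_types, lifting) complex_cnj_mult mult.assoc mult.commute mult.right_neutral uu(1))
    then show ?thesis by (simp only: inner_complex_cnj)
  qed
  define X Y where "X = Complex (1 - l / 2 * s) (b - l / 2 * c)" and "Y = Complex (1 - l / 2 * s) (b + l / 2 * c)"
  have x: "a - (l / 2) *\<^sub>R e = u * X" and y: "a + (l / 2) *\<^sub>R e' = u * Y"
    by (simp_all add: a e X_def Y_def s_def c_def complex_eq_iff algebra_simps)
  have "dist (u * X) (u * Y) = norm (X - Y)" using u by (simp add: dist_norm norm_mult flip: right_diff_distrib)
  also have "\<dots> = \<bar>l * c\<bar>" by (simp add: X_def Y_def cmod_def mult.commute)
  finally have d: "(dist (u * X) (u * Y))\<^sup>2 = (l * c)\<^sup>2" by simp
  define q where "q = 1 - C - b * S"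
  have "1 - (u * X) \<bullet> v = q + l / 2 * (s * C + c * S)" "1 - (u * Y) \<bullet> v = q + l / 2 * (s * C - c * S)"
    unfolding inn q_def by (simp_all add: X_def Y_def S_def C_def algebra_simps)
  then have "l\<^sup>2 \<le> (l * c)\<^sup>2 + 4 * (q + l / 2 * (s * C + c * S)) * (q + l / 2 * (s * C - c * S))"
    using le d unfolding x y unfolded_dist_sq_def by simp
  also have "\<dots> = 4 * q\<^sup>2 + 4 * q * l * s * C + l\<^sup>2 * (c\<^sup>2 + s\<^sup>2 * C\<^sup>2 - c\<^sup>2 * S\<^sup>2)"
    by (simp add: power2_eq_square algebra_simps)
  also have "c\<^sup>2 + s\<^sup>2 * C\<^sup>2 - c\<^sup>2 * S\<^sup>2 = 1 - S\<^sup>2" unfolding sc by (simp add: algebra_simps)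
  finally show ?thesis unfolding q_def S_def C_def s_def by (simp add: algebra_simps)
qed

section \<open>Regular polygons\<close>

text \<open>As the inradius is 1, this is also the midpoint of side \<open>j\<close>. Integer
  indices let one pass to neighbouring sides without reducing modulo \<open>n\<close>.\<close>

definition edge_normal :: "nat \<Rightarrow> int \<Rightarrow> complex" where
  "edge_normal n j = cis ((2 * of_int j + 1) * pi / real n)"

lemma norm_edge_normal [simp]: "norm (edge_normal n j) = 1"
  by (simp add: edge_normal_def)

lemma inner_cis: "cis a \<bullet> cis b = cos (a - b)"
  by (simp add: inner_complex_def cos_diff)

lemma edge_normal_add: "edge_normal n (j + i) = edge_normal n j * cis (2 * of_int i * pi / real n)"
  by (simp add: edge_normal_def cis_mult add_divide_distrib algebra_simps)

lemma edge_normal_mod: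
  assumes "0 < n"
  shows "edge_normal n (j mod int n) = edge_normal n j"
proof -
  have "edge_normal n j = edge_normal n (j mod int n) * cis (2 * of_int (int n * (j div int n)) * pi / real n)"
    by (metis edge_normal_add mod_mult_div_eq)
  also have "2 * of_int (int n * (j div int n)) * pi / real n = 2 * pi * of_int (j div int n)"
    using assms by simp
  also have "cis \<dots> = 1" by (simp add: cis_multiple_2pi)
  finally show ?thesis by simp
qed

text \<open>Side normals point halfway between vertices, so the angle between a vertex and a side
  normal is an odd multiple of \<open>pi / n\<close>. The cosine is largest for the two vertices of
  the side.\<close>

lemma cos_odd_multiple_le:
  fixes q :: int
  assumes "odd q" "0 < n"
  shows "cos (of_int q * pi / real n) \<le> cos (pi / real n)"
proof -
  define r where "r = q mod (2 * int n)"
  have r: "odd r" "0 \<le> r" "r < 2 * int n"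
    using assms by (simp_all add: r_def dvd_mod_iff)
  then have r1: "1 \<le> r" "1 \<le> 2 * int n - r" by (presburger, presburger)
  have "real_of_int q = of_int r + 2 * real n * of_int (q div (2 * int n))"
    unfolding r_def by (metis (no_types, lifting) mod_mult_div_eq of_int_add of_int_mult of_int_numeral of_int_of_nat_eq)
  then have "of_int q * pi / real n = of_int r * pi / real n + of_int (q div (2 * int n)) * (2 * pi)"
    using assms by (simp add: field_simps)
  then have eq: "cos (of_int q * pi / real n) = cos (of_int r * pi / real n)"
    using cos.plus_of_int[of "of_int r * pi / real n" "q div (2 * int n)"] by (simp only: of_real_eq_id id_apply)
  show ?thesis
  proof (cases "r \<le> int n")
    case True
    have "cos (of_int r * pi / real n) \<le> cos (pi / real n)"
      using True r1 assms by (intro cos_monotone_0_pi_le) (auto simp: field_simps)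
    then show ?thesis using eq by simp
  next
    case False
    have "of_int (2 * int n - r) * pi / real n = 2 * pi - of_int r * pi / real n"
      using assms by (simp add: field_simps)
    then have "cos (of_int r * pi / real n) = cos (of_int (2 * int n - r) * pi / real n)" by simp
    also have "\<dots> \<le> cos (pi / real n)"
    proof (rule cos_monotone_0_pi_le)
      have "1 * pi \<le> of_int (2 * int n - r) * pi" using r1 by (intro mult_right_mono) auto
      then show "pi / real n \<le> of_int (2 * int n - r) * pi / real n"
        by (intro divide_right_mono) auto
      have "of_int (2 * int n - r) * pi \<le> real n * pi" using False by (intro mult_right_mono) auto
      then show "of_int (2 * int n - r) * pi / real n \<le> pi" using assms by (simp add: field_simps)
    qed simp
    finally show ?thesis using eq by simp
  qed
qed

section \<open>The regular polygon as an intersection of half-planes\<close>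

context
  fixes n :: nat
  assumes n: "3 \<le> n"
begin

lemma cos_pi_div_pos: "0 < cos (pi / real n)"
proof (rule cos_gt_zero_pi)
  have "pi * 2 < pi * real n" using n by (intro mult_strict_left_mono) auto
  then show "pi / real n < pi / 2" using n by (simp add: field_simps)
  have "0 \<le> pi / real n" by simp
  moreover have "- (pi / 2) < 0" by simp
  ultimately show "- (pi / 2) < pi / real n" by linarith
qed

definition vertex :: "nat \<Rightarrow> complex" where
  "vertex j = complex_of_real (1 / cos (pi / real n)) * cis (2 * pi * real j / real n)"

lemma polygon_vertices: "regular_polygon n = convex hull (vertex ` {..<n})"
  by (simp add: regular_polygon_def vertex_def[abs_def])

lemma vertex_mem: "j \<le> n \<Longrightarrow> vertex j \<in> regular_polygon n"
proof -
  assume j: "j \<le> n"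
  have mem: "vertex i \<in> regular_polygon n" if "i < n" for i
    unfolding polygon_vertices by (rule hull_inc) (use that in auto)
  show ?thesis
  proof (cases "j = n")
    case True
    then have "vertex j = vertex 0" using n by (simp add: vertex_def)
    then show ?thesis using mem[of 0] n by simp
  qed (use mem j in auto)
qed

lemma norm_vertex: "norm (vertex j) = 1 / cos (pi / real n)"
  using cos_pi_div_pos by (simp add: vertex_def norm_mult norm_divide)

lemma vertex_half: "vertex i \<bullet> edge_normal n j \<le> 1"
proof -
  let ?c = "cos (pi / real n)"
  have "vertex i \<bullet> edge_normal n j = (1 / ?c) * cos (2 * pi * real i / real n - (2 * of_int j + 1) * pi / real n)"
    unfolding vertex_def edge_normal_def
    by (simp add: inner_cis inner_complex_def cos_diff field_simps del: of_real_divide)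
      (simp add: algebra_simps add_divide_distrib)
  also have "2 * pi * real i / real n - (2 * of_int j + 1) * pi / real n = of_int (2 * (int i - j) - 1) * pi / real n"
    by (simp add: algebra_simps add_divide_distrib diff_divide_distrib)
  also have "(1 / ?c) * cos \<dots> \<le> (1 / ?c) * ?c"
    using cos_pi_div_pos n by (intro mult_left_mono cos_odd_multiple_le) auto
  also have "\<dots> = 1" using cos_pi_div_pos by simp
  finally show ?thesis .
qed

lemma polygon_half: "z \<in> regular_polygon n \<Longrightarrow> z \<bullet> edge_normal n j \<le> 1"
proof -
  assume z: "z \<in> regular_polygon n"
  have "regular_polygon n \<subseteq> {z. edge_normal n j \<bullet> z \<le> 1}"
    unfolding polygon_vertices
    by (intro hull_minimal convex_halfspace_le) (auto simp: vertex_half inner_commute[of "edge_normal n j"])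
  with z show ?thesis by (auto simp: inner_commute)
qed

lemma polygon_norm: "z \<in> regular_polygon n \<Longrightarrow> norm z \<le> 1 / cos (pi / real n)"
proof -
  assume z: "z \<in> regular_polygon n"
  have "regular_polygon n \<subseteq> cball 0 (1 / cos (pi / real n))"
    unfolding polygon_vertices
    by (rule hull_minimal) (auto simp: norm_vertex)
  with z show ?thesis by auto
qed

lemma zero_mem: "0 \<in> regular_polygon n"
proof -
  let ?w = "cis (2 * pi / real n)"
  have "sin (2 * pi / real n) > 0"
  proof (rule sin_gt_zero)
    have "pi * 2 < pi * real n" using n by (intro mult_strict_left_mono) auto
    then show "2 * pi / real n < pi" using n by (simp add: field_simps)
  qed (use n in auto)
  then have ne: "?w \<noteq> 1" by (auto simp: complex_eq_iff)
  have "?w ^ n = 1" unfolding Complex.DeMoivre using n by simp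
  then have "(\<Sum>i<n. ?w ^ i) = 0" using geometric_sum[OF ne, of n] by simp
  moreover have "vertex i = complex_of_real (1 / cos (pi / real n)) * ?w ^ i" for i
    by (simp add: vertex_def Complex.DeMoivre mult_ac)
  ultimately have s: "(\<Sum>i<n. vertex i) = 0" by (simp flip: sum_divide_distrib)
  have "convex (regular_polygon n)" by (simp add: polygon_vertices)
  then have "(\<Sum>i<n. (1 / real n) *\<^sub>R vertex i) \<in> regular_polygon n"
    by (intro convex_sum) (use n vertex_mem in simp_all)
  then show ?thesis using s by (simp flip: scaleR_sum_right)
qed

text \<open>A point \<open>z\<close> lies in the angular sector between two consecutive vertices.
  Its coordinates \<alpha> and \<beta> with respect to them add up to the inner product of
  \<open>z\<close> with the normal of that side, so the half-plane condition puts \<open>z\<close>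
  into the triangle with apex 0.\<close>

lemma polygon_eq: "regular_polygon n = {z. \<forall>j. z \<bullet> edge_normal n j \<le> 1}"
proof (intro equalityI subsetI)
  fix z assume "z \<in> {z. \<forall>j. z \<bullet> edge_normal n j \<le> 1}"
  then have h: "z \<bullet> edge_normal n j \<le> 1" for j by blast
  define \<kappa> r \<theta> where "\<kappa> = 2 * pi / real n" and "r = norm z" and "\<theta> = Arg2pi z"
  have z: "z = of_real r * cis \<theta>"
    unfolding r_def \<theta>_def by (metis Arg2pi_eq cis_conv_exp)
  have \<theta>: "0 \<le> \<theta>" "\<theta> < 2 * pi" unfolding \<theta>_def using Arg2pi_ge_0 Arg2pi_lt_2pi by auto
  have \<kappa>: "0 < \<kappa>" "\<kappa> < pi" "\<kappa> * real n = 2 * pi" "pi / real n = \<kappa> / 2"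
    using n by (auto simp: \<kappa>_def field_simps)
  define j where "j = nat \<lfloor>\<theta> / \<kappa>\<rfloor>"
  define \<phi> where "\<phi> = \<theta> - \<kappa> * real j"
  have j0: "real j \<le> \<theta> / \<kappa>" "\<theta> / \<kappa> < real j + 1"
    using \<theta> \<kappa> unfolding j_def by (simp_all add: of_nat_nat)
  then have \<phi>: "0 \<le> \<phi>" "\<phi> \<le> \<kappa>" using \<kappa> unfolding \<phi>_def by (auto simp: field_simps)
  have "\<kappa> * real j < \<kappa> * real n" using j0 \<theta> \<kappa> by (simp add: field_simps)
  then have "real j < real n" by (simp only: mult_less_cancel_left_pos[OF \<kappa>(1)])
  then have jn: "Suc j \<le> n" by simp
  have sk: "0 < sin \<kappa>" and s2: "0 < sin (\<kappa> / 2)" and c2: "0 < cos (\<kappa> / 2)"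
    using sin_gt_zero[of \<kappa>] sin_gt_zero[of "\<kappa> / 2"] \<kappa>(1,2) cos_pi_div_pos unfolding \<kappa>(4) by auto
  \<comment> \<open>The sine rule for splitting \<open>cis \<phi>\<close> along 1 and
    \<open>cis \<kappa>\<close>, rescaled because the vertices have norm
    \<open>1 / cos (\<kappa> / 2)\<close>.\<close>
  define \<alpha> \<beta> where "\<alpha> = r * cos (\<kappa> / 2) * sin (\<kappa> - \<phi>) / sin \<kappa>" and "\<beta> = r * cos (\<kappa> / 2) * sin \<phi> / sin \<kappa>"
  have pos: "0 \<le> \<alpha>" "0 \<le> \<beta>"
    using sk c2 \<phi> \<kappa> unfolding \<alpha>_def \<beta>_def r_def
    by (auto intro!: divide_nonneg_pos mult_nonneg_nonneg sin_ge_zero)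
  have v: "vertex j = of_real (1 / cos (\<kappa> / 2)) * cis (\<kappa> * real j)"
    "vertex (Suc j) = of_real (1 / cos (\<kappa> / 2)) * (cis (\<kappa> * real j) * cis \<kappa>)"
    unfolding vertex_def \<kappa>(4) cis_mult by (simp_all add: \<kappa>_def add_divide_distrib distrib_left mult_ac add_ac)
  have "z = of_real r * (cis (\<kappa> * real j) * cis \<phi>)" unfolding z cis_mult by (simp add: \<phi>_def)
  also have "cis \<phi> = of_real (sin (\<kappa> - \<phi>) / sin \<kappa>) + of_real (sin \<phi> / sin \<kappa>) * cis \<kappa>"
    using sk by (simp add: complex_eq_iff sin_diff field_simps)
  finally have zc: "z = \<alpha> *\<^sub>R vertex j + \<beta> *\<^sub>R vertex (Suc j)"
    using c2 unfolding v \<alpha>_def \<beta>_def scaleR_conv_of_real by (simp add: field_simps)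
  have "\<alpha> + \<beta> = r * (cos (\<kappa> / 2) * (sin (\<kappa> - \<phi>) + sin \<phi>) / sin \<kappa>)"
    by (simp add: \<alpha>_def \<beta>_def add_divide_distrib algebra_simps)
  also have "sin (\<kappa> - \<phi>) + sin \<phi> = 2 * sin (\<kappa> / 2) * cos (\<kappa> / 2 - \<phi>)"
    by (simp add: sin_plus_sin diff_divide_distrib)
  also have "sin \<kappa> = 2 * sin (\<kappa> / 2) * cos (\<kappa> / 2)" using sin_double[of "\<kappa> / 2"] by simp
  also have "r * (cos (\<kappa> / 2) * (2 * sin (\<kappa> / 2) * cos (\<kappa> / 2 - \<phi>)) / (2 * sin (\<kappa> / 2) * cos (\<kappa> / 2))) =
      r * cos (\<kappa> / 2 - \<phi>)" using s2 c2 by simp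
  also have "\<dots> = z \<bullet> edge_normal n (int j)"
  proof -
    have "(2 * of_int (int j) + 1) * pi / real n = \<kappa> * real j + \<kappa> / 2"
      using n by (simp add: \<kappa>_def field_simps)
    then have "z \<bullet> edge_normal n (int j) = r * cos (\<theta> - (\<kappa> * real j + \<kappa> / 2))"
      unfolding z edge_normal_def by (simp only: inner_cis flip: scaleR_conv_of_real) (simp add: inner_cis)
    also have "cos (\<theta> - (\<kappa> * real j + \<kappa> / 2)) = cos (\<kappa> / 2 - \<phi>)"
      by (subst cos_minus[symmetric]) (simp add: \<phi>_def algebra_simps)
    finally show ?thesis by simp
  qed
  finally have sum: "\<alpha> + \<beta> \<le> 1" using h by simp
  have "convex hull {vertex j, vertex (Suc j), 0} \<subseteq> regular_polygon n"
    using vertex_mem jn zero_mem by (intro hull_minimal) (auto simp: polygon_vertices)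
  moreover have "z \<in> convex hull {vertex j, vertex (Suc j), 0}"
    unfolding convex_hull_3 mem_Collect_eq
    by (rule exI[of _ \<alpha>], rule exI[of _ \<beta>], rule exI[of _ "1 - \<alpha> - \<beta>"]) (use pos sum zc in simp)
  ultimately show "z \<in> regular_polygon n" by blast
qed (use polygon_half in blast)

lemma polygon_circumscribed: "circumscribed (regular_polygon n) (range (edge_normal n))"
proof
  let ?K = "regular_polygon n"
  show cK: "compact ?K" "?K \<noteq> {}" "convex ?K"
    using zero_mem by (auto simp: polygon_vertices intro: finite_imp_compact_convex_hull)
  show "cball 0 1 \<subseteq> ?K"
  proof
    fix z :: complex assume "z \<in> cball 0 1"
    then have "z \<bullet> edge_normal n j \<le> 1" for j
      using norm_cauchy_schwarz[of z "edge_normal n j"] by simp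
    then show "z \<in> ?K" by (simp add: polygon_eq)
  qed
  fix x assume x: "x \<in> frontier ?K"
  show "\<exists>u\<in>range (edge_normal n). x \<bullet> u = 1"
  proof (rule ccontr)
    assume no: "\<not> ?thesis"
    have "x \<in> ?K" using x cK(1) by (meson compact_imp_closed frontier_subset_closed subsetD)
    then have lt: "x \<bullet> edge_normal n j < 1" for j
      using no polygon_half[of x j] by (metis order_le_less rangeI)
    \<comment> \<open>Openness needs a finite intersection; indices from 0 to \<open>n - 1\<close>
      already produce all the normals.\<close>
    define V where "V = (\<Inter>j\<in>{0..<int n}. {z. edge_normal n j \<bullet> z < 1})"
    have "open V" unfolding V_def by (intro open_INT ballI open_halfspace_lt) auto
    moreover have "V \<subseteq> ?K"
    proof
      fix z assume z: "z \<in> V"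
      have "z \<bullet> edge_normal n j \<le> 1" for j
      proof -
        have "j mod int n \<in> {0..<int n}" using n by simp
        then have "edge_normal n (j mod int n) \<bullet> z < 1" using z by (auto simp: V_def)
        then show ?thesis using n by (simp add: edge_normal_mod inner_commute)
      qed
      then show "z \<in> ?K" by (simp add: polygon_eq)
    qed
    moreover have "x \<in> V" using lt by (auto simp: V_def inner_commute)
    ultimately have "x \<in> interior ?K" by (meson interior_maximal subsetD)
    with x show False by (simp add: frontier_def)
  qed
qed (use polygon_half in auto)

end

lemma disk_circumscribed: "circumscribed (cball 0 1) (sphere 0 1)"
proof
  fix u x :: complex assume "u \<in> sphere 0 1" "x \<in> cball 0 1"
  then show "x \<bullet> u \<le> 1" using norm_cauchy_schwarz[of x u] by simp
next
  fix x :: complex assume "x \<in> frontier (cball 0 1)"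
  then have "norm x = 1" by simp
  then show "\<exists>u\<in>sphere 0 1. x \<bullet> u = 1" by (intro bexI[of _ x]) (auto simp: dot_square_norm)
qed auto

section \<open>Geodesics as local isometries\<close>

lemma mdist_Lipschitz_extend:
  fixes c :: "real \<Rightarrow> 'a"
  assumes l: "0 < l" and mem: "\<And>t. c t \<in> mspace M"
    and loc: "\<And>s t. s \<le> t \<Longrightarrow> t - s \<le> l \<Longrightarrow> mdist M (c s) (c t) \<le> t - s"
    and st: "s \<le> t"
  shows "mdist M (c s) (c t) \<le> t - s"
proof -
  have *: "s \<le> t \<Longrightarrow> t - s \<le> real n * l \<Longrightarrow> mdist M (c s) (c t) \<le> t - s" for n s
  proof (induction n arbitrary: s)
    case 0
    then show ?case using mdist_zero[OF mem mem, of s s] by simp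
  next
    case (Suc n)
    show ?case
    proof (cases "t - s \<le> l")
      case False
      have "mdist M (c s) (c (s + l)) \<le> l" using loc[of s "s + l"] l by simp
      moreover have "mdist M (c (s + l)) (c t) \<le> t - (s + l)"
        using False Suc.prems by (intro Suc.IH) (auto simp: algebra_simps)
      ultimately show ?thesis using mdist_triangle[OF mem mem mem, of s t "s + l"] by linarith
    qed (use Suc.prems loc in auto)
  qed
  obtain n where "(t - s) / l \<le> real n" using real_arch_simple by blast
  then show ?thesis using l st by (intro *[of s n]) (auto simp: field_simps)
qed

text \<open>The arc-length form of the notion. Subdividing into steps within one window shows that
  the speed is constant, and a window is minimizing because no curve is shorter than the distance of
  its ends.\<close>

lemma admits_one_over_geodesicI:
  fixes c :: "real \<Rightarrow> 'a"
  assumes k: "0 < k" and l: "0 < l" and mem: "\<And>t. c t \<in> mspace M"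
    and per: "\<And>t. c (t + real k * l) = c t"
    and iso: "\<And>s t. s \<le> t \<Longrightarrow> t - s \<le> l \<Longrightarrow> mdist M (c s) (c t) = t - s"
  shows "admits_one_over_geodesic k M"
proof -
  define v where "v = real k * l / (2 * pi)"
  define \<gamma> where "\<gamma> t = c (v * t)" for t
  have v: "0 < v" using k l by (simp add: v_def)
  have vpi: "v * (2 * pi) = real k * l" by (simp add: v_def)
  have \<gamma>iso: "mdist M (\<gamma> s) (\<gamma> t) = v * (t - s)" if "s \<le> t" "v * (t - s) \<le> l" for s t
    using iso[of "v * s" "v * t"] that v by (simp add: \<gamma>_def algebra_simps)
  have lip: "mdist M (\<gamma> s) (\<gamma> t) \<le> v * t - v * s" if "s \<le> t" for s t
    unfolding \<gamma>_def by (rule mdist_Lipschitz_extend[OF l mem]) (use that v iso in auto)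
  have cont: "continuous_map euclideanreal (mtopology_of M) \<gamma>"
  proof -
    have "mdist M (\<gamma> s) (\<gamma> t) \<le> v * dist s t" for s t
      using lip[of s t] lip[of t s] mdist_commute[of M "\<gamma> s" "\<gamma> t"]
      by (cases "s \<le> t") (auto simp: dist_real_def algebra_simps)
    then have "Lipschitz_continuous_map euclidean_metric M \<gamma>"
      unfolding Lipschitz_continuous_map_def using mem by (auto simp: \<gamma>_def intro!: exI[of _ v])
    then show ?thesis using Lipschitz_continuous_imp_continuous_map[of euclidean_metric M \<gamma>] by simp
  qed
  have len: "curve_length M \<gamma> a b = ennreal (v * (b - a))" if ab: "a \<le> b" for a b
  proof (rule antisym)
    show "curve_length M \<gamma> a b \<le> ennreal (v * (b - a))"
      using curve_length_le[OF ab, of M \<gamma> "\<lambda>t. v * t"] lip by (simp add: algebra_simps)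
    obtain n where n: "v * (b - a) / l < real n" using reals_Archimedean2 by blast
    have "0 \<le> v * (b - a) / l" using v ab l by simp
    then have n0: "0 < n" using n by (cases n) auto
    define h where "h = (b - a) / real n"
    have h: "0 \<le> h" "real n * h = b - a" "v * h \<le> l"
      using n n0 ab l v by (auto simp: h_def field_simps)
    define ts where "ts = map (\<lambda>i. a + real i * h) [0..<Suc n]"
    have "sorted ts" unfolding ts_def sorted_map
      by (rule sorted_wrt_mono_rel[OF _ sorted_upt]) (use h in \<open>auto intro: mult_right_mono\<close>)
    moreover have "set ts \<subseteq> {a..b}"
    proof -
      have "a \<le> a + real i * h \<and> a + real i * h \<le> b" if "i \<le> n" for i
      proof -
        have "real i * h \<le> real n * h" using that h by (intro mult_right_mono) auto
        then show ?thesis using h by auto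
      qed
      then show ?thesis by (auto simp: ts_def)
    qed
    moreover have "(\<Sum>i<length ts - 1. ennreal (mdist M (\<gamma> (ts ! i)) (\<gamma> (ts ! Suc i)))) = ennreal (v * (b - a))"
    proof -
      have "(\<Sum>i<length ts - 1. ennreal (mdist M (\<gamma> (ts ! i)) (\<gamma> (ts ! Suc i)))) = (\<Sum>i<n. ennreal (v * h))"
      proof (rule sum.cong)
        fix i assume i: "i \<in> {..<n}"
        then have "ts ! i = a + real i * h" "ts ! Suc i = a + real (Suc i) * h"
          by (simp_all add: ts_def nth_map_upt del: upt_Suc)
        then have "ts ! Suc i - ts ! i = h" by (simp add: algebra_simps)
        then show "ennreal (mdist M (\<gamma> (ts ! i)) (\<gamma> (ts ! Suc i))) = ennreal (v * h)"
          using \<gamma>iso[of "ts ! i" "ts ! Suc i"] h by simp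
      qed (simp add: ts_def)
      also have "\<dots> = ennreal (\<Sum>i<n. v * h)" using h v by (intro sum_ennreal) auto
      also have "(\<Sum>i<n. v * h) = v * (b - a)" using h(2) by (simp add: mult.left_commute)
      finally show ?thesis .
    qed
    ultimately show "ennreal (v * (b - a)) \<le> curve_length M \<gamma> a b"
      unfolding curve_length_def by (intro SUP_upper2[of ts]) auto
  qed
  have min: "\<exists>a b. a < t \<and> t < b \<and> length_minimizing_on M \<gamma> a b" for t
  proof (intro exI conjI)
    let ?a = "t - l / (2 * v)" and ?b = "t + l / (2 * v)"
    show "?a < t" "t < ?b" using l v by simp_all
    have vab: "v * (?b - ?a) = l" using v by (simp add: field_simps)
    show "length_minimizing_on M \<gamma> ?a ?b"
      unfolding length_minimizing_on_def
    proof (intro allI impI)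
      fix \<eta> assume \<eta>: "curve_on M \<eta> ?a ?b \<and> \<eta> ?a = \<gamma> ?a \<and> \<eta> ?b = \<gamma> ?b"
      have ab: "?a \<le> ?b" using \<open>?a < t\<close> \<open>t < ?b\<close> by simp
      have "curve_length M \<gamma> ?a ?b = ennreal (mdist M (\<eta> ?a) (\<eta> ?b))"
        using len[OF ab] \<gamma>iso[OF ab] vab \<eta> by simp
      also have "\<dots> \<le> curve_length M \<eta> ?a ?b" by (rule curve_length_ge[OF ab])
      finally show "curve_length M \<gamma> ?a ?b \<le> curve_length M \<eta> ?a ?b" .
    qed
  qed
  have "mdist M (\<gamma> 0) (\<gamma> (l / v)) = l" using \<gamma>iso[of 0 "l / v"] l v by simp
  then have "mdist M (\<gamma> 0) (\<gamma> (l / v)) \<noteq> 0" using l by simp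
  then have "\<gamma> 0 \<noteq> \<gamma> (l / v)" using mdist_zero[of "\<gamma> 0" M "\<gamma> (l / v)"] mem by (simp add: \<gamma>_def)
  moreover have "\<gamma> (t + 2 * pi) = \<gamma> t" for t
    unfolding \<gamma>_def distrib_left vpi by (rule per)
  moreover have "mdist M (\<gamma> t) (\<gamma> (t + 2 * pi / real k)) = enn2real (curve_length M \<gamma> 0 (2 * pi)) / real k" for t
  proof -
    have "v * (2 * pi / real k) = l" using k by (simp add: v_def)
    moreover have "mdist M (\<gamma> t) (\<gamma> (t + 2 * pi / real k)) = v * (t + 2 * pi / real k - t)"
      using calculation by (intro \<gamma>iso) auto
    moreover have "enn2real (curve_length M \<gamma> 0 (2 * pi)) = real k * l"
      using len[of 0 "2 * pi"] vpi k l by simp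
    ultimately show ?thesis using k by simp
  qed
  ultimately have "one_over_geodesic k M \<gamma>"
    unfolding one_over_geodesic_def closed_geodesic_def
    using cont len min v less_imp_le[OF v] by blast
  then show ?thesis unfolding admits_one_over_geodesic_def by blast
qed

text \<open>The definition controls only windows of length exactly \<open>L / k\<close>. As the
  curve is 1-Lipschitz in arc length, equality for such a window passes to all its parts by the
  triangle inequality.\<close>

lemma admits_one_over_geodesicD:
  assumes k: "0 < k" and "admits_one_over_geodesic k M"
  shows "\<exists>c l. 0 < l \<and> (\<forall>t. c t \<in> mspace M) \<and> (\<forall>t. c (t + real k * l) = c t) \<and>
    (\<forall>s t. s \<le> t \<and> t - s \<le> l \<longrightarrow> mdist M (c s) (c t) = t - s)"
proof -
  obtain \<gamma> where g: "closed_geodesic M \<gamma>"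
    and d: "\<And>t. mdist M (\<gamma> t) (\<gamma> (t + 2 * pi / real k)) = enn2real (curve_length M \<gamma> 0 (2 * pi)) / real k"
    using assms(2) by (auto simp: admits_one_over_geodesic_def one_over_geodesic_def)
  from g have cont: "continuous_map euclideanreal (mtopology_of M) \<gamma>"
    and per: "\<And>t. \<gamma> (t + 2 * pi) = \<gamma> t" and nc: "\<exists>s t. \<gamma> s \<noteq> \<gamma> t"
    and "\<exists>v\<ge>0. \<forall>a b. a \<le> b \<longrightarrow> curve_length M \<gamma> a b = ennreal (v * (b - a))"
    unfolding closed_geodesic_def by blast+
  then obtain v where v: "v \<ge> 0"
    and len: "\<And>a b. a \<le> b \<Longrightarrow> curve_length M \<gamma> a b = ennreal (v * (b - a))" by blast
  have mem: "\<gamma> t \<in> mspace M" for t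
    using continuous_map_image_subset_topspace[OF cont] by auto
  have lip: "mdist M (\<gamma> s) (\<gamma> t) \<le> v * (t - s)" if "s \<le> t" for s t
    using curve_length_ge[OF that, of M \<gamma>] len[OF that] v that by (simp add: ennreal_le_iff)
  have v0: "0 < v"
  proof (rule ccontr)
    assume "\<not> 0 < v"
    then have "v = 0" using v by simp
    have eq: "\<gamma> s = \<gamma> t" if "s \<le> t" for s t
    proof -
      have "mdist M (\<gamma> s) (\<gamma> t) = 0" using lip[OF that] \<open>v = 0\<close> mdist_nonneg[of M "\<gamma> s" "\<gamma> t"] by simp
      then show ?thesis using mdist_zero[of "\<gamma> s" M "\<gamma> t"] mem by simp
    qed
    have "\<gamma> s = \<gamma> t" for s t using eq[of s t] eq[of t s, symmetric] linear by blast
    with nc show False by blast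
  qed
  define c l where "c t = \<gamma> (t / v)" and "l = 2 * pi * v / real k" for t
  have lv: "l / v = 2 * pi / real k" "0 < l" using v0 k by (simp_all add: l_def)
  show ?thesis
  proof (intro exI conjI allI impI; (elim conjE)?)
    show "0 < l" by (fact lv)
    show "c t \<in> mspace M" for t by (simp add: c_def mem)
    have "(t + real k * l) / v = t / v + 2 * pi" for t using v0 k by (simp add: l_def add_divide_distrib)
    then show "c (t + real k * l) = c t" for t by (simp add: c_def per)
    have clip: "mdist M (c s) (c t) \<le> t - s" if "s \<le> t" for s t
    proof -
      have "v * (t / v - s / v) = t - s" using v0 by (simp add: right_diff_distrib)
      then show ?thesis using lip[of "s / v" "t / v"] that v0 by (simp add: c_def divide_right_mono)
    qed
    have cl: "mdist M (c s) (c (s + l)) = l" for s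
      using d[of "s / v"] len[of 0 "2 * pi"] v0 lv by (simp add: c_def add_divide_distrib l_def mult_ac)
    show "mdist M (c s) (c t) = t - s" if "s \<le> t" "t - s \<le> l" for s t
    proof -
      have "mdist M (c t) (c (s + l)) \<le> s + l - t" using that by (intro clip) simp
      moreover have "mdist M (c s) (c (s + l)) \<le> mdist M (c s) (c t) + mdist M (c t) (c (s + l))"
        by (rule mdist_triangle) (simp_all add: c_def mem)
      ultimately show ?thesis using cl[of s] clip[OF that(1)] by linarith
    qed
  qed
qed

section \<open>Points of a doubling: representatives and compactness\<close>

context compact_set
begin

lemma doubling_cases:
  assumes "A \<in> mspace (doubling K)"
  obtains z s where "z \<in> K" "A = boundary_rel K `` {(z, s)}"
proof -
  obtain x where "x \<in> two_sheets K" "A = boundary_rel K `` {x}"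
    using assms unfolding mspace_doubling by (meson quotientE)
  with that[of "fst x" "snd x"] show thesis by (auto simp: two_sheets_def)
qed

lemma doubling_memI: "z \<in> K \<Longrightarrow> boundary_rel K `` {(z, s)} \<in> mspace (doubling K)"
  unfolding mspace_doubling by (rule quotientI) (simp add: two_sheets_def)

lemma sheet_points_glued: "z \<in> frontier K \<Longrightarrow> boundary_rel K `` {(z, s)} = boundary_rel K `` {(z, t)}"
  using frontier_sub by (auto simp: boundary_rel_def)

lemma mdist_sheet_points:
  "z \<in> K \<Longrightarrow> w \<in> K \<Longrightarrow>
    mdist (doubling K) (boundary_rel K `` {(z, s)}) (boundary_rel K `` {(w, t)}) = cross_dist K (z, s) (w, t)"
  by (rule mdist_doubling) (simp_all add: two_sheets_def)

lemma double_geodesic_exists: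
  assumes "convex K" "0 < k" "admits_one_over_geodesic k (doubling K)"
  obtains z \<sigma> l where "double_geodesic K z \<sigma> l (real k * l)"
proof -
  obtain c l where l: "0 < l" and mem: "\<And>t. c t \<in> mspace (doubling K)"
    and per: "\<And>t. c (t + real k * l) = c t"
    and iso: "\<And>s t. s \<le> t \<Longrightarrow> t - s \<le> l \<Longrightarrow> mdist (doubling K) (c s) (c t) = t - s"
    using admits_one_over_geodesicD[OF assms(2,3)] by blast
  \<comment> \<open>A choice made for each point of the doubling and not for each parameter, so that
    the sheet is periodic along the curve.\<close>
  define rep where "rep A = (SOME x. fst x \<in> K \<and> A = boundary_rel K `` {x})" for A
  have rep: "fst (rep A) \<in> K" "A = boundary_rel K `` {rep A}" if A: "A \<in> mspace (doubling K)" for A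
  proof -
    have "\<exists>x. fst x \<in> K \<and> A = boundary_rel K `` {x}" using doubling_cases[OF A] by (metis fst_conv)
    then have "fst (rep A) \<in> K \<and> A = boundary_rel K `` {rep A}" unfolding rep_def by (rule someI_ex)
    then show "fst (rep A) \<in> K" "A = boundary_rel K `` {rep A}" by blast+
  qed
  have "double_geodesic K (\<lambda>t. fst (rep (c t))) (\<lambda>t. snd (rep (c t))) l (real k * l)"
  proof
    show "cross_dist K (fst (rep (c s)), snd (rep (c s))) (fst (rep (c t)), snd (rep (c t))) = t - s"
      if "s \<le> t" "t - s \<le> l" for s t
      using iso[OF that] rep[OF mem, of s] rep[OF mem, of t]
        mdist_sheet_points[of "fst (rep (c s))" "fst (rep (c t))" "snd (rep (c s))" "snd (rep (c t))"] by simp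
  qed (use assms l rep mem per in auto)
  with that show thesis by blast
qed

lemma compact_space_doubling: "compact_space (mtopology_of (doubling K))"
proof -
  let ?M = "doubling K" and ?f = "\<lambda>s z. boundary_rel K `` {(z, s)}"
  have c: "compactin (mtopology_of ?M) (?f s ` K)" for s
  proof -
    have "Lipschitz_continuous_map (submetric euclidean_metric K) ?M (?f s)"
      unfolding Lipschitz_continuous_map_def
      by (auto simp: doubling_memI mdist_sheet_points cross_dist_def intro!: exI[of _ 1])
    then have "continuous_map (mtopology_of (submetric euclidean_metric K)) (mtopology_of ?M) (?f s)"
      by (rule Lipschitz_continuous_imp_continuous_map)
    then have "continuous_map (top_of_set K) (mtopology_of ?M) (?f s)"
      by (simp add: mtopology_of_submetric)
    moreover have "compactin (top_of_set K) K" using compact by (simp add: compactin_subtopology)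
    ultimately show ?thesis by (rule image_compactin[rotated])
  qed
  have "mspace ?M = ?f Front ` K \<union> ?f Back ` K"
  proof (intro equalityI subsetI)
    fix A assume "A \<in> mspace ?M"
    then obtain z s where "z \<in> K" "A = ?f s z" by (rule doubling_cases)
    then show "A \<in> ?f Front ` K \<union> ?f Back ` K" by (cases s) auto
  qed (use doubling_memI in auto)
  then show ?thesis
    using compactin_Un[OF c c] by (simp add: compact_space_def)
qed

end

section \<open>Existence of geodesics\<close>

lemma norm_cis_diff: "norm (cis x - cis (- x)) = 2 * \<bar>sin x\<bar>"
  by (simp add: cmod_def real_sqrt_mult)

text \<open>The excess is \<open>4 (A - cos \<delta>)\<^sup>2\<close>, where \<open>A\<close> is the component along \<open>u\<close> of \<open>x\<close> rotated by \<open>\<delta>\<close>.\<close>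

lemma unfolded_dist_sq_rotation:
  assumes u: "norm u = 1"
  shows "(2 * sin \<delta>)\<^sup>2 \<le> unfolded_dist_sq u x (x * cis (2 * \<delta>))"
proof -
  define w where "w = x * cis \<delta> * cnj u"
  define A B s c where "A = Re w" and "B = Im w" and "s = sin \<delta>" and "c = cos \<delta>"
  have sc: "c\<^sup>2 = 1 - s\<^sup>2" by (simp add: s_def c_def cos_squared_eq)
  have "x * cnj u = w * cis (- \<delta>)" "x * cis (2 * \<delta>) * cnj u = w * cis \<delta>"
    by (simp_all add: w_def cis_mult mult_ac)
  then have i: "x \<bullet> u = A * c + B * s" "(x * cis (2 * \<delta>)) \<bullet> u = A * c - B * s"
    by (simp_all add: inner_complex_cnj A_def B_def s_def c_def)
  have "norm w = norm x" using u by (simp add: w_def norm_mult)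
  then have nx: "(norm x)\<^sup>2 = A\<^sup>2 + B\<^sup>2" by (simp add: A_def B_def flip: cmod_power2)
  have "dist x (x * cis (2 * \<delta>)) = norm x * norm (cis 0 - cis (2 * \<delta>))"
    by (simp add: dist_norm right_diff_distrib flip: norm_mult)
  also have "norm (cis 0 - cis (2 * \<delta>)) = norm (cis \<delta>) * norm (cis (- \<delta>) - cis \<delta>)"
    unfolding norm_mult[symmetric] by (simp add: right_diff_distrib cis_mult)
  also have "\<dots> = 2 * \<bar>s\<bar>" by (subst norm_minus_commute) (simp only: norm_mult norm_cis_diff norm_cis s_def mult_1)
  finally have D: "(dist x (x * cis (2 * \<delta>)))\<^sup>2 = 4 * s\<^sup>2 * (A\<^sup>2 + B\<^sup>2)"
    by (simp add: power_mult_distrib nx)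
  have "unfolded_dist_sq u x (x * cis (2 * \<delta>)) = 4 * s\<^sup>2 * (A\<^sup>2 + B\<^sup>2) + 4 * ((1 - A * c)\<^sup>2 - (B * s)\<^sup>2)"
    unfolding unfolded_dist_sq_def i D by (simp add: power2_eq_square algebra_simps)
  also have "\<dots> = 4 * s\<^sup>2 * A\<^sup>2 + 4 * (1 - 2 * A * c + A\<^sup>2 * c\<^sup>2)"
    by (simp add: power2_eq_square algebra_simps)
  also have "\<dots> = 4 * (A - c)\<^sup>2 + 4 * s\<^sup>2" unfolding sc power2_diff by (simp add: algebra_simps)
  finally show ?thesis by (simp add: s_def power_mult_distrib)
qed

text \<open>The curve follows equal chords between points of the unit circle, switching sheets at
  each of them. Advancing by one chord is a rotation by \<open>2 * \<delta>\<close> together with a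
  change of sheet, and crossing through any tangent line then costs at least the chord length
  \<open>2 * sin \<delta>\<close>. Evenness of \<open>N\<close> makes the sheets match when the
  curve closes.\<close>

lemma (in circumscribed) rotation_admits:
  fixes \<alpha> \<delta> :: real and N :: nat
  defines "m \<equiv> \<lambda>i :: int. cis (2 * of_int i * \<delta> + \<alpha>)"
  assumes N: "even N" "0 < N" and period: "cis (2 * real N * \<delta>) = 1" and \<delta>: "0 < sin \<delta>"
    and m: "\<And>i. m i \<in> frontier K"
  shows "admits_one_over_geodesic N (doubling K)"
proof -
  let ?M = "doubling K" and ?cl = "\<lambda>z s. boundary_rel K `` {(z, s)}"
  define l where "l = 2 * sin \<delta>"
  have l: "0 < l" using \<delta> by (simp add: l_def)
  define sh where "sh i = (if even i then Front else Back)" for i :: int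
  define w where "w i r = m i + r *\<^sub>R (m (i + 1) - m i)" for i r
  define C where "C r = ?cl (w \<lfloor>r\<rfloor> (r - of_int \<lfloor>r\<rfloor>)) (sh \<lfloor>r\<rfloor>)" for r :: real
  have mK: "m i \<in> K" for i using m frontier_sub by blast
  have rot: "m (i + 1) = m i * cis (2 * \<delta>)" for i
    by (simp add: m_def cis_mult algebra_simps)
  have wrot: "w (i + 1) r = w i r * cis (2 * \<delta>)" for i r
    unfolding w_def rot by (simp add: algebra_simps)
  have mper: "m (i + int N) = m i" for i
  proof -
    have "m (i + int N) = m i * cis (2 * real N * \<delta>)" by (simp add: m_def cis_mult algebra_simps)
    then show ?thesis using period by simp
  qed
  have wK: "w i r \<in> K" if "0 \<le> r" "r \<le> 1" for i r
  proof -
    have "w i r = (1 - r) *\<^sub>R m i + r *\<^sub>R m (i + 1)" by (simp add: w_def algebra_simps)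
    then show ?thesis using convexD_alt[OF convex mK mK that] by simp
  qed
  have CK: "C r \<in> mspace ?M" for r
    unfolding C_def by (intro doubling_memI wK) linarith+
  have Ci: "C r = ?cl (w i (r - of_int i)) (sh i)" if "of_int i \<le> r" "r \<le> of_int i + 1" for i r
  proof (cases "r = of_int i + 1")
    case True
    then have "\<lfloor>r\<rfloor> = i + 1" by simp
    then have "C r = ?cl (m (i + 1)) (sh (i + 1))" using True by (simp add: C_def w_def)
    also have "\<dots> = ?cl (m (i + 1)) (sh i)" by (rule sheet_points_glued[OF m])
    finally show ?thesis using True by (simp add: w_def)
  next
    case False
    then have "\<lfloor>r\<rfloor> = i" using that by linarith
    then show ?thesis by (simp add: C_def)
  qed
  have nm: "norm (m (i + 1) - m i) = l" for i
  proof -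
    have "m (i + 1) - m i = cis (2 * of_int i * \<delta> + \<alpha> + \<delta>) * (cis \<delta> - cis (- \<delta>))"
      by (simp add: m_def cis_mult right_diff_distrib algebra_simps)
    then show ?thesis using \<delta> by (simp only: norm_mult norm_cis_diff norm_cis l_def mult_1 abs_of_pos)
  qed
  have seg: "mdist ?M (C r) (C r') \<le> l * (r' - r)" if "of_int i \<le> r" "r \<le> r'" "r' \<le> of_int i + 1" for i r r'
  proof -
    have "mdist ?M (C r) (C r') = cross_dist K (w i (r - of_int i), sh i) (w i (r' - of_int i), sh i)"
      using that by (simp add: Ci[of i] mdist_sheet_points wK)
    also have "\<dots> = norm (w i (r' - of_int i) - w i (r - of_int i))"
      by (simp add: cross_dist_def dist_norm norm_minus_commute)
    also have "w i (r' - of_int i) - w i (r - of_int i) = (r' - r) *\<^sub>R (m (i + 1) - m i)"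
      by (simp add: w_def algebra_simps)
    finally show ?thesis using that nm[of i] by (simp add: mult.commute)
  qed
  have lip: "mdist ?M (C r) (C r') \<le> l * (r' - r)" if "r \<le> r'" "r' - r \<le> 1" for r r'
  proof (cases "r' \<le> of_int \<lfloor>r\<rfloor> + 1")
    case True
    then show ?thesis using that by (intro seg[of "\<lfloor>r\<rfloor>"]) linarith+
  next
    case False
    let ?k = "of_int \<lfloor>r\<rfloor> + 1 :: real"
    have "mdist ?M (C r) (C ?k) \<le> l * (?k - r)" by (intro seg[of "\<lfloor>r\<rfloor>"]) linarith+
    moreover have "mdist ?M (C ?k) (C r') \<le> l * (r' - ?k)"
      using False that by (intro seg[of "\<lfloor>r\<rfloor> + 1"]) (simp_all, linarith)
    ultimately show ?thesis using mdist_triangle[OF CK CK CK, of r r' ?k] by (simp add: algebra_simps)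
  qed
  \<comment> \<open>Windows of exactly one chord suffice for the lower bound; the Lipschitz estimate
    extends it to shorter ones.\<close>
  have far: "l \<le> mdist ?M (C r) (C (r + 1))" for r
  proof -
    let ?i = "\<lfloor>r\<rfloor>" and ?f = "r - of_int \<lfloor>r\<rfloor>"
    have f: "0 \<le> ?f" "?f \<le> 1" by linarith+
    have "C (r + 1) = ?cl (w ?i ?f * cis (2 * \<delta>)) (sh (?i + 1))"
      by (simp add: C_def flip: wrot)
    moreover have "w ?i ?f * cis (2 * \<delta>) \<in> K" using wK[OF f, of "?i + 1"] by (simp add: wrot)
    ultimately have eq: "mdist ?M (C r) (C (r + 1)) =
        cross_dist K (w ?i ?f, sh ?i) (w ?i ?f * cis (2 * \<delta>), sh (?i + 1))"
      using wK[OF f, of ?i] by (simp add: C_def mdist_sheet_points)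
    have "sh ?i \<noteq> sh (?i + 1)" by (simp add: sh_def)
    then obtain a where a: "a \<in> frontier K" "mdist ?M (C r) (C (r + 1)) =
        dist (w ?i ?f) a + dist a (w ?i ?f * cis (2 * \<delta>))"
      unfolding eq using cross_dist_cases[of "(w ?i ?f, sh ?i)" "(w ?i ?f * cis (2 * \<delta>), sh (?i + 1))"] by auto
    obtain u where u: "u \<in> U" "a \<bullet> u = 1" using touch[OF a(1)] by blast
    have "l = sqrt (l\<^sup>2)" using l by simp
    also have "\<dots> \<le> sqrt (unfolded_dist_sq u (w ?i ?f) (w ?i ?f * cis (2 * \<delta>)))"
      unfolding l_def by (intro real_sqrt_le_mono unfolded_dist_sq_rotation unit u)
    also have "\<dots> \<le> mdist ?M (C r) (C (r + 1))"
      unfolding a(2) by (rule path_via_line_ge[OF unit[OF u(1)] u(2)])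
    finally show ?thesis .
  qed
  have iso: "mdist ?M (C r) (C r') = l * (r' - r)" if "r \<le> r'" "r' - r \<le> 1" for r r'
  proof -
    have "mdist ?M (C r') (C (r + 1)) \<le> l * (r + 1 - r')" using that by (intro lip) auto
    then show ?thesis
      using far[of r] lip[OF that] mdist_triangle[OF CK CK CK, of r "r + 1" r'] by (simp add: algebra_simps)
  qed
  show ?thesis
  proof (rule admits_one_over_geodesicI[of N l "\<lambda>t. C (t / l)"])
    show "C ((t + real N * l) / l) = C (t / l)" for t
    proof -
      have fl: "\<lfloor>t / l + real N\<rfloor> = \<lfloor>t / l\<rfloor> + int N" by linarith
      have wper: "w (i + int N) r = w i r" for i r
        using mper[of i] mper[of "i + 1"] by (simp add: w_def algebra_simps)
      have "(t + real N * l) / l = t / l + real N" using l by (simp add: add_divide_distrib)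
      then show ?thesis using N by (simp add: C_def fl wper sh_def)
    qed
    show "mdist ?M (C (s / l)) (C (t / l)) = t - s" if "s \<le> t" "t - s \<le> l" for s t
    proof -
      have "s / l \<le> t / l" "t / l - s / l \<le> 1" using that l by (auto simp: divide_right_mono simp flip: diff_divide_distrib)
      from iso[OF this] show ?thesis using l by (simp add: right_diff_distrib)
    qed
  qed (use N l CK in auto)
qed

lemma doubled_polygon_admits:
  assumes "3 \<le> n"
  shows "admits_one_over_geodesic (2 * n) (doubled_polygon n)"
proof -
  interpret circumscribed "regular_polygon n" "range (edge_normal n)"
    by (rule polygon_circumscribed[OF assms])
  have m: "cis (2 * of_int i * (pi / real n) + pi / real n) = edge_normal n i" for i
    by (simp add: edge_normal_def add_divide_distrib algebra_simps)
  show ?thesis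
    unfolding doubled_polygon_def
  proof (rule rotation_admits[where \<delta> = "pi / real n" and \<alpha> = "pi / real n"])
    \<comment> \<open>The polygon of side midpoints is run through twice, which makes the number of
      chords even also for odd \<open>n\<close>.\<close>
    have "2 * real (2 * n) * (pi / real n) = 2 * pi * of_int 2" using assms by simp
    then show "cis (2 * real (2 * n) * (pi / real n)) = 1" using cis_multiple_2pi[of 2] by simp
    show "0 < sin (pi / real n)" using assms by (intro sin_gt_zero) (auto simp: field_simps)
    show "cis (2 * of_int i * (pi / real n) + pi / real n) \<in> frontier (regular_polygon n)" for i
      unfolding m using disk by (intro frontierI[of _ "edge_normal n i"]) (auto simp: dot_square_norm)
  qed (use assms in auto)
qed

lemma doubled_disk_admits: "admits_one_over_geodesic 2 doubled_disk"
proof -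
  interpret circumscribed "cball 0 1" "sphere 0 1" by (rule disk_circumscribed)
  show ?thesis
    unfolding doubled_disk_def
    \<comment> \<open>Two chords: the same diameter, once on each sheet.\<close>
    by (rule rotation_admits[where \<delta> = "pi / 2" and \<alpha> = 0]) (auto simp: cis_multiple_2pi)
qed

section \<open>Bounces in a regular polygon\<close>

lemma inner_rotate:
  fixes u x y :: complex
  assumes "norm u = 1"
  shows "(u * x) \<bullet> (u * y) = x \<bullet> y"
proof -
  have "u * cnj u = 1" using assms by (simp add: complex_norm_square[symmetric])
  then have "u * x * cnj (u * y) = x * cnj y"
    by (metis complex_cnj_mult mult.assoc mult.left_commute mult.right_neutral mult.commute)
  then show ?thesis by (simp only: inner_complex_cnj)
qed

lemma cis_eqE:
  assumes "cis x = cis y"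
  obtains n :: int where "x = y + 2 * pi * of_int n"
proof -
  have "sin x = sin y \<and> cos x = cos y" using assms by (auto simp: complex_eq_iff)
  then obtain n :: int where "x = y + 2 * pi * of_int n" unfolding sin_cos_eq_iff by blast
  then show thesis by (rule that)
qed

text \<open>At bounce \<open>i\<close>, \<open>\<eta> i\<close> is the angle between the incoming chord and the side, and \<open>b i\<close> is the signed offset
  of the bounce from the midpoint of the side; \<open>\<kappa>\<close> is the angle between adjacent sides. The equation between
  \<open>\<eta> i\<close> and \<open>\<eta> (Suc i)\<close> computes the distance from the center to the chord joining two
  consecutive bounces from both of its ends; the last two conditions say that crossing an adjacent side is no shortcut.\<close>

definition bounce_data ::
    "real \<Rightarrow> real \<Rightarrow> real \<Rightarrow> nat \<Rightarrow> (nat \<Rightarrow> real) \<Rightarrow> (nat \<Rightarrow> real) \<Rightarrow> (nat \<Rightarrow> int) \<Rightarrow> int \<Rightarrow> bool" where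
  "bounce_data \<kappa> l L m \<eta> b D w \<longleftrightarrow>
    0 < m \<and> even m \<and> real m * l \<le> L \<and> (\<forall>i. \<eta> (i + m) = \<eta> i \<and> b (i + m) = b i) \<and>
    (\<forall>i. 0 < \<eta> i \<and> \<eta> i < pi) \<and>
    (\<forall>i. cos (\<eta> i) + b i * sin (\<eta> i) = cos (\<eta> (Suc i)) - b (Suc i) * sin (\<eta> (Suc i))) \<and>
    (\<forall>i. \<eta> i + \<eta> (Suc i) = \<kappa> * of_int (D i)) \<and> (\<Sum>i<m. \<eta> i) = pi * of_int w \<and>
    L = 2 * (\<Sum>i<m. sin (\<eta> i)) \<and>
    (\<forall>i. 0 \<le> 1 - cos \<kappa> - b i * sin \<kappa> \<and> 0 \<le> 1 - cos \<kappa> + b i * sin \<kappa>) \<and>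
    (\<forall>i. l\<^sup>2 * (sin \<kappa>)\<^sup>2 \<le> 4 * (1 - cos \<kappa> - b i * sin \<kappa>)\<^sup>2 +
        4 * (1 - cos \<kappa> - b i * sin \<kappa>) * l * sin (\<eta> i) * cos \<kappa>) \<and>
    (\<forall>i. l\<^sup>2 * (sin \<kappa>)\<^sup>2 \<le> 4 * (1 - cos \<kappa> + b i * sin \<kappa>)\<^sup>2 +
        4 * (1 - cos \<kappa> + b i * sin \<kappa>) * l * sin (\<eta> i) * cos \<kappa>)"

text \<open>In the frame of the normal \<open>u i\<close>, the chords before and after bounce
  \<open>i\<close> are mirror images. Every chord is thereby described in the frames of both its
  ends, and comparing the two descriptions produces the equations.\<close>

lemma polygon_bounces:
  assumes n: "3 \<le> n" and "double_geodesic (regular_polygon n) z \<sigma> l L"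
  defines "\<kappa> \<equiv> 2 * pi / real n"
  shows "\<exists>m \<eta> b D w. bounce_data \<kappa> l L m \<eta> b D w"
proof -
  interpret G: double_geodesic "regular_polygon n" z \<sigma> l L by fact
  interpret C: circumscribed "regular_polygon n" "range (edge_normal n)"
    by (rule polygon_circumscribed[OF n])
  let ?K = "regular_polygon n" and ?N = "edge_normal n"
  obtain m where m: "0 < m" "even m" "real m * l \<le> L" and
    per: "\<And>i. G.bounce (i + m) = G.bounce i" "\<And>i. G.chord_dir (i + m) = G.chord_dir i"
      "\<And>i. G.chord_length (i + m) = G.chord_length i" and
    total: "(\<Sum>i<m. G.chord_length i) = L"
    using G.bounce_period by blast
  \<comment> \<open>Chosen from the point alone, so that the normals inherit the period of the
    bounces.\<close>
  define J where "J a = (SOME j. a \<bullet> ?N j = 1)" for a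
  define a where "a i = G.bounce (Suc i)" for i
  define u where "u i = ?N (J (a i))" for i
  define e where "e = G.chord_dir"
  define X where "X i = a i - (l / 2) *\<^sub>R e i" for i
  define Y where "Y i = a i + (l / 2) *\<^sub>R e (Suc i)" for i
  have ne: "norm (e i) = 1" and nu: "norm (u i) = 1" for i by (simp_all add: e_def u_def G.chord)
  have au: "a i \<bullet> u i = 1" for i
  proof -
    have "\<exists>j. a i \<bullet> ?N j = 1" using C.touch[OF G.bounce_frontier] by (auto simp: a_def)
    then show ?thesis unfolding u_def J_def by (rule someI_ex)
  qed
  have XY: "X i \<in> interior ?K" "Y i \<in> interior ?K" for i
  proof -
    have c: "l \<le> G.chord_length i" "l \<le> G.chord_length (Suc i)" "0 < l" by (simp_all add: G.chord_length_ge G.l)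
    have "X i = G.bounce i + (G.chord_length i - l / 2) *\<^sub>R G.chord_dir i"
      by (simp add: X_def a_def e_def G.bounce_Suc algebra_simps)
    then show "X i \<in> interior ?K" using c G.chord_interior[of "G.chord_length i - l / 2" i] by simp
    show "Y i \<in> interior ?K" unfolding Y_def a_def e_def using c by (intro G.chord_interior) auto
  qed
  have unf: "l\<^sup>2 \<le> unfolded_dist_sq v (X i) (Y i)" if v: "v \<in> range ?N" for v i
  proof -
    obtain w where w: "w \<in> frontier ?K" "dist (X i) w + dist w (Y i) \<le> sqrt (unfolded_dist_sq v (X i) (Y i))"
      using C.path_via_frontier[OF v] XY interior_subset by (metis subsetD)
    have "l / 2 + l / 2 \<le> dist (X i) w + dist w (Y i)"
      unfolding X_def Y_def a_def e_def using G.l w(1) by (intro G.crossing) auto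
    then have "l \<le> sqrt (unfolded_dist_sq v (X i) (Y i))" using w(2) by simp
    moreover from this have "0 < unfolded_dist_sq v (X i) (Y i)"
      using G.l by (metis less_le_trans real_sqrt_gt_0_iff)
    ultimately have "l\<^sup>2 \<le> (sqrt (unfolded_dist_sq v (X i) (Y i)))\<^sup>2"
      using G.l by (intro power_mono) auto
    with \<open>0 < unfolded_dist_sq v (X i) (Y i)\<close> show ?thesis by simp
  qed
  have eu: "0 < e i \<bullet> u i" for i
  proof -
    have "X i \<bullet> u i < 1" using C.interior_half[OF _ XY(1)] by (simp add: u_def)
    then have "0 < l / 2 * (e i \<bullet> u i)" by (simp add: X_def inner_diff_left au)
    then show ?thesis using G.l by (simp add: zero_less_mult_iff)
  qed
  \<comment> \<open>The imaginary part of this number is the inner product of \<open>e i\<close> and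
    \<open>u i\<close>, which is positive as the chord runs outwards; so the argument lies strictly
    between 0 and \<pi>.\<close>
  define \<eta> where "\<eta> i = Arg (\<i> * u i * cnj (e i))" for i
  have cis\<eta>: "cis (\<eta> i) = \<i> * u i * cnj (e i)" for i
  proof -
    have nz: "norm (\<i> * u i * cnj (e i)) = 1" by (simp add: norm_mult ne nu)
    then have "\<i> * u i * cnj (e i) \<noteq> 0" by (metis norm_zero zero_neq_one)
    then show ?thesis unfolding \<eta>_def using cis_Arg nz by (simp add: sgn_div_norm)
  qed
  have \<eta>: "0 < \<eta> i" "\<eta> i < pi" for i
  proof -
    have "Im (\<i> * u i * cnj (e i)) = e i \<bullet> u i" by (simp add: inner_complex_def)
    then show "0 < \<eta> i" "\<eta> i < pi" unfolding \<eta>_def using eu[of i] Arg_lt_pi by metis+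
  qed
  have e1: "e i = u i * Complex (sin (\<eta> i)) (cos (\<eta> i))" for i
  proof -
    have "u i * cnj (cis (\<eta> i)) * \<i> = u i * cnj (u i) * e i"
      unfolding cis\<eta> by (simp add: complex_eq_iff algebra_simps)
    also have "u i * cnj (u i) = 1" using nu[of i] by (simp add: complex_norm_square[symmetric])
    finally show ?thesis by (simp add: complex_eq_iff)
  qed
  have e2: "e (Suc i) = u i * Complex (- sin (\<eta> i)) (cos (\<eta> i))" for i
  proof -
    have "e (Suc i) = - (u i)\<^sup>2 * cnj (e i)"
      using unf[of "u i" i] au G.l unfolding X_def Y_def
      by (intro reflection_law[OF nu ne ne]) (auto simp: u_def)
    also have "\<dots> = (u i * cnj (u i)) * (u i * - cnj (Complex (sin (\<eta> i)) (cos (\<eta> i))))"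
      unfolding e1 by (simp add: power2_eq_square mult_ac)
    also have "u i * cnj (u i) = 1" using nu[of i] by (simp add: complex_norm_square[symmetric])
    also have "- cnj (Complex (sin (\<eta> i)) (cos (\<eta> i))) = Complex (- sin (\<eta> i)) (cos (\<eta> i))"
      by (simp add: complex_eq_iff)
    finally show ?thesis by simp
  qed
  define b where "b i = Im (a i * cnj (u i))" for i
  have ab: "a i = u i * Complex 1 (b i)" for i
  proof -
    have "a i * cnj (u i) = Complex 1 (b i)"
      using au[of i] unfolding inner_complex_cnj by (simp add: b_def complex_eq_iff)
    then have "u i * Complex 1 (b i) = a i * (u i * cnj (u i))" by (metis mult.left_commute)
    then show ?thesis using nu[of i] by (simp add: complex_norm_square[symmetric])
  qed
  have aS: "a (Suc i) = a i + G.chord_length (Suc i) *\<^sub>R e (Suc i)" for i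
    by (simp add: a_def e_def G.bounce_Suc[of "Suc i"])
  have bounce: "cos (\<eta> i) + b i * sin (\<eta> i) = cos (\<eta> (Suc i)) - b (Suc i) * sin (\<eta> (Suc i))" for i
  proof -
    \<comment> \<open>A unit normal of the chord; the inner product with it is the same at both ends
      of the chord.\<close>
    let ?n = "- \<i> * e (Suc i)"
    have "a (Suc i) \<bullet> ?n = a i \<bullet> ?n"
      unfolding aS by (simp add: inner_complex_def algebra_simps)
    moreover have "?n = u i * Complex (cos (\<eta> i)) (sin (\<eta> i))"
      unfolding e2 by (simp add: complex_eq_iff)
    then have "a i \<bullet> ?n = cos (\<eta> i) + b i * sin (\<eta> i)"
      by (simp only: ab inner_rotate[OF nu]) (simp add: inner_complex_def)
    moreover have "?n = u (Suc i) * Complex (cos (\<eta> (Suc i))) (- sin (\<eta> (Suc i)))"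
      unfolding e1[of "Suc i"] by (simp add: complex_eq_iff)
    then have "a (Suc i) \<bullet> ?n = cos (\<eta> (Suc i)) - b (Suc i) * sin (\<eta> (Suc i))"
      by (simp only: ab inner_rotate[OF nu]) (simp add: inner_complex_def)
    ultimately show ?thesis by simp
  qed
  have len: "G.chord_length (Suc i) =
      (sin (\<eta> (Suc i)) + b (Suc i) * cos (\<eta> (Suc i))) - (b i * cos (\<eta> i) - sin (\<eta> i))" for i
  proof -
    have "a (Suc i) \<bullet> e (Suc i) = a i \<bullet> e (Suc i) + G.chord_length (Suc i)"
      unfolding aS using ne[of "Suc i"] by (simp add: inner_add_left dot_square_norm)
    moreover have "a i \<bullet> e (Suc i) = b i * cos (\<eta> i) - sin (\<eta> i)"
      by (simp only: ab e2 inner_rotate[OF nu]) (simp add: inner_complex_def)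
    moreover have "a (Suc i) \<bullet> e (Suc i) = sin (\<eta> (Suc i)) + b (Suc i) * cos (\<eta> (Suc i))"
      by (simp only: ab e1[of "Suc i"] inner_rotate[OF nu]) (simp add: inner_complex_def)
    ultimately show ?thesis by simp
  qed
  have aper: "a (i + m) = a i" and eper: "e (i + m) = e i" for i
    using per(1)[of "Suc i"] per(2)[of i] by (simp_all add: a_def e_def)
  have uper: "u (i + m) = u i" for i by (simp add: u_def aper)
  have \<eta>per: "\<eta> (i + m) = \<eta> i" and bper: "b (i + m) = b i" for i
    by (simp_all add: \<eta>_def b_def aper eper uper)
  \<comment> \<open>The terms \<open>b i * cos (\<eta> i)\<close> from the two ends of consecutive
    chords cancel around the period.\<close>
  have L: "L = 2 * (\<Sum>i<m. sin (\<eta> i))"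
  proof -
    have "L = (\<Sum>i<m. G.chord_length (i + 1))" using total periodic_sum_shift[of G.chord_length m 1, OF per(3)] by simp
    also have "\<dots> = (\<Sum>i<m. sin (\<eta> (i + 1)) + b (i + 1) * cos (\<eta> (i + 1))) - (\<Sum>i<m. b i * cos (\<eta> i) - sin (\<eta> i))"
      by (simp add: len sum_subtractf)
    also have "(\<Sum>i<m. sin (\<eta> (i + 1)) + b (i + 1) * cos (\<eta> (i + 1))) = (\<Sum>i<m. sin (\<eta> i) + b i * cos (\<eta> i))"
      by (rule periodic_sum_shift[of "\<lambda>i. sin (\<eta> i) + b i * cos (\<eta> i)"]) (simp add: \<eta>per bper)
    finally show ?thesis by (simp add: sum.distrib sum_subtractf)
  qed
  \<comment> \<open>Reading the chord direction in both frames shows that the normals at its ends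
    differ by the angle \<open>\<eta> i + \<eta> (Suc i)\<close>. Angles between side normals are
    multiples of \<kappa>, and so is a full turn.\<close>
  have "\<exists>D :: int. \<eta> i + \<eta> (Suc i) = \<kappa> * of_int D" for i
  proof -
    have "u (Suc i) * Complex (sin (\<eta> (Suc i))) (cos (\<eta> (Suc i))) = u i * Complex (- sin (\<eta> i)) (cos (\<eta> i))"
      using e1[of "Suc i"] e2[of i] by simp
    moreover have "Complex (sin x) (cos x) = \<i> * cis (- x)" "Complex (- sin x) (cos x) = \<i> * cis x" for x
      by (simp_all add: complex_eq_iff)
    ultimately have "u (Suc i) * cis (- \<eta> (Suc i)) = u i * cis (\<eta> i)" by simp
    then have "u (Suc i) * cis (- \<eta> (Suc i)) * cis (\<eta> (Suc i)) = u i * (cis (\<eta> i) * cis (\<eta> (Suc i)))" by simp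
    then have "u (Suc i) = u i * cis (\<eta> i + \<eta> (Suc i))" by (simp add: cis_mult mult.assoc)
    moreover have "u (Suc i) = u i * cis (\<kappa> * of_int (J (a (Suc i)) - J (a i)))"
      using edge_normal_add[of n "J (a i)" "J (a (Suc i)) - J (a i)"] by (simp add: u_def \<kappa>_def mult_ac)
    moreover have "u i \<noteq> 0" using nu[of i] by auto
    ultimately have "cis (\<eta> i + \<eta> (Suc i)) = cis (\<kappa> * of_int (J (a (Suc i)) - J (a i)))" by simp
    then obtain k :: int where "\<eta> i + \<eta> (Suc i) = \<kappa> * of_int (J (a (Suc i)) - J (a i)) + 2 * pi * of_int k"
      by (rule cis_eqE)
    moreover have "2 * pi * of_int k = \<kappa> * of_int (int n * k)" using n by (simp add: \<kappa>_def)
    ultimately have "\<eta> i + \<eta> (Suc i) = \<kappa> * of_int (J (a (Suc i)) - J (a i) + int n * k)"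
      by (simp only: of_int_add distrib_left)
    then show ?thesis by blast
  qed
  then obtain D :: "nat \<Rightarrow> int" where D: "\<And>i. \<eta> i + \<eta> (Suc i) = \<kappa> * of_int (D i)" by metis
  \<comment> \<open>Bounce \<open>i\<close> turns the direction by \<open>2 * \<eta> i\<close>;
    after a period the direction is back, so the total turning is a multiple of
    \<open>2 * pi\<close>.\<close>
  have "e j = e 0 * cis (2 * (\<Sum>i<j. \<eta> i))" for j
  proof (induction j)
    case (Suc j)
    have "e (Suc j) = e j * cis (2 * \<eta> j)"
    proof -
      have "Complex (- sin (\<eta> j)) (cos (\<eta> j)) = \<i> * cis (\<eta> j)" by (simp add: complex_eq_iff)
      also have "\<dots> = \<i> * cis (- \<eta> j) * cis (2 * \<eta> j)" by (simp add: cis_mult mult.assoc)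
      also have "\<i> * cis (- \<eta> j) = Complex (sin (\<eta> j)) (cos (\<eta> j))" by (simp add: complex_eq_iff)
      finally show ?thesis unfolding e1[of j] e2 by simp
    qed
    then show ?case using Suc by (simp add: cis_mult distrib_left)
  qed simp
  from this[of m] have "e 0 * cis (2 * (\<Sum>i<m. \<eta> i)) = e 0 * 1" using eper[of 0] by simp
  moreover have "e 0 \<noteq> 0" using ne[of 0] by auto
  ultimately have "cis (2 * (\<Sum>i<m. \<eta> i)) = cis 0" by simp
  then obtain w :: int where w: "2 * (\<Sum>i<m. \<eta> i) = 0 + 2 * pi * of_int w" by (rule cis_eqE)
  have nb: "u i * cis (\<kappa> * of_int s) \<in> range ?N" for i and s :: int
    using rangeI[of ?N "J (a i) + s"] unfolding edge_normal_add by (simp add: u_def \<kappa>_def mult_ac)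
  have q0: "0 \<le> 1 - cos x - b i * sin x" if "u i * cis x \<in> range ?N" for i x
  proof -
    have "a i \<in> ?K" using G.bounce_frontier G.frontier_sub by (auto simp: a_def)
    from C.half[OF that this] show ?thesis
      by (simp only: ab inner_rotate[OF nu]) (simp add: inner_complex_def)
  qed
  have q: "l\<^sup>2 * (sin x)\<^sup>2 \<le> 4 * (1 - cos x - b i * sin x)\<^sup>2 +
      4 * (1 - cos x - b i * sin x) * l * sin (\<eta> i) * cos x" if "u i * cis x \<in> range ?N" for i x
    by (rule offset_inequality[OF nu ab e1 e2 refl unf[OF that, unfolded X_def Y_def]])
  have r: "u i * cis \<kappa> \<in> range ?N" "u i * cis (- \<kappa>) \<in> range ?N" for i
    using nb[of i 1] nb[of i "-1"] by simp_all
  show ?thesis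
    by (intro exI[of _ m] exI[of _ \<eta>] exI[of _ b] exI[of _ D] exI[of _ w], unfold bounce_data_def)
      (use m \<eta>per bper \<eta> bounce D w L q0[OF r(1)] q0[OF r(2)] q[OF r(1)] q[OF r(2)] in simp)
qed

text \<open>The length \<open>k * l\<close> is twice a sum of at least two sines, each at least
  \<open>S\<close>, so \<open>l\<close> is at least \<open>4 * S / k\<close>. This is the
  \<open>l0\<close> of the offset bound, and \<open>l0 / 32\<close> is the \<delta> of the rigidity
  argument; the remaining assumptions collect their smallness conditions on \<kappa>.\<close>

lemma no_polygon_geodesic:
  fixes p k :: nat
  defines "\<kappa> \<equiv> 2 * pi / real p" and "S \<equiv> sqrt (1 - ((1 + cos (pi / real k)) / 2)\<^sup>2)"
  assumes p: "prime p" "k < p" and k: "2 \<le> k"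
    and \<kappa>: "\<kappa> < 1" "\<kappa> / 2 \<le> sin \<kappa>" "\<kappa> * (1 - 4 * S / real k / 32) \<le> sin \<kappa>"
      "\<kappa>\<^sup>2 \<le> 4 * S / real k" "4 * real k * \<kappa> \<le> 1 - cos (pi / real k)"
      "8 * real k * \<kappa> < 4 * S / real k / 32 * S\<^sup>2" "24 * (real k)\<^sup>2 * \<kappa> < S\<^sup>2"
    and S: "0 < S"
  shows "\<not> admits_one_over_geodesic k (doubled_polygon p)"
proof
  assume adm: "admits_one_over_geodesic k (doubled_polygon p)"
  have p3: "3 \<le> p" using p k by simp
  have \<kappa>0: "0 < \<kappa>" using p3 by (simp add: \<kappa>_def)
  interpret C: circumscribed "regular_polygon p" "range (edge_normal p)"
    by (rule polygon_circumscribed[OF p3])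
  obtain z \<sigma> l where dg: "double_geodesic (regular_polygon p) z \<sigma> l (real k * l)"
    using C.double_geodesic_exists[OF C.convex _ adm[unfolded doubled_polygon_def]] k by auto
  have l: "0 < l" using dg unfolding double_geodesic_def double_geodesic_axioms_def by blast
  obtain m \<eta> b D w where data: "bounce_data \<kappa> l (real k * l) m \<eta> b D w"
    using polygon_bounces[OF p3 dg, folded \<kappa>_def] by blast
  from data have
    m: "0 < m" "even m" "real m * l \<le> real k * l"
    and per: "\<And>i. \<eta> (i + m) = \<eta> i" "\<And>i. b (i + m) = b i"
    and \<eta>: "\<And>i. 0 < \<eta> i" "\<And>i. \<eta> i < pi"
    and bounce: "\<And>i. cos (\<eta> i) + b i * sin (\<eta> i) = cos (\<eta> (Suc i)) - b (Suc i) * sin (\<eta> (Suc i))"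
    and D: "\<And>i. \<eta> i + \<eta> (Suc i) = \<kappa> * of_int (D i)"
    and w: "(\<Sum>i<m. \<eta> i) = pi * of_int w"
    and L: "real k * l = 2 * (\<Sum>i<m. sin (\<eta> i))"
    and q0: "\<And>i. 0 \<le> 1 - cos \<kappa> - b i * sin \<kappa>" "\<And>i. 0 \<le> 1 - cos \<kappa> + b i * sin \<kappa>"
    and q: "\<And>i. l\<^sup>2 * (sin \<kappa>)\<^sup>2 \<le> 4 * (1 - cos \<kappa> - b i * sin \<kappa>)\<^sup>2 +
        4 * (1 - cos \<kappa> - b i * sin \<kappa>) * l * sin (\<eta> i) * cos \<kappa>"
      "\<And>i. l\<^sup>2 * (sin \<kappa>)\<^sup>2 \<le> 4 * (1 - cos \<kappa> + b i * sin \<kappa>)\<^sup>2 +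
        4 * (1 - cos \<kappa> + b i * sin \<kappa>) * l * sin (\<eta> i) * cos \<kappa>"
    unfolding bounce_data_def by blast+
  have mk: "m \<le> k" using m(3) l by simp
  have m2: "2 \<le> m" using m(1,2) by presburger
  have sin\<kappa>: "0 < sin \<kappa>" using \<kappa>(2) \<kappa>0 by linarith
  have b\<kappa>: "\<bar>b i\<bar> \<le> \<kappa>" for i
  proof -
    have "1 - cos \<kappa> \<le> \<kappa> * sin \<kappa>"
    proof -
      have "1 - cos \<kappa> = 2 * (sin (\<kappa> / 2))\<^sup>2" using cos_double_sin[of "\<kappa> / 2"] by simp
      also have "\<dots> \<le> 2 * (\<kappa> / 2)\<^sup>2"
        using abs_sin_x_le_abs_x[of "\<kappa> / 2"] \<kappa>0 by (intro mult_left_mono) (auto simp: abs_le_square_iff[symmetric])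
      also have "\<dots> = \<kappa> * (\<kappa> / 2)" by (simp add: power2_eq_square)
      also have "\<dots> \<le> \<kappa> * sin \<kappa>" using \<kappa>(2) \<kappa>0 by (intro mult_left_mono) auto
      finally show ?thesis .
    qed
    then have "b i * sin \<kappa> \<le> \<kappa> * sin \<kappa>" "(- b i) * sin \<kappa> \<le> \<kappa> * sin \<kappa>" using q0[of i] by simp_all
    then have "b i \<le> \<kappa>" "- b i \<le> \<kappa>" using sin\<kappa> by (simp_all only: mult_le_cancel_right_pos)
    then show ?thesis by simp
  qed
  have near: "\<bar>cos (\<eta> i) - cos (\<eta> (Suc i))\<bar> \<le> 2 * \<kappa>" for i
  proof -
    have "\<bar>b j * sin x\<bar> \<le> \<kappa> * 1" for j x
      unfolding abs_mult using \<kappa>0 by (intro mult_mono b\<kappa>) auto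
    from this[of i "\<eta> i"] this[of "Suc i" "\<eta> (Suc i)"] show ?thesis using bounce[of i] by (simp add: abs_le_iff)
  qed
  have S\<eta>: "S \<le> sin (\<eta> i)" for i
    unfolding S_def by (rule sin_lower_bound[OF m(1) mk per(1) \<eta> w near \<kappa>(5)])
  have sin1: "0 \<le> sin (\<eta> i)" for i using S\<eta>[of i] S by linarith
  have l0: "4 * S / real k \<le> l"
  proof -
    have "real 2 * S \<le> real m * S" using m2 S by (intro mult_right_mono) auto
    also have "\<dots> \<le> (\<Sum>i<m. sin (\<eta> i))" using sum_bounded_below[of "{..<m}" S "\<lambda>i. sin (\<eta> i)"] S\<eta> by simp
    finally have "4 * S \<le> real k * l" using L by simp
    then show ?thesis using k by (simp add: field_simps)
  qed
  have bb: "\<bar>b i\<bar> \<le> \<kappa> * (1 / 2 - 4 * S / real k / 32)" for i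
  proof -
    have "b i \<le> \<kappa> * (1 / 2 - 4 * S / real k / 32)"
      by (rule offset_bound[OF \<kappa>0 \<kappa>(1) l0 \<kappa>(4) sin1 sin_le_one \<kappa>(2,3) q0 q(1)])
    moreover have "- b i \<le> \<kappa> * (1 / 2 - 4 * S / real k / 32)"
      by (rule offset_bound[OF \<kappa>0 \<kappa>(1) l0 \<kappa>(4) sin1[of i] sin_le_one \<kappa>(2,3)]) (use q0 q(2)[of i] in simp_all)
    ultimately show ?thesis by simp
  qed
  have small: "8 * real m * \<kappa> < 4 * S / real k / 32 * S\<^sup>2" "24 * (real m)\<^sup>2 * \<kappa> < S\<^sup>2"
  proof -
    have "8 * real m * \<kappa> \<le> 8 * real k * \<kappa>" "24 * (real m)\<^sup>2 * \<kappa> \<le> 24 * (real k)\<^sup>2 * \<kappa>"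
      using mk \<kappa>0 by (intro mult_right_mono mult_left_mono power_mono; simp)+
    then show "8 * real m * \<kappa> < 4 * S / real k / 32 * S\<^sup>2" "24 * (real m)\<^sup>2 * \<kappa> < S\<^sup>2"
      using \<kappa>(6,7) by linarith+
  qed
  obtain W :: int where "2 * (\<Sum>i<m. \<eta> i) = \<kappa> * real m * of_int W"
    using bounce_rigidity[OF m(2,1) per \<eta> S S\<eta> bounce D \<kappa>0 bb small] by blast
  then have "of_int w * real p = real m * of_int W"
    unfolding w using p3 by (simp add: \<kappa>_def field_simps)
  then have "of_int (w * int p) = (of_int (int m * W) :: real)" by simp
  then have "w * int p = int m * W" by (simp only: of_int_eq_iff)
  then have dv: "int m dvd w * int p" by simp
  have "coprime p m"
    using p mk m(1) by (intro prime_imp_coprime) (auto dest: dvd_imp_le)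
  then have "coprime (int m) (int p)" by (simp add: coprime_commute)
  then have "int m dvd w" using dv by (simp add: coprime_dvd_mult_left_iff)
  moreover have "0 < w"
  proof -
    have "0 < (\<Sum>i<m. \<eta> i)" using m \<eta> by (intro sum_pos) auto
    then show ?thesis unfolding w by (simp add: zero_less_mult_iff)
  qed
  moreover have "w < int m"
  proof -
    have "(\<Sum>i<m. \<eta> i) < (\<Sum>i<m. pi)" using m \<eta> by (intro sum_strict_mono) auto
    then have "pi * of_int w < pi * real m" unfolding w by (simp add: mult.commute)
    then show ?thesis by (simp add: mult_less_cancel_left_pos)
  qed
  ultimately show False using zdvd_not_zless by blast
qed

text \<open>The thresholds depend on \<open>k\<close> only, so it is enough that each condition
  holds for all small positive \<kappa>.\<close>

lemma eventually_no_polygon_geodesic: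
  assumes k: "2 \<le> k"
  shows "\<forall>\<^sub>F p in sequentially. prime p \<longrightarrow> \<not> admits_one_over_geodesic k (doubled_polygon p)"
proof -
  define S where "S = sqrt (1 - ((1 + cos (pi / real k)) / 2)\<^sup>2)"
  define c where "c = cos (pi / real k)"
  have "cos (pi / real k) < cos 0" using k by (intro cos_monotone_0_pi) (auto simp: field_simps)
  moreover have "0 \<le> cos (pi / real k)" using k by (intro cos_ge_zero) (auto simp: field_simps intro: order_trans[of _ 0])
  ultimately have c: "0 \<le> c" "c < 1" by (simp_all add: c_def)
  then have "((1 + c) / 2)\<^sup>2 < 1\<^sup>2" by (intro power_strict_mono) auto
  then have S: "0 < S" unfolding S_def c_def by simp
  have lim: "((\<lambda>x::real. sin x / x) \<longlongrightarrow> 1) (at_right 0)"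
  proof -
    have "((\<lambda>x::real. sin x / x) \<longlongrightarrow> 1) (at 0)"
      using DERIV_sin[of "0 :: real"] by (simp add: DERIV_def)
    then show ?thesis by (rule filterlim_mono) (auto simp: at_le)
  qed
  have pos: "\<forall>\<^sub>F x in at_right (0::real). 0 < x" by (simp add: eventually_at_right_less)
  have sin: "\<forall>\<^sub>F x in at_right (0::real). x * t \<le> sin x" if "t < 1" for t
    using order_tendstoD(1)[OF lim that] pos by eventually_elim (simp add: field_simps)
  have lin: "\<forall>\<^sub>F x in at_right (0::real). x * s < t" if "0 < t" for s t :: real
  proof -
    have "((\<lambda>x. x * s) \<longlongrightarrow> 0 * s) (at_right 0)" by (intro tendsto_intros)
    then show ?thesis using order_tendstoD(2)[of "\<lambda>x. x * s" 0] that by simp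
  qed
  have sq: "\<forall>\<^sub>F x in at_right (0::real). x\<^sup>2 < t" if "0 < t" for t :: real
  proof -
    have "((\<lambda>x. x\<^sup>2) \<longlongrightarrow> 0\<^sup>2) (at_right (0::real))" by (intro tendsto_intros)
    then show ?thesis using order_tendstoD(2)[of "\<lambda>x::real. x\<^sup>2" 0] that by simp
  qed
  have lim\<kappa>: "filterlim (\<lambda>p. 2 * pi / real p) (at_right 0) sequentially"
    by (rule tendsto_imp_filterlim_at_right)
      (auto intro!: tendsto_divide_0[OF tendsto_const] filterlim_at_top_imp_at_infinity filterlim_real_sequentially
        eventually_mono[OF eventually_gt_at_top[of 0]])
  have ev: "\<forall>\<^sub>F x in at_right (0::real). x < 1 \<and> x / 2 \<le> sin x \<and> x * (1 - 4 * S / real k / 32) \<le> sin x \<and>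
      x\<^sup>2 \<le> 4 * S / real k \<and> 4 * real k * x \<le> 1 - cos (pi / real k) \<and>
      8 * real k * x < 4 * S / real k / 32 * S\<^sup>2 \<and> 24 * (real k)\<^sup>2 * x < S\<^sup>2"
  proof -
    have "1 - 4 * S / real k / 32 < 1" "0 < 4 * S / real k" "0 < 1 - cos (pi / real k)"
      "0 < 4 * S / real k / 32 * S\<^sup>2" "0 < S\<^sup>2"
      using S k c by (auto simp: c_def)
    note * = lin[of 1 1] sin[of "1 / 2"] sin[OF this(1)] sq[OF this(2)] lin[OF this(3), of "4 * real k"]
      lin[OF this(4), of "8 * real k"] lin[OF this(5), of "24 * (real k)\<^sup>2"]
    show ?thesis using *[simplified] by eventually_elim (auto simp: mult_ac)
  qed
  have "\<forall>\<^sub>F p in sequentially. k < p" by (rule eventually_gt_at_top)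
  with lim\<kappa>[unfolded filterlim_iff, rule_format, OF ev] show ?thesis
  proof eventually_elim
    case (elim p)
    then show ?case using no_polygon_geodesic[of p k] k S unfolding S_def by blast
  qed
qed

section \<open>Gromov-Hausdorff convergence\<close>

text \<open>The spaces are joined by bridges of length \<open>r\<close> from every \<open>x\<close>
  to \<open>f x\<close>. A detour over two bridges costs \<open>2 * r\<close>, exactly the amount by
  which \<open>f\<close> may shrink distances; positivity of \<open>r\<close> keeps the two copies
  disjoint.\<close>

lemma gromov_hausdorff_dist_le:
  fixes M :: "'a metric" and N :: "'b metric"
  assumes r: "0 < r" and f: "f ` mspace M = mspace N"
    and le: "\<And>x y. x \<in> mspace M \<Longrightarrow> y \<in> mspace M \<Longrightarrow> mdist N (f x) (f y) \<le> mdist M x y"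
    and ge: "\<And>x y. x \<in> mspace M \<Longrightarrow> y \<in> mspace M \<Longrightarrow> mdist M x y \<le> mdist N (f x) (f y) + 2 * r"
  shows "gromov_hausdorff_dist M N \<le> ennreal r"
proof -
  define d where "d a b = (case (a, b) of (Inl x, Inl y) \<Rightarrow> mdist M x y | (Inr x, Inr y) \<Rightarrow> mdist N x y
      | (Inl x, Inr y) \<Rightarrow> r + mdist N (f x) y | (Inr y, Inl x) \<Rightarrow> r + mdist N (f x) y)" for a b :: "'a + 'b"
  have d: "d (Inl x) (Inl x') = mdist M x x'" "d (Inr y) (Inr y') = mdist N y y'"
    "d (Inl x) (Inr y) = r + mdist N (f x) y" "d (Inr y) (Inl x) = r + mdist N (f x) y" for x x' y y'
    by (simp_all add: d_def)
  let ?S = "Inl ` mspace M \<union> Inr ` mspace N"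
  have fN: "f x \<in> mspace N" if "x \<in> mspace M" for x using f that by blast
  have "Metric_space ?S d"
  proof
    show "0 \<le> d a b" for a b using r by (cases a; cases b) (simp_all add: d)
    show "d a b = d b a" for a b by (cases a; cases b) (simp_all add: d mdist_commute)
    show "d a b = 0 \<longleftrightarrow> a = b" if "a \<in> ?S" "b \<in> ?S" for a b
      using that r mdist_nonneg[of N] by (auto simp: d) (smt (verit) mdist_nonneg)+
    show "d a c \<le> d a b + d b c" if "a \<in> ?S" "b \<in> ?S" "c \<in> ?S" for a b c
    proof -
      have N: "mdist N x z \<le> mdist N x y + mdist N y z" if "x \<in> mspace N" "y \<in> mspace N" "z \<in> mspace N" for x y z
        using that by (rule mdist_triangle)
      have M: "mdist M x z \<le> mdist M x y + mdist M y z" if "x \<in> mspace M" "y \<in> mspace M" "z \<in> mspace M" for x y z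
        using that by (rule mdist_triangle)
      have MMN: "r + mdist N (f x) y \<le> mdist M x x' + (r + mdist N (f x') y)"
        and NMM: "r + mdist N (f x') y \<le> (r + mdist N (f x) y) + mdist M x x'"
        and MNM: "mdist M x x' \<le> (r + mdist N (f x) y) + (r + mdist N (f x') y)"
        if m: "x \<in> mspace M" "x' \<in> mspace M" "y \<in> mspace N" for x x' y
        using le[OF m(1,2)] ge[OF m(1,2)] N[OF fN[OF m(1)] fN[OF m(2)] m(3)] N[OF fN[OF m(2)] fN[OF m(1)] m(3)]
          N[OF fN[OF m(1)] m(3) fN[OF m(2)]] mdist_commute[of N y "f x'"] mdist_commute[of N "f x" "f x'"]
        by linarith+
      have MNN: "r + mdist N (f x) y' \<le> (r + mdist N (f x) y) + mdist N y y'"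
        and NNM: "r + mdist N (f x) y \<le> mdist N y y' + (r + mdist N (f x) y')"
        and NMN: "mdist N y y' \<le> (r + mdist N (f x) y) + (r + mdist N (f x) y')"
        if m: "x \<in> mspace M" "y \<in> mspace N" "y' \<in> mspace N" for x y y'
        using N[OF fN[OF m(1)] m(2,3)] N[OF fN[OF m(1)] m(3,2)] N[OF m(2) fN[OF m(1)] m(3)] r
          mdist_commute[of N y y'] mdist_commute[of N y "f x"]
        by linarith+
      from that show ?thesis
        by (elim UnE imageE) (simp_all only: d M N MMN NMM MNM MNN NNM NMN)
    qed
  qed
  note Z = Metric_space.mspace_metric[OF this] Metric_space.mdist_metric[OF this]
  let ?Z = "metric (?S, d)"
  have near: "d (Inl x) (Inr (f x)) = r" if "x \<in> mspace M" for x using fN[OF that] by (simp add: d)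
  have "(SUP a\<in>Inl ` mspace M. INF b\<in>Inr ` mspace N. ennreal (mdist ?Z a b)) \<le> ennreal r"
  proof (rule SUP_least)
    fix a assume "a \<in> (Inl ` mspace M :: ('a + 'b) set)"
    then obtain x where x: "x \<in> mspace M" "a = Inl x" by blast
    show "(INF b\<in>Inr ` mspace N. ennreal (mdist ?Z a b)) \<le> ennreal r"
      by (rule INF_lower2[of "Inr (f x)"]) (use x near fN Z in auto)
  qed
  moreover have "(SUP b\<in>Inr ` mspace N. INF a\<in>Inl ` mspace M. ennreal (mdist ?Z a b)) \<le> ennreal r"
  proof (rule SUP_least)
    fix b assume "b \<in> (Inr ` mspace N :: ('a + 'b) set)"
    then obtain x where x: "x \<in> mspace M" "b = Inr (f x)" using f by blast
    show "(INF a\<in>Inl ` mspace M. ennreal (mdist ?Z a b)) \<le> ennreal r"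
      by (rule INF_lower2[of "Inl x"]) (use x near Z in auto)
  qed
  ultimately have "hausdorff_dist ?Z (Inl ` mspace M) (Inr ` mspace N) \<le> ennreal r"
    unfolding hausdorff_dist_def by simp
  moreover have "isometric_embedding M ?Z Inl" "isometric_embedding N ?Z Inr"
    unfolding isometric_embedding_def by (auto simp: Z d)
  then have "gromov_hausdorff_dist M N \<le> hausdorff_dist ?Z (Inl ` mspace M) (Inr ` mspace N)"
    unfolding gromov_hausdorff_dist_def by (intro Inf_lower) blast
  ultimately show ?thesis by (rule order_trans[rotated])
qed

text \<open>The comparison map is the nearest-point projection \<open>g\<close> onto the disk on
  each sheet. Frontier points of \<open>K\<close> have norm at least 1, so \<open>g\<close> sends
  them to the circle; being 1-Lipschitz, it maps crossings to crossings that are no longer.\<close>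

lemma (in circumscribed) gromov_hausdorff_dist_doubled_disk:
  assumes e: "0 < e" and K: "K \<subseteq> cball 0 (1 + e)"
  shows "gromov_hausdorff_dist (doubling K) doubled_disk \<le> ennreal (2 * e)"
proof -
  let ?D = "cball 0 1 :: complex set"
  interpret D: circumscribed ?D "sphere 0 1" by (rule disk_circumscribed)
  define g where "g = closest_point ?D"
  have gD: "g z \<in> ?D" for z unfolding g_def by (rule closest_point_in_set) auto
  have gid: "g z = z" if "z \<in> ?D" for z unfolding g_def using that by (rule closest_point_self)
  have glip: "dist (g z) (g w) \<le> dist z w" for z w
    unfolding g_def by (rule closest_point_lipschitz) auto
  have radial: "dist z ((1 / norm z) *\<^sub>R z) = norm z - 1" if "1 \<le> norm z" for z :: complex
  proof -
    have "dist z ((1 / norm z) *\<^sub>R z) = norm ((1 - 1 / norm z) *\<^sub>R z)"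
      by (simp add: dist_norm algebra_simps)
    also have "\<dots> = (1 - 1 / norm z) * norm z" unfolding norm_scaleR using that by (simp add: divide_le_eq_1)
    also have "\<dots> = norm z - 1" using that by (cases "z = 0") (auto simp: left_diff_distrib)
    finally show ?thesis .
  qed
  have gF: "g z \<in> frontier ?D" if zF: "z \<in> frontier K" for z
  proof -
    obtain u where u: "u \<in> U" "z \<bullet> u = 1" using touch[OF zF] by blast
    then have "1 \<le> norm z"
      using norm_cauchy_schwarz[of z u] unit[OF u(1)] u(2) by simp
    have "dist z (g z) \<le> dist z ((1 / norm z) *\<^sub>R z)"
      unfolding g_def using \<open>1 \<le> norm z\<close> by (intro closest_point_le) auto
    also have "\<dots> = norm z - 1" using \<open>1 \<le> norm z\<close> by (rule radial)
    finally have "1 \<le> norm (g z)" using norm_triangle_ineq2[of z "g z"] by (simp add: dist_norm)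
    then show ?thesis using gD[of z] by simp
  qed
  have gdist: "dist z (g z) \<le> e" if z: "z \<in> K" for z
  proof (cases "norm z \<le> 1")
    case True
    then show ?thesis using gid[of z] e by simp
  next
    case False
    have "dist z (g z) \<le> dist z ((1 / norm z) *\<^sub>R z)"
      unfolding g_def using False by (intro closest_point_le) auto
    also have "\<dots> = norm z - 1" using False by (intro radial) simp
    finally show ?thesis using K z by auto
  qed
  have outer: "\<exists>b\<in>frontier K. dist a b \<le> e" if a: "a \<in> frontier ?D" for a
  proof -
    have na: "norm a = 1" using a by simp
    have "closed_segment a ((2 + e) *\<^sub>R a) \<inter> frontier K \<noteq> {}"
    proof (intro connected_Int_frontier connected_segment)
      show "closed_segment a ((2 + e) *\<^sub>R a) \<inter> K \<noteq> {}" using disk na by force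
      have "(2 + e) *\<^sub>R a \<notin> K" using K na e by auto
      then show "closed_segment a ((2 + e) *\<^sub>R a) - K \<noteq> {}" by blast
    qed
    then obtain b where b: "b \<in> closed_segment a ((2 + e) *\<^sub>R a)" "b \<in> frontier K" by blast
    then obtain t where t: "0 \<le> t" "b = (1 - t) *\<^sub>R a + t *\<^sub>R (2 + e) *\<^sub>R a" by (auto simp: in_segment)
    have bc: "b = a + (t * (1 + e)) *\<^sub>R a" unfolding t(2) by (simp add: complex_eq_iff algebra_simps)
    then have "b = (1 + t * (1 + e)) *\<^sub>R a" by (simp add: algebra_simps)
    then have "norm b = 1 + t * (1 + e)" using t(1) e na by simp
    moreover have "norm b \<le> 1 + e" using K b(2) frontier_sub by auto
    moreover have "dist a b = t * (1 + e)" using t(1) e na by (simp add: bc dist_norm)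
    ultimately show ?thesis using b(2) by (intro bexI[of _ b]) auto
  qed
  have less: "cross_dist ?D (g z, s) (g w, t) \<le> cross_dist K (z, s) (w, t)" for z w s t
  proof (cases "s = t")
    case False
    then obtain a where a: "a \<in> frontier K" "cross_dist K (z, s) (w, t) = dist z a + dist a w"
      using cross_dist_cases[of "(z, s)" "(w, t)"] by auto
    show ?thesis
      using D.cross_dist_le[OF gF[OF a(1)], of "(g z, s)" "(g w, t)"] glip[of z a] glip[of a w] a(2) by simp
  qed (simp add: cross_dist_def glip)
  \<comment> \<open>A crossing at \<open>a\<close> is replaced by one at a frontier point
    \<open>b\<close> within \<open>e\<close> of it. Each endpoint moves by at most \<open>e\<close>,
    and the detour from \<open>a\<close> to \<open>b\<close> is paid twice, so \<open>4 * e\<close>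
    suffices.\<close>
  have more: "cross_dist K (z, s) (w, t) \<le> cross_dist ?D (g z, s) (g w, t) + 2 * (2 * e)"
    if "z \<in> K" "w \<in> K" for z w s t
  proof (cases "s = t")
    case True
    have "dist z w \<le> dist z (g z) + dist (g z) (g w) + dist w (g w)"
      using dist_triangle[of z w "g z"] dist_triangle[of "g z" w "g w"] dist_commute[of w "g w"] by linarith
    then show ?thesis using True gdist[OF that(1)] gdist[OF that(2)] e by (simp add: cross_dist_def)
  next
    case False
    then obtain a where a: "a \<in> frontier ?D"
      "cross_dist ?D (g z, s) (g w, t) = dist (g z) a + dist a (g w)"
      using D.cross_dist_cases[of "(g z, s)" "(g w, t)"] by auto
    obtain b where b: "b \<in> frontier K" "dist a b \<le> e" using outer[OF a(1)] by blast
    have "dist z b \<le> dist z (g z) + dist (g z) a + dist a b"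
      using dist_triangle[of z b "g z"] dist_triangle[of "g z" b a] by linarith
    moreover have "dist b w \<le> dist a b + dist a (g w) + dist w (g w)"
      using dist_triangle[of b w a] dist_triangle[of a w "g w"] dist_commute[of b a] dist_commute[of w "g w"] by linarith
    ultimately show ?thesis
      using cross_dist_le[OF b(1), of "(z, s)" "(w, t)"] a(2) b(2) gdist[OF that(1)] gdist[OF that(2)] by simp
  qed
  \<comment> \<open>Mapping the whole class and saturating avoids the choice of a
    representative.\<close>
  define f where "f A = boundary_rel ?D `` (map_prod g id ` A)" for A
  have f: "f (boundary_rel K `` {(z, s)}) = boundary_rel ?D `` {(g z, s)}" if "z \<in> K" for z s
  proof (cases "z \<in> frontier K")
    case True
    have "boundary_rel K `` {(z, s)} = {(z, Front), (z, Back)}"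
    proof -
      have "t = Front \<or> t = Back" for t by (cases t) auto
      then show ?thesis using True that by (auto simp: boundary_rel_def)
    qed
    then have "f (boundary_rel K `` {(z, s)}) = boundary_rel ?D `` {(g z, Front)} \<union> boundary_rel ?D `` {(g z, Back)}"
      by (auto simp: f_def)
    then show ?thesis using D.sheet_points_glued[OF gF[OF True]] by (metis sup.idem)
  next
    case False
    then have "boundary_rel K `` {(z, s)} = {(z, s)}" using that by (auto simp: boundary_rel_def)
    then show ?thesis by (simp add: f_def)
  qed
  show ?thesis
    unfolding doubled_disk_def
  proof (rule gromov_hausdorff_dist_le[where f = f])
    show "f ` mspace (doubling K) = mspace (doubling ?D)"
    proof (intro equalityI subsetI)
      fix B assume "B \<in> f ` mspace (doubling K)"
      then obtain A where A: "A \<in> mspace (doubling K)" "B = f A" by blast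
      from A(1) obtain z s where "z \<in> K" "A = boundary_rel K `` {(z, s)}" by (rule doubling_cases)
      then show "B \<in> mspace (doubling ?D)" using A(2) f D.doubling_memI[OF gD] by simp
    next
      fix B assume "B \<in> mspace (doubling ?D)"
      then obtain z s where z: "z \<in> ?D" "B = boundary_rel ?D `` {(z, s)}" by (rule D.doubling_cases)
      then have "z \<in> K" using disk by blast
      then have "B = f (boundary_rel K `` {(z, s)})" using z f gid by simp
      then show "B \<in> f ` mspace (doubling K)" using doubling_memI[OF \<open>z \<in> K\<close>] by blast
    qed
    fix A B assume "A \<in> mspace (doubling K)" "B \<in> mspace (doubling K)"
    then obtain z s w t where zw: "z \<in> K" "A = boundary_rel K `` {(z, s)}" "w \<in> K" "B = boundary_rel K `` {(w, t)}"
      by (meson doubling_cases)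
    show "mdist (doubling ?D) (f A) (f B) \<le> mdist (doubling K) A B"
      using zw less by (simp only: f mdist_sheet_points D.mdist_sheet_points gD)
    show "mdist (doubling K) A B \<le> mdist (doubling ?D) (f A) (f B) + 2 * (2 * e)"
      using zw more by (simp only: f mdist_sheet_points D.mdist_sheet_points gD)
  qed (use e in simp)
qed

lemma doubled_polygon_tendsto: "gromov_hausdorff_tendsto doubled_polygon doubled_disk sequentially"
proof -
  have lim0: "(\<lambda>n. pi / real n) \<longlonglongrightarrow> 0" by (rule lim_const_over_n)
  have lim: "(\<lambda>n. ennreal (2 * (1 / cos (pi / real n) - 1))) \<longlonglongrightarrow> ennreal (2 * (1 / cos 0 - 1))"
    by (intro tendsto_ennrealI tendsto_mult tendsto_diff tendsto_divide tendsto_const tendsto_cos lim0) simp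
  have bound: "gromov_hausdorff_dist (doubled_polygon n) doubled_disk \<le> ennreal (2 * (1 / cos (pi / real n) - 1))"
    if n: "3 \<le> n" for n
  proof -
    interpret circumscribed "regular_polygon n" "range (edge_normal n)" by (rule polygon_circumscribed[OF n])
    have "cos (pi / real n) < cos 0" using n by (intro cos_monotone_0_pi) (auto simp: field_simps)
    then have "0 < 1 / cos (pi / real n) - 1" using cos_pi_div_pos[OF n] by (simp add: field_simps)
    then show ?thesis
      unfolding doubled_polygon_def
      by (rule gromov_hausdorff_dist_doubled_disk) (use polygon_norm[OF n] in auto)
  qed
  show ?thesis
    unfolding gromov_hausdorff_tendsto_def
  proof (rule tendsto_sandwich[OF _ _ tendsto_const])
    show "\<forall>\<^sub>F n in sequentially. gromov_hausdorff_dist (doubled_polygon n) doubled_disk \<le> ennreal (2 * (1 / cos (pi / real n) - 1))"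
      using eventually_ge_at_top[of 3] by eventually_elim (rule bound)
    show "(\<lambda>n. ennreal (2 * (1 / cos (pi / real n) - 1))) \<longlonglongrightarrow> 0" using lim by simp
  qed simp
qed

section \<open>Minimizing indices and the failure of continuity\<close>

lemma minind_doubled_disk: "minind doubled_disk = 2"
  unfolding minind_def using doubled_disk_admits by (intro Least_equality) auto

text \<open>The \<open>1/2p\<close> geodesic guarantees that the least index is attained. Below any
  \<open>Z\<close> only finitely many indices have to be excluded, and each is excluded for all
  large primes.\<close>

lemma minind_doubled_polygon_at_top:
  "filterlim (\<lambda>p. minind (doubled_polygon p)) at_top (inf sequentially (principal {p. prime p}))"
  unfolding filterlim_at_top eventually_inf_principal
proof
  fix Z
  have "\<forall>\<^sub>F p in sequentially. \<forall>k\<in>{2..<Z}. prime p \<longrightarrow> \<not> admits_one_over_geodesic k (doubled_polygon p)"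
    by (intro eventually_ball_finite ballI eventually_no_polygon_geodesic) auto
  then show "\<forall>\<^sub>F p in sequentially. p \<in> {p. prime p} \<longrightarrow> Z \<le> minind (doubled_polygon p)"
    using eventually_ge_at_top[of 3]
  proof eventually_elim
    case (elim p)
    have "2 \<le> 2 * p \<and> admits_one_over_geodesic (2 * p) (doubled_polygon p)"
      using doubled_polygon_admits elim(2) by auto
    then have "2 \<le> minind (doubled_polygon p) \<and> admits_one_over_geodesic (minind (doubled_polygon p)) (doubled_polygon p)"
      unfolding minind_def by (rule LeastI)
    then show ?case using elim(1) by (metis atLeastLessThan_iff mem_Collect_eq not_le)
  qed
qed

theorem corollary1p4:
  shows "(\<exists>(M :: nat \<Rightarrow> (complex \<times> sheet) set metric) (N :: (complex \<times> sheet) set metric).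
            (\<forall>i. compact_space (mtopology_of (M i))) \<and> compact_space (mtopology_of N) \<and>
            (\<forall>i. \<exists>k\<ge>2. admits_one_over_geodesic k (M i)) \<and> (\<exists>k\<ge>2. admits_one_over_geodesic k N) \<and>
            gromov_hausdorff_tendsto M N sequentially \<and>
            \<not> (\<lambda>i. minind (M i)) \<longlonglongrightarrow> minind N) \<and>
         gromov_hausdorff_tendsto doubled_polygon doubled_disk
           (inf sequentially (principal {p. prime p})) \<and>
         filterlim (\<lambda>p. minind (doubled_polygon p)) at_top
           (inf sequentially (principal {p. prime p})) \<and>
         minind doubled_disk = 2"
proof (intro conjI)
  \<comment> \<open>A sequence has to consist of genuine polygons from its first term on, so the
    prime 2 is left out.\<close>
  let ?P = "{p :: nat. prime p \<and> 3 \<le> p}"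
  define P where "P = enumerate ?P"
  have "?P = {p. prime p} - {..<3}" by auto
  then have inf: "infinite ?P" using primes_infinite by (metis Diff_infinite_finite finite_lessThan)
  have P: "prime (P i)" "3 \<le> P i" for i
    using enumerate_in_set[OF inf, of i] by (auto simp: P_def)
  have seq: "filterlim P sequentially sequentially"
    unfolding P_def by (intro filterlim_subseq strict_mono_enumerate inf)
  have primes: "filterlim P (inf sequentially (principal {p. prime p})) sequentially"
    unfolding filterlim_inf filterlim_principal using seq P by simp
  have "compact_space (mtopology_of (doubled_polygon (P i)))" for i
  proof -
    interpret circumscribed "regular_polygon (P i)" "range (edge_normal (P i))"
      by (rule polygon_circumscribed[OF P(2)])
    show ?thesis unfolding doubled_polygon_def by (rule compact_space_doubling)
  qed
  moreover have "compact_space (mtopology_of doubled_disk)"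
  proof -
    interpret circumscribed "cball 0 1" "sphere 0 1" by (rule disk_circumscribed)
    show ?thesis unfolding doubled_disk_def by (rule compact_space_doubling)
  qed
  moreover have "\<exists>k\<ge>2. admits_one_over_geodesic k (doubled_polygon (P i))" for i
    using doubled_polygon_admits[OF P(2), of i] P(2)[of i] by (intro exI[of _ "2 * P i"]) simp
  moreover have "\<exists>k\<ge>2. admits_one_over_geodesic k doubled_disk"
    using doubled_disk_admits by auto
  moreover have "gromov_hausdorff_tendsto (\<lambda>i. doubled_polygon (P i)) doubled_disk sequentially"
    using doubled_polygon_tendsto seq unfolding gromov_hausdorff_tendsto_def by (rule filterlim_compose)
  moreover have "\<not> (\<lambda>i. minind (doubled_polygon (P i))) \<longlonglongrightarrow> minind doubled_disk"
  proof
    assume "(\<lambda>i. minind (doubled_polygon (P i))) \<longlonglongrightarrow> minind doubled_disk"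
    \<comment> \<open>A convergent sequence of natural numbers is eventually constant.\<close>
    then have "\<forall>\<^sub>F i in sequentially. minind (doubled_polygon (P i)) = 2"
      by (simp add: tendsto_discrete minind_doubled_disk)
    moreover have "\<forall>\<^sub>F i in sequentially. 3 \<le> minind (doubled_polygon (P i))"
      using filterlim_compose[OF minind_doubled_polygon_at_top primes] by (simp add: filterlim_at_top)
    ultimately have "\<forall>\<^sub>F i :: nat in sequentially. False" by eventually_elim simp
    then show False by simp
  qed
  ultimately show "\<exists>(M :: nat \<Rightarrow> (complex \<times> sheet) set metric) (N :: (complex \<times> sheet) set metric).
      (\<forall>i. compact_space (mtopology_of (M i))) \<and> compact_space (mtopology_of N) \<and>
      (\<forall>i. \<exists>k\<ge>2. admits_one_over_geodesic k (M i)) \<and> (\<exists>k\<ge>2. admits_one_over_geodesic k N) \<and>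
      gromov_hausdorff_tendsto M N sequentially \<and> \<not> (\<lambda>i. minind (M i)) \<longlonglongrightarrow> minind N"
    by (intro exI[of _ "\<lambda>i. doubled_polygon (P i)"] exI[of _ doubled_disk]) blast
  show "gromov_hausdorff_tendsto doubled_polygon doubled_disk (inf sequentially (principal {p. prime p}))"
    using doubled_polygon_tendsto unfolding gromov_hausdorff_tendsto_def by (rule tendsto_mono[rotated]) simp
qed (fact minind_doubled_polygon_at_top minind_doubled_disk)+

end
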